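(* Let $G$ be a finite group. Suppose either that $G$ is the direct product of an odd-order group and a $2$-group, or that $G$ is a group of order $2n$ where $n$ is odd and all elements of $G$ of even order are involutions. Then $$\left( \frac{m}{G} \right)_{el} =\left( \frac{d_G}{m} \right)$$ for all integers $m$ such that $(m,|G|)=1$.
   Context: For a finite group $G$ and an integer $a$ with $(a,|G|)=1$, the map $\rho_a:G\to G$, $g\mapsto g^a$, is a permutation of the set $G$; $\left(\frac{a}{G}\right)_{el}\in\{1,-1\}$ denotes its signature. For a non-negative integer $m$, $f_m(G)=\{g\in G: g^m=1\}$. Let $n_2(G)$ be the number of Sylow $2$-subgroups of $G$, and let $\epsilon(G)=1$ if $|G|=2n_2(G)$ and $\epsilon(G)=0$ otherwise. Define $$d_G:= (-1)^{\frac{|G|-|f_{2}(G)|}{2}}\,\frac{|G|^{|f_{2}(G)|}}{n_2(G)^{\epsilon(G)}}.$$ $\left(\frac{n}{a}\right)$ is the Kronecker symbol for integers $n,a$: it is the Legendre symbol when $a$ is an odd prime, and it is determined by $\left(\frac{n}{a}\right)\left(\frac{n}{b}\right)=\left(\frac{n}{ab}\right)$; $\left(\frac{n}{2}\right)=0$ if $n$ is even, $1$ if $n\equiv 1,7 \pmod 8$, $-1$ if $n\equiv 3,5\pmod 8$; $\left(\frac{n}{-1}\right)=1$ if $n\ge 0$ and $-1$ if $n<0$; $\left(\frac{n}{0}\right)=1$ if $n=1$ and $0$ if $n\neq 1$. Convention: when $a$ is not odd and positive, the symbol $\left(\frac{n}{a}\right)$ is used only for $n\equiv 0,1\pmod 4$.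 *)

theory Defs
  imports
    "HOL-Combinatorics.Permutations"
    "HOL-Number_Theory.Residues"
    "HOL-Algebra.Multiplicative_Group"
begin

section \<open>The Kronecker symbol\<close>

definition kronecker_prime :: "int \<Rightarrow> int \<Rightarrow> int" where
  "kronecker_prime n p =
     (if p = 2 then (if even n then 0 else if n mod 8 \<in> {1, 7} then 1 else -1)
      else Legendre n p)"

definition kronecker_neg1 :: "int \<Rightarrow> int" where
  "kronecker_neg1 n = (if n \<ge> 0 then 1 else -1)"

text \<open>
  The symbol \<open>(n/a)\<close>. For nonzero \<open>a\<close> it is the multiplicative extension in \<open>a\<close> of the values at
  \<open>-1\<close> and at the primes; \<open>prime_factorization a\<close> consists of the positive primes dividing \<open>a\<close>,
  so the sign of \<open>a\<close> has to be treated separately. The value for \<open>a = 0\<close> is \<open>1\<close> only at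
  \<open>n = 1\<close> (not also at \<open>n = -1\<close>, as in some other conventions). The function is total: the
  convention restricting even or nonpositive \<open>a\<close> to \<open>n\<close> congruent to \<open>0\<close> or \<open>1\<close> modulo \<open>4\<close> is
  not built in.
\<close>

definition kronecker :: "int \<Rightarrow> int \<Rightarrow> int" where
  "kronecker n a =
     (if a = 0 then (if n = 1 then 1 else 0)
      else (if a < 0 then kronecker_neg1 n else 1)
           * (\<Prod>p\<in>#prime_factorization a. kronecker_prime n p))"

lemma kronecker_0: "kronecker n 0 = (if n = 1 then 1 else 0)"
  by (simp add: kronecker_def)

lemma kronecker_1: "kronecker n 1 = 1"
  by (simp add: kronecker_def)

lemma kronecker_minus_1: "kronecker n (-1) = (if n \<ge> 0 then 1 else -1)"
proof -
  have "prime_factorization (-1 :: int) = {#}"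
    by (simp add: prime_factorization_empty_iff)
  then show ?thesis by (simp add: kronecker_def kronecker_neg1_def)
qed

lemma kronecker_2:
  "kronecker n 2 = (if even n then 0 else if n mod 8 \<in> {1, 7} then 1 else -1)"
  by (simp add: kronecker_def kronecker_prime_def prime_factorization_prime)

lemma kronecker_odd_prime:
  assumes "prime p" "odd p"
  shows "kronecker n p = Legendre n p"
proof -
  have "p > 0" "p \<noteq> 2" using assms by (auto simp: prime_gt_0_int)
  then show ?thesis
    by (simp add: kronecker_def kronecker_prime_def prime_factorization_prime assms(1))
qed

lemma kronecker_1_left: "kronecker 1 a = 1"
proof -
  have "kronecker_prime 1 p = 1" if "p \<in># prime_factorization a" for p
  proof (cases "p = 2")
    case False
    have "prime p" using that by (simp add: in_prime_factors_iff)
    then have "\<not> p dvd 1" by (metis not_prime_unit)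
    moreover have "QuadRes p 1" unfolding QuadRes_def by (rule exI[of _ 1]) simp
    ultimately show ?thesis
      using False by (simp add: kronecker_prime_def Legendre_def cong_0_iff)
  qed (simp add: kronecker_prime_def)
  then have "(\<Prod>p\<in>#prime_factorization a. kronecker_prime 1 p) = (\<Prod>p\<in>#prime_factorization a. 1)"
    by (metis (mono_tags, lifting) image_mset_cong)
  then show ?thesis by (simp add: kronecker_def kronecker_neg1_def)
qed

lemma kronecker_mult: "kronecker n (a * b) = kronecker n a * kronecker n b"
proof (cases "a = 0 \<or> b = 0")
  case True
  then show ?thesis
    by (cases "n = 1") (auto simp: kronecker_0 kronecker_1_left)
next
  case False
  have "kronecker_neg1 n * kronecker_neg1 n = 1" by (simp add: kronecker_neg1_def)
  then show ?thesis using False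
    by (auto simp: kronecker_def prime_factorization_mult mult_less_0_iff algebra_simps)
qed


section \<open>The elementary symbol of a finite group\<close>

text \<open>
  The library's \<open>sign\<close> is defined for permutations of the whole type, so the power map is extended
  by the identity outside the carrier; this does not affect the signature.
\<close>

definition power_perm :: "int \<Rightarrow> ('a, 'b) monoid_scheme \<Rightarrow> 'a \<Rightarrow> 'a" where
  "power_perm a G = restrict_id (\<lambda>g. g [^]\<^bsub>G\<^esub> a) (carrier G)"

definition elementary_symbol :: "int \<Rightarrow> ('a, 'b) monoid_scheme \<Rightarrow> int" where
  "elementary_symbol a G = sign (power_perm a G)"

lemma power_perm_permutes:
  assumes "group G" "finite (carrier G)" "coprime a (int (order G))"
  shows "power_perm a G permutes carrier G"
proof -
  interpret group G by fact
  obtain u v where uv: "u * a + v * int (order G) = 1"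
    using assms(3) by (metis bezout_int coprime_iff_gcd_eq_1)
  have inv: "(g [^]\<^bsub>G\<^esub> a) [^]\<^bsub>G\<^esub> u = g" if g: "g \<in> carrier G" for g
  proof -
    have "g = g [^]\<^bsub>G\<^esub> (a * u + int (order G) * v)"
      using uv g by (simp add: mult.commute)
    also have "\<dots> = (g [^]\<^bsub>G\<^esub> a) [^]\<^bsub>G\<^esub> u \<otimes>\<^bsub>G\<^esub> (g [^]\<^bsub>G\<^esub> int (order G)) [^]\<^bsub>G\<^esub> v"
      using g by (simp add: int_pow_mult int_pow_pow)
    also have "\<dots> = (g [^]\<^bsub>G\<^esub> a) [^]\<^bsub>G\<^esub> u"
      using g by (simp add: int_pow_int pow_order_eq_1)
    finally show ?thesis by simp
  qed
  have "inj_on (\<lambda>g. g [^]\<^bsub>G\<^esub> a) (carrier G)"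
    by (rule inj_on_inverseI[of _ "\<lambda>h. h [^]\<^bsub>G\<^esub> u"]) (rule inv)
  moreover have "(\<lambda>g. g [^]\<^bsub>G\<^esub> a) ` carrier G \<subseteq> carrier G" by auto
  ultimately have "bij_betw (\<lambda>g. g [^]\<^bsub>G\<^esub> a) (carrier G) (carrier G)"
    using assms(2) by (simp add: bij_betw_def endo_inj_surj)
  then show ?thesis
    unfolding power_perm_def
    by (intro bij_imp_permutes) (auto simp: restrict_id_def cong: bij_betw_cong)
qed


section \<open>The discriminant of a finite group\<close>

definition torsion_set :: "nat \<Rightarrow> ('a, 'b) monoid_scheme \<Rightarrow> 'a set" where
  "torsion_set m G = {g \<in> carrier G. g [^]\<^bsub>G\<^esub> m = \<one>\<^bsub>G\<^esub>}"

definition sylow_subgroups :: "nat \<Rightarrow> ('a, 'b) monoid_scheme \<Rightarrow> 'a set set" where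
  "sylow_subgroups p G = {H. subgroup H G \<and> card H = p ^ multiplicity p (order G)}"

definition num_sylow2 :: "('a, 'b) monoid_scheme \<Rightarrow> nat" where
  "num_sylow2 G = card (sylow_subgroups 2 G)"

definition sylow2_eps :: "('a, 'b) monoid_scheme \<Rightarrow> nat" where
  "sylow2_eps G = (if order G = 2 * num_sylow2 G then 1 else 0)"

text \<open>
  Both divisions are exact: elements with \<open>g\<^sup>2 \<noteq> 1\<close> pair off with their inverses,
  and see \<open>num_sylow2_dvd\<close> below.
\<close>

definition group_disc :: "('a, 'b) monoid_scheme \<Rightarrow> int" where
  "group_disc G =
     (-1) ^ ((order G - card (torsion_set 2 G)) div 2)
     * (int (order G) ^ card (torsion_set 2 G) div int (num_sylow2 G) ^ sylow2_eps G)"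

lemma num_sylow2_dvd:
  assumes "group G" "finite (carrier G)"
  shows "int (num_sylow2 G) ^ sylow2_eps G dvd int (order G) ^ card (torsion_set 2 G)"
proof -
  interpret group G by fact
  have "\<one>\<^bsub>G\<^esub> \<in> torsion_set 2 G" by (simp add: torsion_set_def)
  moreover have "finite (torsion_set 2 G)" using assms(2) by (simp add: torsion_set_def)
  ultimately have "card (torsion_set 2 G) \<noteq> 0" by auto
  then have "int (order G) dvd int (order G) ^ card (torsion_set 2 G)"
    by (simp add: dvd_power)
  then show ?thesis by (auto simp: sylow2_eps_def intro: dvd_trans)
qed


section \<open>The two classes of groups\<close>

text \<open>
  The factors may be taken over the element type of \<open>G\<close> without loss of generality, as they embed
  in \<open>G\<close>. They are automatically finite: \<open>order\<close> is \<open>0\<close>, hence even and not a power of \<open>2\<close>, for an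
  infinite carrier.
\<close>

definition odd_times_2group :: "('a, 'b) monoid_scheme \<Rightarrow> bool" where
  "odd_times_2group G \<longleftrightarrow>
     (\<exists>(H :: 'a monoid) (K :: 'a monoid).
        group H \<and> group K \<and> odd (order H) \<and> (\<exists>k. order K = 2 ^ k) \<and> G \<cong> H \<times>\<times> K)"

definition even_order_elements_are_involutions :: "('a, 'b) monoid_scheme \<Rightarrow> bool" where
  "even_order_elements_are_involutions G \<longleftrightarrow>
     (\<forall>g \<in> carrier G. even (group.ord G g) \<longrightarrow> group.ord G g = 2)"

end

theory Submission
  imports Defs "HOL-Number_Theory.Quadratic_Reciprocity" "Jordan_Normal_Form.Determinant"
begin

text \<open>
  Suppose first that \<open>G\<close> has odd order and \<open>q\<close> is an odd prime not dividing it. Modulo \<open>q\<close>, the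
  \<open>q\<close>-th convolution power of a class function \<open>f\<close> is \<open>f\<close> transported along \<open>x \<mapsto> x ^ q\<close>, so the power
  map acts on the ring of class functions as the Frobenius endomorphism. As no \<open>x \<noteq> 1\<close> is conjugate
  to its inverse, the odd class functions and the even class functions of sum zero have the same
  rank, and multiplication by a suitable odd function \<open>d\<close> is an isomorphism modulo \<open>q\<close> from the
  latter to the former. Comparing multiplication by \<open>d\<close> with multiplication by its Frobenius image
  \<open>d ^ q = d (d\<^sup>2) ^ ((q - 1) / 2)\<close> identifies the signature of the power map, which Gauss's lemma expresses
  through the classes, with the Legendre symbol of the determinant of \<open>d\<^sup>2\<close>; the Gram determinants
  of the form \<open>(f * h)(1)\<close> evaluate it to \<open>(\<plusminus>|G| / q)\<close>. This replaces the discriminant of the character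
  table by elementary linear algebra over the integers modulo \<open>q\<close>. Reciprocity and periodicity
  extend the result to all \<open>m\<close>.

  A \<open>2\<close>-group only sees \<open>m\<close> modulo \<open>4\<close>, because Gauss's lemma applies with a half system invariant
  under the \<open>m\<close>-th power map when \<open>m \<equiv> 1\<close>. A group of order \<open>2n\<close>, \<open>n\<close> odd, has a subgroup of index 2,
  the kernel of the sign of its regular representation, and the remaining elements are involutions.
\<close>

hide_const (open) Polynomial.order

section \<open>Signs of permutations\<close>

text \<open>For a non-abelian group the power map need not be a homomorphism, so it gives no
  endomorphism of the whole group ring; the centre modulo \<open>q\<close> is where it does, whence
  class functions and congruences. The signature is then a quotient of two determinants. The
  non-trivial classes form \<open>r\<close> pairs of mutually inverse ones. On even functions the
  power map permutes these pairs; on odd functions it induces the same permutation with signs, and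
  the product of the signs is what Gauss's lemma computes. The sum-zero condition removes the one
  dimension that the identity adds on the even side. The function \<open>d\<close> is far from
  unique but matters only up to squares: \<open>det(d)^2 (-1)^r = det(d^2) |G|\<close>, so the
  symbol of \<open>det(d^2)\<close> is that of \<open>(-1)^r |G|\<close>, and as all classes have
  odd size this is \<open>|G|\<close> with the sign making it 1 modulo 4. For \<open>q = 2\<close>
  the power \<open>d ^ q\<close> would not be odd; an even \<open>m\<close> is reached by adding the
  odd order. In even order the power of \<open>|G|\<close> in the discriminant is a square, so
  besides the sign only the division by the number of Sylow subgroups can leave a
  non-square.\<close>

lemma sign_on_Un:
  assumes "finite A" "finite B" "A \<inter> B = {}" "bij_betw f A A" "bij_betw f B B"
  shows "sign_on (A \<union> B) f = sign_on A f * sign_on B f"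
proof -
  have "restrict_id f (A \<union> B) = restrict_id f A \<circ> restrict_id f B"
    using assms(3-5) by (auto simp: fun_eq_iff restrict_id_def bij_betw_def)
  then show ?thesis
    unfolding sign_on_def
    by (metis assms(1,2,4,5) permutes_imp_permutation permutes_restrict_id sign_compose)
qed

lemma sign_on_conj:
  assumes "finite A" "bij_betw k A B" "bij_betw f A A" "\<And>x. x \<in> A \<Longrightarrow> k (f x) = g (k x)"
  shows "sign_on B g = sign_on A f"
proof -
  have B: "B = k ` A" and inj: "inj_on k A" using assms(2) by (auto simp: bij_betw_def)
  have "restrict_id g B = map_permutation A k (restrict_id f A)"
    unfolding map_permutation_def B
    using assms(4) inj by (auto simp: fun_eq_iff restrict_id_def inv_into_f_f)
  then show ?thesis
    unfolding sign_on_def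
    using sign_map_permutation[OF inj permutes_restrict_id[OF assms(3)] assms(1)] by simp
qed

lemma sign_on_double:
  assumes "finite T" "bij_betw k T T'" "T \<inter> T' = {}" "bij_betw f T T"
    and "\<And>x. x \<in> T \<Longrightarrow> k (f x) = f (k x)"
  shows "sign_on (T \<union> T') f = 1"
proof -
  have fT': "finite T'" using assms(1,2) bij_betw_finite by blast
  have "bij_betw f T' T'"
  proof -
    have T': "T' = k ` T" using assms(2) by (simp add: bij_betw_def)
    have "f ` T' = k ` f ` T" unfolding T' image_image using assms(5) by (auto intro!: image_cong)
    then have "f ` T' = T'" using assms(4) T' by (simp add: bij_betw_def)
    then show ?thesis using fT' by (simp add: bij_betw_def eq_card_imp_inj_on)
  qed
  then have "sign_on (T \<union> T') f = sign_on T f * sign_on T' f"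
    using assms fT' by (intro sign_on_Un)
  moreover have "sign_on T' f = sign_on T f"
    using assms by (intro sign_on_conj)
  ultimately show ?thesis by (simp add: sign_on_def)
qed

lemma sign_on_fixed: "(\<And>x. x \<in> A \<Longrightarrow> f x = x) \<Longrightarrow> sign_on A f = 1"
  using sign_on_cong[of A A f "\<lambda>x. x"] by simp

lemma sign_on_swap:
  assumes "finite T" "inj_on k T" "T \<inter> k ` T = {}"
    and "\<And>x. x \<in> T \<Longrightarrow> f x = k x" "\<And>x. x \<in> T \<Longrightarrow> f (k x) = x"
  shows "sign_on (T \<union> k ` T) f = (-1) ^ card T"
  using assms
proof (induction T rule: finite_induct)
  case empty
  then show ?case by (simp add: sign_on_def restrict_id_def flip: id_def)
next
  case (insert a T)
  have bij: "bij_betw f (T \<union> k ` T) (T \<union> k ` T)"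
    using insert.prems by (intro bij_betw_byWitness[where f' = f]) auto
  have bija: "bij_betw f {a, k a} {a, k a}"
    using insert.prems by (intro bij_betw_byWitness[where f' = f]) auto
  have ne: "a \<noteq> k a" using insert.prems by auto
  have "sign_on ({a, k a} \<union> (T \<union> k ` T)) f = sign_on {a, k a} f * sign_on (T \<union> k ` T) f"
    using insert by (intro sign_on_Un bij bija) (auto dest: inj_onD)
  moreover have "sign_on {a, k a} f = sign_on {a, k a} (transpose a (k a))"
    using insert.prems ne by (intro sign_on_cong) auto
  then have "sign_on {a, k a} f = -1" using ne by (simp add: sign_on_transpose)
  moreover have "sign_on (T \<union> k ` T) f = (-1) ^ card T"
    using insert by (intro insert.IH) auto
  moreover have "insert a T \<union> k ` insert a T = {a, k a} \<union> (T \<union> k ` T)" by auto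
  ultimately show ?case using insert.hyps by simp
qed

text \<open>Gauss's lemma for any permutation commuting with an involution \<open>j\<close>. The
  condition on \<open>T\<close> makes \<open>j\<close> fixed-point free and puts one element of each
  pair into \<open>T\<close>. Correcting \<open>f\<close> by swaps of the pairs where it leaves
  \<open>T\<close> gives a permutation preserving \<open>T\<close>, whose sign is 1 because it acts
  alike on both halves; each swap costs a factor -1.\<close>

lemma sign_on_gauss:
  assumes "finite X" "bij_betw f X X"
    and j: "\<And>x. x \<in> X \<Longrightarrow> j x \<in> X" "\<And>x. x \<in> X \<Longrightarrow> j (j x) = x"
    and T: "T \<subseteq> X" "\<And>x. x \<in> X \<Longrightarrow> j x \<in> T \<longleftrightarrow> x \<notin> T"
    and fj: "\<And>x. x \<in> X \<Longrightarrow> f (j x) = j (f x)"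
  shows "sign_on X f = (-1) ^ card {x \<in> T. f x \<notin> T}"
proof -
  have fX: "f x \<in> X" if "x \<in> X" for x using assms(2) that by (auto simp: bij_betw_def)
  have inj_f: "inj_on f X" using assms(2) by (simp add: bij_betw_def)
  have inj_j: "inj_on j X" using j(2) by (metis inj_onI)
  define U where "U = f ` {x \<in> T. f x \<notin> T}"
  have UX: "U \<subseteq> X" using T(1) fX by (auto simp: U_def)
  have UT: "U \<inter> T = {}" by (auto simp: U_def)
  have jUT: "j ` U \<subseteq> T" using UX UT T(2) by auto
  define s where "s y = (if y \<in> U \<union> j ` U then j y else y)" for y
  have ss: "s (s y) = y" and sX: "s y \<in> X" if "y \<in> X" for y
    using that UX j by (auto simp: s_def)
  have jUiff: "j y \<in> U \<union> j ` U \<longleftrightarrow> y \<in> U \<union> j ` U" if "y \<in> X" for y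
  proof -
    have "x \<in> U \<union> j ` U \<Longrightarrow> j x \<in> U \<union> j ` U" for x using UX j(2) by auto
    from this[of y] this[of "j y"] show ?thesis using j(2)[OF that] by auto
  qed
  have sj: "s (j y) = j (s y)" if "y \<in> X" for y
    using that jUiff by (simp add: s_def)
  have bs: "bij_betw s X X"
    by (intro bij_betw_byWitness[where f' = s]) (auto simp: ss sX)
  have bU: "bij_betw s (U \<union> j ` U) (U \<union> j ` U)"
    using UX j(2) by (intro bij_betw_byWitness[where f' = s]) (auto simp: s_def subset_iff)
  have bnU: "bij_betw s (X - (U \<union> j ` U)) (X - (U \<union> j ` U))"
    by (intro bij_betw_byWitness[where f' = s]) (auto simp: s_def)
  have "sign_on ((U \<union> j ` U) \<union> (X - (U \<union> j ` U))) s
      = sign_on (U \<union> j ` U) s * sign_on (X - (U \<union> j ` U)) s"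
    using UX assms(1) by (intro sign_on_Un bU bnU) (auto intro: finite_subset)
  moreover have "sign_on (X - (U \<union> j ` U)) s = 1"
    by (intro sign_on_fixed) (auto simp: s_def)
  moreover have "sign_on (U \<union> j ` U) s = (-1) ^ card U"
    using UX UT jUT j inj_j assms(1)
    by (intro sign_on_swap) (auto simp: s_def intro: finite_subset inj_on_subset)
  moreover have "(U \<union> j ` U) \<union> (X - (U \<union> j ` U)) = X" using UX j by auto
  ultimately have sign_s: "sign_on X s = (-1) ^ card U" by simp
  have card_U: "card U = card {x \<in> T. f x \<notin> T}"
    unfolding U_def by (intro card_image inj_on_subset[OF inj_f]) (use T in auto)
  define g where "g = s \<circ> f"
  have gX: "bij_betw g X X" unfolding g_def using assms(2) bs by (rule bij_betw_trans)
  have "sign_on X f = sign_on X (s \<circ> g)"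
    by (intro sign_on_cong) (auto simp: g_def ss fX)
  also have "\<dots> = sign_on X s * sign_on X g"
    by (intro sign_on_compose bs gX assms(1))
  also have "sign_on X g = 1"
  proof -
    have gT: "g x \<in> T" if "x \<in> T" for x
    proof (cases "f x \<in> T")
      case True
      \<comment> \<open>Otherwise \<open>f\<close> would agree on \<open>x\<close> and on some
        \<open>j y\<close> with \<open>y\<close> in \<open>T\<close>, so \<open>x = j y\<close>
        would lie outside \<open>T\<close>.\<close>
      have "f x \<notin> j ` U"
      proof
        assume "f x \<in> j ` U"
        then obtain y where y: "y \<in> T" "f y \<notin> T" "f x = j (f y)" by (auto simp: U_def)
        then have "f x = f (j y)" using fj T(1) by auto
        then have "x = j y" using inj_f that y(1) T(1) j(1) by (auto dest: inj_onD)
        then show False using that y(1) T by auto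
      qed
      then show ?thesis using True UT by (auto simp: g_def s_def)
    next
      case False
      then have "f x \<in> U" using that by (auto simp: U_def)
      then show ?thesis using False T fX that by (auto simp: g_def s_def)
    qed
    have "inj_on g T" using gX T(1) by (auto simp: bij_betw_def intro: inj_on_subset)
    then have "bij_betw g T T"
      using endo_inj_surj[OF finite_subset[OF T(1) assms(1)], of g] gT by (auto simp: bij_betw_def)
    moreover have "bij_betw j T (X - T)"
      using T j by (intro bij_betw_byWitness[where f' = j]) auto
    moreover have "j (g x) = g (j x)" if "x \<in> T" for x
      using that T(1) fX sj fj by (auto simp: g_def)
    ultimately have "sign_on (T \<union> (X - T)) g = 1"
      using finite_subset[OF T(1) assms(1)] by (intro sign_on_double[where k = j]) auto
    then show ?thesis using T(1) by (simp add: Un_absorb1)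
  qed
  finally show ?thesis using sign_s card_U by simp
qed

section \<open>Reciprocity for the Kronecker symbol\<close>

lemma Legendre_values: "Legendre a p \<in> {-1, 0, 1}"
  by (auto simp: Legendre_def)

lemma Legendre_eqI:
  assumes "p > 2" "x \<in> {-1, 0, 1 :: int}" "[Legendre a p = x] (mod p)"
  shows "Legendre a p = x"
proof -
  have "p dvd Legendre a p - x" using assms(3) by (simp add: cong_iff_dvd_diff)
  moreover have "\<bar>Legendre a p - x\<bar> < p"
    using assms(1,2) Legendre_values[of a p] by auto
  ultimately show ?thesis using dvd_imp_le_int[of "Legendre a p - x" p] assms(1) by force
qed

lemma Legendre_euler:
  assumes "prime p" "p > 2"
  shows "[Legendre a p = a ^ nat ((p - 1) div 2)] (mod p)"
proof -
  have p: "p = int (nat p)" using assms by simp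
  have "prime (nat p)" "2 < nat p" using assms by auto
  from euler_criterion[OF this, of a]
  have "[Legendre a p = a ^ ((nat p - 1) div 2)] (mod p)" using p by simp
  moreover have "nat ((p - 1) div 2) = (nat p - 1) div 2"
    using assms(2) by (simp add: nat_div_distrib nat_diff_distrib)
  ultimately show ?thesis by simp
qed

lemma Legendre_mult:
  assumes "prime p" "p > 2"
  shows "Legendre (a * b) p = Legendre a p * Legendre b p"
proof (rule Legendre_eqI[OF assms(2)])
  show "Legendre a p * Legendre b p \<in> {- 1, 0, 1}"
    using Legendre_values[of a p] Legendre_values[of b p] by auto
  have "[Legendre (a * b) p = a ^ nat ((p - 1) div 2) * b ^ nat ((p - 1) div 2)] (mod p)"
    using Legendre_euler[OF assms, of "a * b"] by (simp add: power_mult_distrib)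
  moreover have "[a ^ nat ((p - 1) div 2) * b ^ nat ((p - 1) div 2) = Legendre a p * Legendre b p] (mod p)"
    by (intro cong_mult cong_sym[OF Legendre_euler[OF assms]])
  ultimately show "[Legendre (a * b) p = Legendre a p * Legendre b p] (mod p)"
    by (rule cong_trans)
qed

lemma Legendre_minus_one:
  assumes "prime p" "p > 2"
  shows "Legendre (-1) p = (if p mod 4 = 1 then 1 else -1)"
proof -
  have "odd p" using assms prime_odd_int by blast
  then have "even (nat ((p - 1) div 2)) \<longleftrightarrow> p mod 4 = 1"
    using assms(2) by (auto simp: even_nat_iff) presburger+
  then have "(-1) ^ nat ((p - 1) div 2) = (if p mod 4 = 1 then 1 else -1 :: int)" by auto
  then show ?thesis
    using Legendre_euler[OF assms, of "-1"] by (intro Legendre_eqI assms) auto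
qed

text \<open>Gauss's lemma for the multiplier 2: with \<open>n = (p - 1) div 2\<close>, the doubles
  of \<open>1, ..., n\<close> do not wrap around modulo \<open>p\<close>, so the exponent counts the
  \<open>x \<le> n\<close> with \<open>2 * x > n\<close>. There are \<open>n - n div 2\<close> of
  them, a parity visible modulo 8.\<close>

lemma Legendre_two:
  assumes "prime p" "p > 2"
  shows "Legendre 2 p = (if p mod 8 \<in> {1, 7} then 1 else -1)"
proof -
  define n where "n = (p - 1) div 2"
  have "odd p" using assms prime_odd_int by blast
  then have pn: "p = 2 * n + 1" by (simp add: n_def)
  have n0: "n \<ge> 1" using assms(2) pn by auto
  interpret GAUSS "nat p" 2
    using assms by unfold_locales (auto simp: cong_0_iff zdvd_not_zless)
  have A: "A = {0<..n}" using assms by (simp add: A_def n_def)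
  have "C = (\<lambda>x. x * 2) ` A"
  proof -
    have "x * 2 mod int (nat p) = x * 2" if "x \<in> A" for x
      using that A pn assms by (intro mod_pos_pos_trivial) auto
    then show ?thesis unfolding C_def B_def image_image by (intro image_cong) auto
  qed
  then have "E = (\<lambda>x. x * 2) ` {n div 2<..n}"
    using n0 assms(2) by (auto simp: E_def A simp flip: n_def)
  then have "card E = nat (n - n div 2)"
    by (simp add: card_image inj_on_def)
  then have "Legendre 2 p = (-1) ^ nat (n - n div 2)"
    using gauss_lemma assms(2) by simp
  moreover have "even (nat (n - n div 2)) \<longleftrightarrow> p mod 8 \<in> {1, 7}"
    using n0 pn by (auto simp: even_nat_iff) presburger+
  ultimately show ?thesis by auto
qed

lemma kronecker_prime_mult:
  assumes "prime p"
  shows "kronecker_prime (a * b) p = kronecker_prime a p * kronecker_prime b p"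
proof (cases "p = 2")
  case True
  \<comment> \<open>The value at 2 depends only on the numerator modulo 8, which reduces
    multiplicativity to a finite table of residues.\<close>
  define F :: "int \<Rightarrow> int" where
    "F r = (if r = 1 \<or> r = 7 then 1 else if r = 3 \<or> r = 5 then -1 else 0)" for r
  have F: "kronecker_prime n 2 = F (n mod 8)" for n
  proof -
    have "even n \<longleftrightarrow> n mod 8 \<noteq> 1 \<and> n mod 8 \<noteq> 3 \<and> n mod 8 \<noteq> 5 \<and> n mod 8 \<noteq> 7" by presburger
    then show ?thesis by (auto simp: kronecker_prime_def F_def)
  qed
  have S: "{0..<8} = {0, 1, 2, 3, 4, 5, 6, 7 :: int}" by auto
  have "\<forall>r\<in>{0..<8}. \<forall>s\<in>{0..<8}. F (r * s mod 8) = F r * F s"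
    unfolding S by (simp add: F_def)
  moreover have "a mod 8 \<in> {0..<8}" "b mod 8 \<in> {0..<8}" by auto
  ultimately have "F ((a mod 8) * (b mod 8) mod 8) = F (a mod 8) * F (b mod 8)" by blast
  then show ?thesis using True by (simp add: F mod_mult_eq)
next
  case False
  then have "p > 2" using prime_ge_2_int[OF assms] by simp
  then show ?thesis using False by (simp add: kronecker_prime_def Legendre_mult assms)
qed

text \<open>The exclusions matter: the symbol at \<open>-1\<close> treats 0 as positive, so the
  numerators 0 and -1 violate the rule at \<open>m = -1\<close>, and at \<open>m = 0\<close> the
  numerators -1 and -1 do.\<close>

lemma kronecker_mult_left:
  assumes "a \<noteq> 0" "b \<noteq> 0" "m \<noteq> 0"
  shows "kronecker (a * b) m = kronecker a m * kronecker b m"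
proof -
  have "image_mset (kronecker_prime (a * b)) (prime_factorization m)
      = image_mset (\<lambda>p. kronecker_prime a p * kronecker_prime b p) (prime_factorization m)"
    by (intro image_mset_cong kronecker_prime_mult) (simp add: in_prime_factors_iff)
  moreover have "kronecker_neg1 (a * b) = kronecker_neg1 a * kronecker_neg1 b"
    using assms by (auto simp: kronecker_neg1_def zero_le_mult_iff)
  ultimately show ?thesis using assms by (simp add: kronecker_def prod_mset.distrib)
qed

lemma kronecker_prime_coprime:
  assumes "prime p" "\<not> p dvd n"
  shows "kronecker_prime n p \<in> {1, -1}"
  using assms by (auto simp: kronecker_prime_def Legendre_def cong_0_iff)

lemma kronecker_coprime:
  assumes "coprime n m" "m \<noteq> 0"
  shows "kronecker n m \<in> {1, -1}"
proof -
  have "(\<Prod>p\<in>#M. kronecker_prime n p) \<in> {1, -1}"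
    if "\<And>p. p \<in># M \<Longrightarrow> prime p \<and> \<not> p dvd n" for M
    using that
  proof (induction M)
    case (add p M)
    then have "(\<Prod>p\<in>#M. kronecker_prime n p) \<in> {1, -1}" by simp
    moreover have "prime p" "\<not> p dvd n" using add.prems[of p] by simp_all
    then have "kronecker_prime n p \<in> {1, -1}" by (rule kronecker_prime_coprime)
    ultimately show ?case by auto
  qed auto
  moreover have "prime p \<and> \<not> p dvd n" if "p \<in># prime_factorization m" for p
    using that assms(1)
    by (auto simp: in_prime_factors_iff dest: coprime_common_divisor not_prime_unit)
  ultimately have "(\<Prod>p\<in>#prime_factorization m. kronecker_prime n p) \<in> {1, -1}" by blast
  then show ?thesis using assms(2) by (auto simp: kronecker_def kronecker_neg1_def)
qed

lemma kronecker_square_mult: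
  assumes "coprime s m" "s \<noteq> 0" "a \<noteq> 0" "m \<noteq> 0"
  shows "kronecker (s\<^sup>2 * a) m = kronecker a m"
proof -
  have "kronecker (s\<^sup>2 * a) m = kronecker s m * kronecker s m * kronecker a m"
    using assms by (simp add: kronecker_mult_left power2_eq_square)
  then show ?thesis using kronecker_coprime[of s m] assms by auto
qed

lemma kronecker_cong_left:
  assumes "odd h" "h > 0" "[m = m'] (mod h)"
  shows "kronecker m h = kronecker m' h"
proof -
  have "kronecker_prime m p = kronecker_prime m' p" if "p \<in># prime_factorization h" for p
  proof -
    have p: "p dvd h" using that by (simp add: in_prime_factors_iff)
    then have "p \<noteq> 2" using assms(1) by auto
    moreover have c: "[m = m'] (mod p)" using assms(3) p by (rule cong_dvd_modulus)
    then have "[x = m] (mod p) \<longleftrightarrow> [x = m'] (mod p)" "[m = x] (mod p) \<longleftrightarrow> [m' = x] (mod p)" for x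
      by (metis cong_sym cong_trans)+
    ultimately show ?thesis by (simp add: kronecker_prime_def Legendre_def QuadRes_def)
  qed
  then have "image_mset (kronecker_prime m) (prime_factorization h)
      = image_mset (kronecker_prime m') (prime_factorization h)"
    by (rule image_mset_cong)
  then show ?thesis using assms(2) by (simp add: kronecker_def)
qed

lemma mult_mod_4_eq_1_iff:
  fixes a b :: int
  assumes "odd a" "odd b"
  shows "a * b mod 4 = 1 \<longleftrightarrow> (a mod 4 = 1 \<longleftrightarrow> b mod 4 = 1)"
proof -
  have "a mod 4 = 1 \<or> a mod 4 = 3" "b mod 4 = 1 \<or> b mod 4 = 3" using assms by presburger+
  then show ?thesis
    unfolding mod_mult_eq[of a 4 b, symmetric] by (elim disjE) simp_all
qed

text \<open>Negative \<open>m\<close> fits the same formula because \<open>m mod 4\<close> also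
  records the sign: \<open>-1\<close> has residue 3 and symbol -1.\<close>

lemma kronecker_minus_one_left:
  assumes "odd m"
  shows "kronecker (-1) m = (if m mod 4 = 1 then 1 else -1)"
  using assms
proof (induction m rule: prime_divisors_induct)
  case zero
  then show ?case by simp
next
  case (unit x)
  then have "x = 1 \<or> x = -1" by auto
  then show ?case by (auto simp: kronecker_1 kronecker_minus_1)
next
  case (factor p x)
  then have odd: "odd p" "odd x" by auto
  then have p2: "p > 2" using prime_ge_2_int[OF factor(1)] by (cases "p = 2") auto
  show ?case
    using factor.IH odd p2 factor.hyps
    by (simp add: kronecker_mult kronecker_odd_prime Legendre_minus_one mult_mod_4_eq_1_iff)
qed

text \<open>The classical starred number of quadratic reciprocity,
  \<open>(-1)^((h - 1) / 2) h\<close> for odd \<open>h > 0\<close>. It is 1 modulo 4, as the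
  convention for even and negative denominators demands.\<close>

definition star :: "int \<Rightarrow> int" where
  "star h = (if h mod 4 = 1 then h else -h)"

lemma star_mult:
  assumes "odd a" "odd b"
  shows "star (a * b) = star a * star b"
  using mult_mod_4_eq_1_iff[OF assms] by (simp add: star_def)

lemma Legendre_star:
  assumes "prime p" "prime q" "p > 2" "q > 2" "p \<noteq> q"
  shows "Legendre (star p) q = Legendre q p"
proof -
  have odd: "odd p" "odd q" using assms prime_odd_int by blast+
  have nz: "Legendre a b \<in> {1, -1}" if "prime a" "prime b" "a \<noteq> b" for a b :: int
    using that primes_dvd_imp_eq[of b a] by (auto simp: Legendre_def cong_0_iff)
  have "even (nat ((p - 1) div 2 * ((q - 1) div 2))) \<longleftrightarrow> p mod 4 = 1 \<or> q mod 4 = 1"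
  proof -
    have "even (nat ((p - 1) div 2 * ((q - 1) div 2))) \<longleftrightarrow> even ((p - 1) div 2 * ((q - 1) div 2))"
      using assms(3,4) by (intro even_nat_iff) (auto intro!: mult_nonneg_nonneg)
    moreover have "even ((p - 1) div 2) \<longleftrightarrow> p mod 4 = 1" "even ((q - 1) div 2) \<longleftrightarrow> q mod 4 = 1"
      using odd by presburger+
    ultimately show ?thesis by simp
  qed
  then have rec: "Legendre p q * Legendre q p = (if p mod 4 = 1 \<or> q mod 4 = 1 then 1 else -1)"
    using Quadratic_Reciprocity_int[of p q] assms by auto
  have "Legendre (- p) q = Legendre (-1) q * Legendre p q"
    using Legendre_mult[OF assms(2,4), of "-1" p] by simp
  then show ?thesis
    using rec nz[of p q] nz[of q p] assms
    by (auto simp: star_def Legendre_minus_one split: if_splits)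
qed

text \<open>Three laws at once, one for each kind of factor of \<open>m\<close>: the first
  supplement for the unit \<open>-1\<close>, the second for the prime 2, reciprocity for odd
  primes.\<close>

lemma kronecker_star_prime:
  assumes "prime p" "p > 2" "coprime m p"
  shows "kronecker (star p) m = kronecker m p"
  using assms(3)
proof (induction m rule: prime_divisors_induct)
  case zero
  then show ?case using assms by auto
next
  case (unit x)
  then have "x = 1 \<or> x = -1" by auto
  moreover have odd: "odd p" using assms prime_odd_int by blast
  moreover have "Legendre 1 p = 1"
    using kronecker_1_left[of p] odd assms by (simp add: kronecker_odd_prime)
  ultimately show ?case
    using assms by (auto simp: kronecker_1 kronecker_minus_1 kronecker_1_left star_def
        kronecker_odd_prime Legendre_minus_one)
next
  case (factor q x)
  have oddp: "odd p" using assms prime_odd_int by blast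
  have cop: "coprime q p" "coprime x p" using factor.prems by auto
  have ne: "q \<noteq> p" using cop assms by auto
  have "kronecker (star p) q = kronecker q p"
  proof (cases "q = 2")
    case True
    have "(- p) mod 8 = 1 \<longleftrightarrow> p mod 8 = 7" "(- p) mod 8 = 7 \<longleftrightarrow> p mod 8 = 1"
      by presburger+
    then have "star p mod 8 \<in> {1, 7} \<longleftrightarrow> p mod 8 \<in> {1, 7}" "odd (star p)"
      using oddp by (auto simp: star_def)
    then show ?thesis
      using True oddp by (simp add: kronecker_2 kronecker_odd_prime assms Legendre_two)
  next
    case False
    then have q2: "q > 2" using prime_ge_2_int[OF factor(1)] by simp
    then have "odd q" using prime_odd_int factor(1) by blast
    then show ?thesis
      using oddp assms factor(1) q2 ne by (simp add: kronecker_odd_prime Legendre_star)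
  qed
  then show ?case
    using factor.IH[OF cop(2)] oddp assms
    by (simp add: kronecker_mult kronecker_odd_prime Legendre_mult)
qed

text \<open>Induction over the prime factors of \<open>h\<close>, now multiplying numerators. The
  denominator 0 is separated because multiplicativity in the numerator fails there; coprimality then
  leaves only \<open>h = 1\<close>.\<close>

theorem kronecker_star:
  assumes "odd h" "h > 0" "coprime m h"
  shows "kronecker (star h) m = kronecker m h"
proof (cases "m = 0")
  case True
  then have "h = 1" using assms by auto
  then show ?thesis by (simp add: kronecker_1 kronecker_1_left star_def)
next
  case m0: False
  show ?thesis using assms
  proof (induction h rule: prime_divisors_induct)
    case zero
    then show ?case by simp
  next
    case (unit x)
    then have "x = 1" by auto
    then show ?case by (simp add: kronecker_1 kronecker_1_left star_def)
  next
    case (factor p x)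
    have p: "odd p" "p > 2" using factor.prems(1) prime_ge_2_int[OF factor(1)] by (cases "p = 2", auto)+
    have x: "odd x" "x > 0" "coprime m x" "coprime m p"
      using factor.prems p by (auto simp: zero_less_mult_iff)
    have "star p \<noteq> 0" "star x \<noteq> 0" using p x by (auto simp: star_def)
    then show ?case
      using factor.IH[OF x(1-3)] kronecker_star_prime[OF factor(1) p(2) x(4)] m0 p x
      by (simp add: star_mult kronecker_mult_left kronecker_mult)
  qed
qed

section \<open>Class functions and convolution\<close>

text \<open>As \<open>r ^^ q\<close> is the identity and \<open>q\<close> is prime, orbits of
  \<open>r\<close> have size 1 or \<open>q\<close>, and one of size \<open>q\<close> contributes a
  multiple of \<open>q\<close>. The induction removes such orbits one by one.\<close>

lemma sum_cong_fixed_points: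
  fixes W :: "'b \<Rightarrow> int"
  assumes "prime q" "finite X"
    and "\<And>x. x \<in> X \<Longrightarrow> r x \<in> X" "\<And>x. x \<in> X \<Longrightarrow> (r ^^ q) x = x" "\<And>x. x \<in> X \<Longrightarrow> W (r x) = W x"
  shows "[sum W X = sum W {x \<in> X. r x = x}] (mod int q)"
  using assms(2-)
proof (induction "card X" arbitrary: X rule: less_induct)
  case less
  show ?case
  proof (cases "\<exists>x\<in>X. r x \<noteq> x")
    case False
    then have "{x \<in> X. r x = x} = X" by auto
    then show ?thesis by simp
  next
    case True
    then obtain x where x: "x \<in> X" "r x \<noteq> x" by blast
    have q0: "q > 0" using assms(1) by (simp add: prime_gt_0_nat)
    define O' where "O' = (\<lambda>i. (r ^^ i) x) ` {..<q}"
    have rX: "(r ^^ i) x \<in> X" for i by (induction i) (use x less.prems in auto)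
    then have OX: "O' \<subseteq> X" by (auto simp: O'_def)
    have per: "(r ^^ (q * i)) x = x" for i
      by (induction i) (use x less.prems(3) in \<open>auto simp: funpow_add\<close>)
    \<comment> \<open>An exponent \<open>0 < d < q\<close> is invertible modulo \<open>q\<close>: if
      \<open>r ^^ d\<close> fixed \<open>x\<close>, so would \<open>r ^^ (d * u)\<close>, which acts
      on \<open>x\<close> as \<open>r\<close> itself.\<close>
    have nofix: "(r ^^ d) x \<noteq> x" if d: "0 < d" "d < q" for d
    proof
      assume a: "(r ^^ d) x = x"
      have "coprime d q" using d assms(1)
        by (metis coprime_commute nat_dvd_not_less prime_imp_coprime)
      then obtain u where "[d * u = 1] (mod q)" using cong_solve_coprime_nat by auto
      then have "d * u mod q = 1" using prime_gt_1_nat[OF assms(1)] by (simp add: cong_def)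
      then obtain v where v: "d * u = 1 + q * v" by (metis add.commute mult_div_mod_eq)
      have "(r ^^ (d * i)) x = x" for i by (induction i) (use a in \<open>auto simp: funpow_add\<close>)
      then have "(r ^^ (1 + q * v)) x = x" using v by metis
      then show False using x(2) per[of v] by simp
    qed
    have inj: "inj_on (\<lambda>i. (r ^^ i) x) {..<q}"
    proof (rule linorder_inj_onI)
      fix i j assume ij: "i < j" "i \<in> {..<q}" "j \<in> {..<q}"
      show "(r ^^ i) x \<noteq> (r ^^ j) x"
      proof
        assume eq: "(r ^^ i) x = (r ^^ j) x"
        have "(r ^^ (q - i + i)) x = (r ^^ (q - i + j)) x"
          unfolding funpow_add o_apply eq ..
        moreover have e: "q - i + i = q" "q - i + j = (j - i) + q" using ij by auto
        ultimately have "(r ^^ q) x = (r ^^ ((j - i) + q)) x" unfolding e by blast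
        then have "x = (r ^^ (j - i)) x"
          unfolding funpow_add o_apply less.prems(3)[OF x(1)] .
        then show False using nofix[of "j - i"] ij by (auto simp: less_imp_diff_less)
      qed
    qed auto
    have rO: "r y \<in> O'" if y: "y \<in> O'" for y
    proof -
      obtain i where i: "i < q" "y = (r ^^ i) x" using y by (auto simp: O'_def)
      show ?thesis
      proof (cases "Suc i = q")
        case True
        then have "r y = x" using less.prems(3)[OF x(1)] i by (metis funpow.simps(2) o_apply)
        then show ?thesis using q0 unfolding O'_def by (intro image_eqI[of _ _ 0]) auto
      next
        case False
        then show ?thesis using i unfolding O'_def by (intro image_eqI[of _ _ "Suc i"]) auto
      qed
    qed
    have WO: "W ((r ^^ i) x) = W x" for i by (induction i) (use less.prems(4) rX in auto)
    have fO: "finite O'" by (simp add: O'_def)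
    have "sum W O' = (\<Sum>i<q. W ((r ^^ i) x))" unfolding O'_def by (simp add: sum.reindex[OF inj])
    also have "\<dots> = int q * W x" by (simp add: WO)
    finally have sO: "sum W O' = int q * W x" .
    have fixO: "{y \<in> X. r y = y} = {y \<in> X - O'. r y = y}"
    proof -
      have "r y \<noteq> y" if y: "y \<in> O'" for y
      proof
        assume a: "r y = y"
        obtain i where i: "i < q" "y = (r ^^ i) x" using y by (auto simp: O'_def)
        have "(r ^^ k) y = y" for k by (induction k) (use a in auto)
        then have "(r ^^ (q - i)) ((r ^^ i) x) = y" using i(2) by simp
        then have "(r ^^ (q - i + i)) x = y" unfolding funpow_add o_apply .
        then have "y = x" using i(1) less.prems(3)[OF x(1)] by simp
        then show False using a x(2) by simp
      qed
      then show ?thesis by auto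
    qed
    have r_compl: "r y \<in> X - O'" if y: "y \<in> X - O'" for y
    proof -
      have "r y \<notin> O'"
      proof
        assume a: "r y \<in> O'"
        have "(r ^^ k) (r y) \<in> O'" for k by (induction k) (use a rO in auto)
        then have "(r ^^ Suc (q - 1)) y \<in> O'" by (metis funpow_Suc_right o_apply)
        then show False using y q0 less.prems(3) by auto
      qed
      then show ?thesis using y less.prems(2) by auto
    qed
    have "x \<in> O'" using q0 unfolding O'_def by (intro image_eqI[of _ _ 0]) auto
    then have "card (X - O') < card X" using less.prems(1) x by (intro psubset_card_mono) auto
    then have IH: "[sum W (X - O') = sum W {y \<in> X - O'. r y = y}] (mod int q)"
      using less.prems r_compl by (intro less.hyps) auto
    have "sum W X = sum W (X - O') + int q * W x"
      using sum.subset_diff[OF OX less.prems(1), of W] sO by simp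
    then have "[sum W X = sum W (X - O')] (mod int q)" by (simp add: cong_def)
    then show ?thesis using IH fixO by (auto intro: cong_trans)
  qed
qed

lemma fermat_little_int:
  fixes a :: int
  assumes "prime p"
  shows "[a ^ p = a] (mod int p)"
proof -
  define b where "b = nat (a mod int p)"
  have p0: "p > 0" using assms by (simp add: prime_gt_0_nat)
  then have ab: "[a = int b] (mod int p)" by (simp add: b_def cong_def)
  have "[b ^ p = b] (mod p)"
  proof (cases "p dvd b")
    case True
    then have "p dvd b ^ p" by (rule dvd_trans) (simp add: dvd_power p0)
    then show ?thesis using True by (simp add: cong_def dvd_eq_mod_eq_0)
  next
    case False
    then have "[b * b ^ (p - 1) = b * 1] (mod p)"
      by (intro cong_mult cong_refl fermat_theorem assms)
    moreover have "b * b ^ (p - 1) = b ^ p" using p0 by (simp add: power_eq_if)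
    ultimately show ?thesis by simp
  qed
  then have "[int b ^ p = int b] (mod int p)" by (metis cong_int_iff of_nat_power)
  then show ?thesis using ab by (meson cong_pow cong_sym cong_trans)
qed

section \<open>The centre of the integral group ring\<close>

locale finite_group = group G for G (structure) +
  assumes fin [simp, intro]: "finite (carrier G)"
begin

text \<open>Vanishing off the carrier makes equality of HOL functions the same as equality on the
  group, so the monoid laws below hold literally.\<close>

definition class_fun :: "('a \<Rightarrow> int) set" where
  "class_fun = {f. (\<forall>x. x \<notin> carrier G \<longrightarrow> f x = 0) \<and>
     (\<forall>x\<in>carrier G. \<forall>h\<in>carrier G. f (h \<otimes> x \<otimes> inv h) = f x)}"

text \<open>Multiplication in the integral group ring, its elements being given by their coefficient
  functions.\<close>

definition conv :: "('a \<Rightarrow> int) \<Rightarrow> ('a \<Rightarrow> int) \<Rightarrow> 'a \<Rightarrow> int" where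
  "conv f g x = (if x \<in> carrier G then \<Sum>y\<in>carrier G. f y * g (inv y \<otimes> x) else 0)"

definition unit_fun :: "'a \<Rightarrow> int" where
  "unit_fun x = (if x = \<one> then 1 else 0)"

lemma class_funD:
  assumes "f \<in> class_fun"
  shows "x \<notin> carrier G \<Longrightarrow> f x = 0"
    and "x \<in> carrier G \<Longrightarrow> h \<in> carrier G \<Longrightarrow> f (h \<otimes> x \<otimes> inv h) = f x"
  using assms by (auto simp: class_fun_def)

lemma inv_cancel_left [simp]:
  assumes "a \<in> carrier G" "x \<in> carrier G"
  shows "inv a \<otimes> (a \<otimes> x) = x" "a \<otimes> (inv a \<otimes> x) = x"
  using assms by (simp_all flip: m_assoc)

lemma conj_eq_iff:
  assumes "a \<in> carrier G" "w \<in> carrier G" "z \<in> carrier G"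
  shows "z = a \<otimes> w \<otimes> inv a \<longleftrightarrow> inv a \<otimes> z \<otimes> a = w"
  using assms by (auto simp: m_assoc)

lemma bij_mult_left: "a \<in> carrier G \<Longrightarrow> bij_betw (\<lambda>x. a \<otimes> x) (carrier G) (carrier G)"
  by (intro bij_betw_byWitness[where f' = "\<lambda>x. inv a \<otimes> x"]) auto

lemma bij_conj: "a \<in> carrier G \<Longrightarrow> bij_betw (\<lambda>x. a \<otimes> x \<otimes> inv a) (carrier G) (carrier G)"
  by (intro bij_betw_byWitness[where f' = "\<lambda>x. inv a \<otimes> x \<otimes> a"])
     (auto simp: m_assoc)

lemma bij_inv: "bij_betw (\<lambda>x. inv x) (carrier G) (carrier G)"
  by (intro bij_betw_byWitness[where f' = "\<lambda>x. inv x"]) auto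

lemma class_fun_comm:
  assumes "f \<in> class_fun" "x \<in> carrier G" "y \<in> carrier G"
  shows "f (x \<otimes> y) = f (y \<otimes> x)"
  using class_funD(2)[OF assms(1), of "y \<otimes> x" x] assms by (simp add: m_assoc)

lemma conv_assoc: "conv (conv f g) h = conv f (conv g h)"
proof
  fix x
  show "conv (conv f g) h x = conv f (conv g h) x"
  proof (cases "x \<in> carrier G")
    case x: True
    have "conv (conv f g) h x
        = (\<Sum>y\<in>carrier G. \<Sum>z\<in>carrier G. f z * g (inv z \<otimes> y) * h (inv y \<otimes> x))"
      using x by (simp add: conv_def sum_distrib_right)
    also have "\<dots> = (\<Sum>z\<in>carrier G. \<Sum>y\<in>carrier G. f z * g (inv z \<otimes> y) * h (inv y \<otimes> x))"
      by (rule sum.swap)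
    also have "\<dots> = (\<Sum>z\<in>carrier G. \<Sum>w\<in>carrier G. f z * (g w * h (inv w \<otimes> (inv z \<otimes> x))))"
    proof (rule sum.cong[OF refl])
      fix z assume z: "z \<in> carrier G"
      have "(\<Sum>y\<in>carrier G. f z * g (inv z \<otimes> y) * h (inv y \<otimes> x))
          = (\<Sum>w\<in>carrier G. f z * g (inv z \<otimes> (z \<otimes> w)) * h (inv (z \<otimes> w) \<otimes> x))"
        by (rule sum.reindex_bij_betw[OF bij_mult_left[OF z], symmetric])
      also have "\<dots> = (\<Sum>w\<in>carrier G. f z * (g w * h (inv w \<otimes> (inv z \<otimes> x))))"
        using z x by (intro sum.cong) (auto simp: inv_mult_group m_assoc)
      finally show "(\<Sum>y\<in>carrier G. f z * g (inv z \<otimes> y) * h (inv y \<otimes> x))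
        = (\<Sum>w\<in>carrier G. f z * (g w * h (inv w \<otimes> (inv z \<otimes> x))))" .
    qed
    also have "\<dots> = conv f (conv g h) x"
      using x by (simp add: conv_def sum_distrib_left)
    finally show ?thesis .
  qed (simp add: conv_def)
qed

text \<open>Class functions are central in the whole group ring, so \<open>g\<close> is arbitrary.
  The substitution \<open>y = x \<otimes> inv z\<close> exchanges the arguments up to the order of a
  product inside \<open>f\<close>.\<close>

lemma conv_commute:
  assumes "f \<in> class_fun"
  shows "conv f g = conv g f"
proof
  fix x
  show "conv f g x = conv g f x"
  proof (cases "x \<in> carrier G")
    case x: True
    have b: "bij_betw (\<lambda>z. x \<otimes> inv z) (carrier G) (carrier G)"
      by (rule bij_betw_trans[OF bij_inv bij_mult_left[OF x], unfolded o_def])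
    have "conv f g x = (\<Sum>y\<in>carrier G. f y * g (inv y \<otimes> x))"
      using x by (simp add: conv_def)
    also have "\<dots> = (\<Sum>z\<in>carrier G. f (x \<otimes> inv z) * g (inv (x \<otimes> inv z) \<otimes> x))"
      by (rule sum.reindex_bij_betw[OF b, symmetric])
    also have "\<dots> = (\<Sum>z\<in>carrier G. g z * f (inv z \<otimes> x))"
      using x class_fun_comm[OF assms x]
      by (intro sum.cong) (auto simp: inv_mult_group m_assoc)
    finally show ?thesis using x by (simp add: conv_def)
  qed (simp add: conv_def)
qed

lemma conv_closed:
  assumes "f \<in> class_fun" "g \<in> class_fun"
  shows "conv f g \<in> class_fun"
proof -
  have "conv f g (h \<otimes> x \<otimes> inv h) = conv f g x" if x: "x \<in> carrier G" and h: "h \<in> carrier G" for x h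
  proof -
    have "conv f g (h \<otimes> x \<otimes> inv h) = (\<Sum>y\<in>carrier G. f y * g (inv y \<otimes> (h \<otimes> x \<otimes> inv h)))"
      using x h by (simp add: conv_def)
    also have "\<dots>
        = (\<Sum>z\<in>carrier G. f (h \<otimes> z \<otimes> inv h) * g (inv (h \<otimes> z \<otimes> inv h) \<otimes> (h \<otimes> x \<otimes> inv h)))"
      by (rule sum.reindex_bij_betw[OF bij_conj[OF h], symmetric])
    also have "\<dots> = (\<Sum>z\<in>carrier G. f z * g (inv z \<otimes> x))"
    proof (rule sum.cong[OF refl])
      fix z assume z: "z \<in> carrier G"
      have "inv (h \<otimes> z \<otimes> inv h) \<otimes> (h \<otimes> x \<otimes> inv h) = h \<otimes> (inv z \<otimes> x) \<otimes> inv h"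
        using x h z by (simp add: inv_mult_group m_assoc)
      then show "f (h \<otimes> z \<otimes> inv h) * g (inv (h \<otimes> z \<otimes> inv h) \<otimes> (h \<otimes> x \<otimes> inv h)) = f z * g (inv z \<otimes> x)"
        using x h z assms by (simp add: class_funD)
    qed
    finally show ?thesis using x by (simp add: conv_def)
  qed
  then show ?thesis by (auto simp: class_fun_def) (auto simp: conv_def)
qed

lemma unit_fun_closed: "unit_fun \<in> class_fun"
proof -
  have "unit_fun (h \<otimes> x \<otimes> inv h) = unit_fun x" if "x \<in> carrier G" "h \<in> carrier G" for x h
    using conj_eq_iff[of h x \<one>] that unfolding unit_fun_def by auto
  moreover have "unit_fun x = 0" if "x \<notin> carrier G" for x
    using that by (auto simp: unit_fun_def)
  ultimately show ?thesis by (simp add: class_fun_def)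
qed

lemma conv_unit: "f \<in> class_fun \<Longrightarrow> conv unit_fun f = f"
  by (rule ext) (auto simp: conv_def unit_fun_def if_distrib[of "\<lambda>c. c * _"] sum.delta
      class_funD(1) cong: if_cong)

definition class_monoid :: "('a \<Rightarrow> int) monoid" where
  "class_monoid = \<lparr>carrier = class_fun, monoid.mult = conv, one = unit_fun\<rparr>"

lemma class_monoid_simps [simp]:
  "carrier class_monoid = class_fun" "monoid.mult class_monoid = conv" "one class_monoid = unit_fun"
  by (simp_all add: class_monoid_def)

sublocale C: comm_monoid class_monoid
  by (rule comm_monoidI)
     (auto simp: conv_closed unit_fun_closed conv_assoc conv_unit intro: conv_commute)

abbreviation cpow :: "('a \<Rightarrow> int) \<Rightarrow> nat \<Rightarrow> 'a \<Rightarrow> int" (infixr "^*" 75) where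
  "f ^* n \<equiv> f [^]\<^bsub>class_monoid\<^esub> n"

section \<open>Convolution powers and the Frobenius congruence\<close>

definition words :: "nat \<Rightarrow> 'a list set" where
  "words n = {xs. set xs \<subseteq> carrier G \<and> length xs = n}"

lemma finite_words [simp]: "finite (words n)"
  unfolding words_def by (rule finite_lists_length_eq) simp

definition lprod :: "'a list \<Rightarrow> 'a" where
  "lprod xs = foldr (\<otimes>) xs \<one>"

lemma lprod_simps [simp]: "lprod [] = \<one>" "lprod (x # xs) = x \<otimes> lprod xs"
  by (simp_all add: lprod_def)

lemma lprod_closed: "set xs \<subseteq> carrier G \<Longrightarrow> lprod xs \<in> carrier G"
  by (induction xs) auto

lemma lprod_append:
  "set xs \<subseteq> carrier G \<Longrightarrow> set ys \<subseteq> carrier G \<Longrightarrow> lprod (xs @ ys) = lprod xs \<otimes> lprod ys"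
  by (induction xs) (auto simp: m_assoc lprod_closed)

lemma lprod_replicate: "x \<in> carrier G \<Longrightarrow> lprod (replicate n x) = x [^] n"
  by (induction n) (auto, metis nat_pow_Suc nat_pow_Suc2)

lemma words_Suc: "words (Suc n) = (\<lambda>(y, ys). y # ys) ` (carrier G \<times> words n)"
  by (auto simp: words_def length_Suc_conv image_iff)

lemma cpow_words:
  assumes "f \<in> class_fun" "x \<in> carrier G"
  shows "(f ^* n) x = (\<Sum>xs\<in>words n. if lprod xs = x then prod_list (map f xs) else 0)"
  using assms(2)
proof (induction n arbitrary: x)
  case 0
  have "words 0 = {[]}" by (auto simp: words_def)
  then show ?case by (auto simp: unit_fun_def)
next
  case (Suc n)
  have "(f ^* Suc n) x = conv f (f ^* n) x"
    using C.nat_pow_Suc2[of f n] assms by simp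
  also have "\<dots> = (\<Sum>y\<in>carrier G. \<Sum>ys\<in>words n.
      if lprod ys = inv y \<otimes> x then f y * prod_list (map f ys) else 0)"
    using Suc by (simp add: conv_def sum_distrib_left if_distrib[of "\<lambda>c. _ * c"] cong: if_cong)
  also have "\<dots> = (\<Sum>(y, ys)\<in>carrier G \<times> words n.
      if lprod (y # ys) = x then prod_list (map f (y # ys)) else 0)"
    unfolding sum.cartesian_product[symmetric]
  proof (intro sum.cong refl)
    fix y ys assume "y \<in> carrier G" "ys \<in> words n"
    then have "lprod ys = inv y \<otimes> x \<longleftrightarrow> y \<otimes> lprod ys = x"
      using Suc.prems lprod_closed[of ys] by (auto simp: words_def inv_solve_left)
    then show "(if lprod ys = inv y \<otimes> x then f y * prod_list (map f ys) else 0)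
      = (if lprod (y # ys) = x then prod_list (map f (y # ys)) else 0)" by simp
  qed
  also have "\<dots> = (\<Sum>xs\<in>words (Suc n). if lprod xs = x then prod_list (map f xs) else 0)"
    unfolding words_Suc by (subst sum.reindex) (auto simp: inj_on_def case_prod_unfold)
  finally show ?case .
qed

lemma nat_pow_inj:
  assumes "coprime n (order G)" "x \<in> carrier G" "y \<in> carrier G" "x [^] n = y [^] n"
  shows "x = y"
proof -
  have "power_perm (int n) G permutes carrier G"
    by (rule power_perm_permutes) (use assms(1) is_group fin in auto)
  then have "inj (power_perm (int n) G)" by (rule permutes_inj)
  then show ?thesis
    using assms by (auto simp: power_perm_def int_pow_int dest!: injD[of _ x y])
qed

lemma conj_nat_pow:
  assumes "h \<in> carrier G" "x \<in> carrier G"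
  shows "(h \<otimes> x \<otimes> inv h) [^] (n::nat) = h \<otimes> x [^] n \<otimes> inv h"
proof (induction n)
  case (Suc n)
  have "(h \<otimes> x [^] n \<otimes> inv h) \<otimes> (h \<otimes> x \<otimes> inv h) = h \<otimes> (x [^] n \<otimes> ((inv h \<otimes> h) \<otimes> x)) \<otimes> inv h"
    using assms by (simp add: m_assoc del: l_inv)
  then show ?case using Suc assms by simp
qed (use assms in auto)

text \<open>
  Averaged over conjugation, the coefficient of a \<open>q\<close>-th convolution power is a sum over words of
  length \<open>q\<close> whose weight is invariant under rotation, so modulo \<open>q\<close> only constant words survive.
\<close>

lemma cpow_prime_cong:
  assumes q: "prime q" "coprime q (order G)" and f: "f \<in> class_fun" and t: "t \<in> carrier G"
  shows "[(f ^* q) (t [^] q) = f t] (mod int q)"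
proof -
  define x where "x = t [^] q"
  have x: "x \<in> carrier G" using t by (simp add: x_def)
  \<comment> \<open>\<open>N z\<close> counts the \<open>h\<close> that conjugate \<open>x\<close>
    to \<open>z\<close>. Rotation does not preserve the condition \<open>lprod xs = x\<close>; this
    weight depends only on the class of the product, which it does preserve.\<close>
  define N where "N z = (\<Sum>h\<in>carrier G. if z = h \<otimes> x \<otimes> inv h then 1 else 0 :: int)" for z
  define W where "W xs = prod_list (map f xs) * N (lprod xs)" for xs
  have fq: "f ^* q \<in> class_fun" using C.nat_pow_closed f by simp
  have N_conj: "N (inv a \<otimes> z \<otimes> a) = N z" if a: "a \<in> carrier G" and z: "z \<in> carrier G" for a z
  proof -
    have "N z = (\<Sum>h\<in>carrier G. if z = (a \<otimes> h) \<otimes> x \<otimes> inv (a \<otimes> h) then 1 else 0)"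
      unfolding N_def by (rule sum.reindex_bij_betw[OF bij_mult_left[OF a], symmetric])
    also have "\<dots> = N (inv a \<otimes> z \<otimes> a)"
      unfolding N_def
    proof (intro sum.cong refl if_cong)
      fix h assume h: "h \<in> carrier G"
      have e: "(a \<otimes> h) \<otimes> x \<otimes> inv (a \<otimes> h) = a \<otimes> (h \<otimes> x \<otimes> inv h) \<otimes> inv a"
        using a h x by (simp add: inv_mult_group m_assoc)
      show "(z = (a \<otimes> h) \<otimes> x \<otimes> inv (a \<otimes> h)) = (inv a \<otimes> z \<otimes> a = h \<otimes> x \<otimes> inv h)"
        unfolding e by (rule conj_eq_iff) (use a h x z in auto)
    qed
    finally show ?thesis by simp
  qed
  \<comment> \<open>Averaging over conjugates costs the factor \<open>order G\<close>, a unit modulo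
    \<open>q\<close> that is cancelled at the end.\<close>
  have "int (order G) * (f ^* q) x = (\<Sum>h\<in>carrier G. (f ^* q) (h \<otimes> x \<otimes> inv h))"
    using class_funD(2)[OF fq x] by (simp add: Coset.order_def)
  also have "\<dots> = (\<Sum>h\<in>carrier G. \<Sum>xs\<in>words q.
      if lprod xs = h \<otimes> x \<otimes> inv h then prod_list (map f xs) else 0)"
    using x by (intro sum.cong refl cpow_words f) auto
  also have "\<dots> = sum W (words q)"
    by (subst sum.swap) (simp add: W_def N_def sum_distrib_left if_distrib[of "\<lambda>c. _ * c"] cong: if_cong)
  also have "[\<dots> = sum W {xs \<in> words q. rotate1 xs = xs}] (mod int q)"
  proof (rule sum_cong_fixed_points[OF q(1)])
    fix xs assume xs: "xs \<in> words q"
    show "rotate1 xs \<in> words q" using xs by (simp add: words_def)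
    show "(rotate1 ^^ q) xs = xs"
      using xs by (simp add: words_def rotate_def[symmetric])
    show "W (rotate1 xs) = W xs"
    proof (cases xs)
      case (Cons a as)
      have a: "a \<in> carrier G" "set as \<subseteq> carrier G" using xs Cons by (auto simp: words_def)
      have "lprod (rotate1 xs) = inv a \<otimes> lprod xs \<otimes> a"
        using a Cons lprod_closed[OF a(2)]
        by (simp add: lprod_append)
      moreover have "lprod xs \<in> carrier G" using xs by (auto simp: words_def intro: lprod_closed)
      ultimately show ?thesis
        using Cons a N_conj by (simp add: W_def mult.commute)
    qed simp
  qed simp
  also have "{xs \<in> words q. rotate1 xs = xs} = replicate q ` carrier G"
  proof -
    have "xs \<in> replicate q ` carrier G" if xs: "xs \<in> words q" "rotate1 xs = xs" for xs
    proof -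
      have q0: "q > 0" using q(1) by (simp add: prime_gt_0_nat)
      have l: "length xs = q" using xs by (simp add: words_def)
      have rot: "rotate k xs = xs" for k by (induction k) (use xs in auto)
      have nth: "xs ! k = xs ! 0" if "k < q" for k
        using nth_rotate[of 0 xs k] that l q0 unfolding rot by simp
      have "xs = replicate q (xs ! 0)"
        using l by (intro nth_equalityI) (simp, metis nth nth_replicate)
      moreover have "xs ! 0 \<in> carrier G" using xs l q0 by (auto simp: words_def intro: nth_mem)
      ultimately show ?thesis by blast
    qed
    then show ?thesis by (auto simp: words_def)
  qed
  also have "sum W (replicate q ` carrier G) = (\<Sum>y\<in>carrier G. f y ^ q * N (y [^] q))"
    using q(1) by (subst sum.reindex)
      (auto simp: W_def lprod_replicate prod_list_replicate inj_on_def replicate_eq_replicate prime_gt_0_nat)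
  \<comment> \<open>Constant words give \<open>f y ^ q\<close>, reduced by Fermat; injectivity of
    the \<open>q\<close>-th power map then turns conjugates of \<open>t [^] q\<close> into
    conjugates of \<open>t\<close>.\<close>
  also have "[\<dots> = (\<Sum>y\<in>carrier G. f y * N (y [^] q))] (mod int q)"
  proof (intro cong_sum cong_mult cong_refl)
    show "[f y ^ q = f y] (mod int q)" for y by (rule fermat_little_int[OF q(1)])
  qed
  also have "(\<Sum>y\<in>carrier G. f y * N (y [^] q))
      = (\<Sum>h\<in>carrier G. \<Sum>y\<in>carrier G. if y = h \<otimes> t \<otimes> inv h then f y else 0)"
  proof -
    have "y [^] q = h \<otimes> x \<otimes> inv h \<longleftrightarrow> y = h \<otimes> t \<otimes> inv h" if "h \<in> carrier G" "y \<in> carrier G" for h y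
      using that t nat_pow_inj[OF q(2)] by (auto simp: x_def conj_nat_pow[symmetric])
    then show ?thesis
      unfolding N_def sum_distrib_left
      by (subst sum.swap) (intro sum.cong refl, auto)
  qed
  also have "\<dots> = int (order G) * f t"
    using t by (simp add: sum.delta class_funD[OF f] Coset.order_def)
  finally have "[int (order G) * (f ^* q) x = int (order G) * f t] (mod int q)" .
  then show ?thesis
    using q(2) cong_mult_lcancel[of "int (order G)" "int q"]
    by (simp add: x_def coprime_commute)
qed

end

section \<open>Parity and conjugacy\<close>

context finite_group
begin

definition conj_to :: "'a \<Rightarrow> 'a \<Rightarrow> bool" where
  "conj_to x y \<longleftrightarrow> x \<in> carrier G \<and> (\<exists>h\<in>carrier G. y = h \<otimes> x \<otimes> inv h)"

lemma conj_to_carrier: "conj_to x y \<Longrightarrow> x \<in> carrier G" "conj_to x y \<Longrightarrow> y \<in> carrier G"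
  by (auto simp: conj_to_def)

lemma conj_to_refl: "x \<in> carrier G \<Longrightarrow> conj_to x x"
  by (auto simp: conj_to_def intro!: bexI[of _ \<one>])

lemma conj_to_conj: "x \<in> carrier G \<Longrightarrow> h \<in> carrier G \<Longrightarrow> conj_to x (h \<otimes> x \<otimes> inv h)"
  by (auto simp: conj_to_def)

lemma conj_to_sym: "conj_to x y \<Longrightarrow> conj_to y x"
proof -
  assume "conj_to x y"
  then obtain h where h: "x \<in> carrier G" "h \<in> carrier G" "y = h \<otimes> x \<otimes> inv h" by (auto simp: conj_to_def)
  then have "x = inv h \<otimes> y \<otimes> inv (inv h)" by (simp add: m_assoc)
  then show "conj_to y x" using h unfolding conj_to_def by (intro conjI bexI[of _ "inv h"]) auto
qed

lemma conj_to_trans: "conj_to x y \<Longrightarrow> conj_to y z \<Longrightarrow> conj_to x z"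
proof -
  assume "conj_to x y" "conj_to y z"
  then obtain h k where h: "x \<in> carrier G" "h \<in> carrier G" "y = h \<otimes> x \<otimes> inv h"
    "k \<in> carrier G" "z = k \<otimes> y \<otimes> inv k" by (auto simp: conj_to_def)
  then have "z = (k \<otimes> h) \<otimes> x \<otimes> inv (k \<otimes> h)" by (simp add: m_assoc inv_mult_group)
  then show "conj_to x z" using h unfolding conj_to_def by (intro conjI bexI[of _ "k \<otimes> h"]) auto
qed

lemma conj_to_inv: "conj_to x y \<Longrightarrow> conj_to (inv x) (inv y)"
proof -
  assume "conj_to x y"
  then obtain h where h: "x \<in> carrier G" "h \<in> carrier G" "y = h \<otimes> x \<otimes> inv h" by (auto simp: conj_to_def)
  then have "inv y = h \<otimes> inv x \<otimes> inv h" by (simp add: m_assoc inv_mult_group)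
  then show ?thesis using h unfolding conj_to_def by (intro conjI bexI[of _ h]) auto
qed

lemma conj_to_inv_iff: "x \<in> carrier G \<Longrightarrow> y \<in> carrier G \<Longrightarrow> conj_to (inv x) (inv y) \<longleftrightarrow> conj_to x y"
  using conj_to_inv[of x y] conj_to_inv[of "inv x" "inv y"] by auto

lemma conj_to_pow: "conj_to x y \<Longrightarrow> conj_to (x [^] (n::nat)) (y [^] n)"
proof -
  assume "conj_to x y"
  then obtain h where h: "x \<in> carrier G" "h \<in> carrier G" "y = h \<otimes> x \<otimes> inv h" by (auto simp: conj_to_def)
  then show ?thesis unfolding conj_to_def using conj_nat_pow[of h x n] by (intro conjI bexI[of _ h]) auto
qed

lemma conj_to_pow_iff:
  assumes "coprime n (order G)" "x \<in> carrier G" "y \<in> carrier G"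
  shows "conj_to (x [^] n) (y [^] n) \<longleftrightarrow> conj_to x y"
proof
  assume "conj_to (x [^] n) (y [^] n)"
  then obtain h where h: "h \<in> carrier G" "y [^] n = h \<otimes> x [^] n \<otimes> inv h" by (auto simp: conj_to_def)
  then have "y [^] n = (h \<otimes> x \<otimes> inv h) [^] n" using conj_nat_pow[of h x n] assms by simp
  then have "y = h \<otimes> x \<otimes> inv h" by (rule nat_pow_inj[OF assms(1,3), rotated]) (use h(1) assms(2) in simp)
  then show "conj_to x y" using h assms by (auto simp: conj_to_def)
qed (rule conj_to_pow)

lemma conj_to_one: "conj_to \<one> y \<Longrightarrow> y = \<one>"
  by (auto simp: conj_to_def)

lemma class_fun_conj_to: "f \<in> class_fun \<Longrightarrow> conj_to x y \<Longrightarrow> f y = f x"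
  by (auto simp: conj_to_def class_funD)

lemma inv_pow_nat: "x \<in> carrier G \<Longrightarrow> (inv x) [^] (n::nat) = inv (x [^] n)"
  by (rule nat_pow_inv)

text \<open>Orbit and stabiliser: the fibres of
  \<open>h \<mapsto> h \<otimes> x \<otimes> inv h\<close> partition the group and are left
  translates of the centraliser \<open>F x\<close>.\<close>

lemma card_class_dvd:
  assumes x: "x \<in> carrier G"
  shows "card {y. conj_to x y} dvd order G"
proof -
  define F where "F y = {h \<in> carrier G. h \<otimes> x \<otimes> inv h = y}" for y
  have fin_class: "finite {y. conj_to x y}"
    by (rule finite_subset[OF _ fin]) (auto dest: conj_to_carrier)
  have "card (F y) = card (F x)" if y: "conj_to x y" for y
  proof -
    obtain k where k: "k \<in> carrier G" "y = k \<otimes> x \<otimes> inv k" using y by (auto simp: conj_to_def)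
    have "bij_betw (\<lambda>h. k \<otimes> h) (F x) (F y)"
    proof (rule bij_betw_byWitness[where f' = "\<lambda>h. inv k \<otimes> h"])
      show "\<forall>a\<in>F x. inv k \<otimes> (k \<otimes> a) = a" "\<forall>a\<in>F y. k \<otimes> (inv k \<otimes> a) = a"
        using k by (auto simp: F_def)
      show "(\<lambda>h. k \<otimes> h) ` F x \<subseteq> F y"
      proof
        fix w assume "w \<in> (\<lambda>h. k \<otimes> h) ` F x"
        then obtain h where h: "h \<in> carrier G" "h \<otimes> x \<otimes> inv h = x" "w = k \<otimes> h"
          by (auto simp: F_def)
        have "w \<otimes> x \<otimes> inv w = k \<otimes> (h \<otimes> x \<otimes> inv h) \<otimes> inv k"
          using h(1,3) k x by (simp add: inv_mult_group m_assoc)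
        then show "w \<in> F y" using h k by (simp add: F_def)
      qed
      show "(\<lambda>h. inv k \<otimes> h) ` F y \<subseteq> F x"
      proof
        fix w assume "w \<in> (\<lambda>h. inv k \<otimes> h) ` F y"
        then obtain h where h: "h \<in> carrier G" "h \<otimes> x \<otimes> inv h = y" "w = inv k \<otimes> h"
          by (auto simp: F_def)
        have "w \<otimes> x \<otimes> inv w = inv k \<otimes> (h \<otimes> x \<otimes> inv h) \<otimes> k"
          using h(1,3) k x by (simp add: inv_mult_group m_assoc)
        also have "\<dots> = x" unfolding h(2) k(2) using k(1) x by (simp add: m_assoc)
        finally show "w \<in> F x" using h(1,3) k(1) by (simp add: F_def)
      qed
    qed
    then show ?thesis by (simp add: bij_betw_same_card)
  qed
  moreover have "carrier G = (\<Union>y\<in>{y. conj_to x y}. F y)"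
    using x by (auto simp: F_def conj_to_def)
  then have "order G = (\<Sum>y\<in>{y. conj_to x y}. card (F y))"
    unfolding Coset.order_def using fin_class
    by (simp only:) (rule card_UN_disjoint, auto simp: F_def)
  ultimately have "order G = card {y. conj_to x y} * card (F x)" by simp
  then show ?thesis by simp
qed

section \<open>Parity under inversion and the augmentation\<close>

lemma int_sum_inv: "(\<Sum>x\<in>carrier G. (f::'a \<Rightarrow> int) (inv x)) = (\<Sum>x\<in>carrier G. f x)"
  by (rule sum.reindex_bij_betw[OF bij_inv])

definition parity :: "int \<Rightarrow> ('a \<Rightarrow> int) \<Rightarrow> bool" where
  "parity a f \<longleftrightarrow> (\<forall>x\<in>carrier G. f (inv x) = a * f x)"

text \<open>Inversion reverses products, hence is an anti-automorphism of the group ring; on the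
  commutative centre it becomes multiplicative.\<close>

lemma parity_conv:
  assumes "f \<in> class_fun" "g \<in> class_fun" "parity a f" "parity b g"
  shows "parity (a * b) (conv f g)"
  unfolding parity_def
proof
  fix x assume x: "x \<in> carrier G"
  have "conv f g (inv x) = (\<Sum>y\<in>carrier G. f y * g (inv y \<otimes> inv x))"
    using x by (simp add: conv_def)
  also have "\<dots> = (\<Sum>y\<in>carrier G. f (inv y) * g (inv (inv y) \<otimes> inv x))"
    by (rule int_sum_inv[symmetric])
  also have "\<dots> = (\<Sum>y\<in>carrier G. a * b * (f y * g (inv y \<otimes> x)))"
  proof (rule sum.cong[OF refl])
    fix y assume y: "y \<in> carrier G"
    have "g (inv (inv y) \<otimes> inv x) = g (inv (x \<otimes> inv y))" using x y by (simp add: inv_mult_group)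
    also have "\<dots> = b * g (x \<otimes> inv y)" using assms(4) x y by (simp add: parity_def)
    also have "g (x \<otimes> inv y) = g (inv y \<otimes> x)" using class_fun_comm[OF assms(2)] x y by simp
    finally show "f (inv y) * g (inv (inv y) \<otimes> inv x) = a * b * (f y * g (inv y \<otimes> x))"
      using assms(3) y by (simp add: parity_def)
  qed
  also have "\<dots> = a * b * conv f g x" using x by (simp add: conv_def sum_distrib_left)
  finally show "conv f g (inv x) = a * b * conv f g x" .
qed

lemma parity_unit: "parity 1 unit_fun"
  by (auto simp: parity_def unit_fun_def)

lemma parity_cpow:
  assumes "f \<in> class_fun" "parity a f"
  shows "parity (a ^ n) (f ^* n)"
proof (induction n)
  case (Suc n)
  have "f ^* n \<in> class_fun" using C.nat_pow_closed assms(1) by simp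
  from parity_conv[OF this assms(1) Suc assms(2)] show ?case by (simp add: mult.commute)
qed (simp add: parity_unit)

text \<open>The augmentation, that is the trivial character, is a ring homomorphism.\<close>

lemma sum_conv: "(\<Sum>x\<in>carrier G. conv f g x) = (\<Sum>x\<in>carrier G. f x) * (\<Sum>x\<in>carrier G. g x)"
proof -
  have "(\<Sum>x\<in>carrier G. conv f g x) = (\<Sum>x\<in>carrier G. \<Sum>y\<in>carrier G. f y * g (inv y \<otimes> x))"
    by (simp add: conv_def)
  also have "\<dots> = (\<Sum>y\<in>carrier G. \<Sum>x\<in>carrier G. f y * g (inv y \<otimes> x))" by (rule sum.swap)
  also have "\<dots> = (\<Sum>y\<in>carrier G. f y * (\<Sum>x\<in>carrier G. g x))"
  proof (rule sum.cong[OF refl])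
    fix y assume "y \<in> carrier G"
    then have "inv y \<in> carrier G" by simp
    from sum.reindex_bij_betw[OF bij_mult_left[OF this], of g]
    show "(\<Sum>x\<in>carrier G. f y * g (inv y \<otimes> x)) = f y * (\<Sum>x\<in>carrier G. g x)"
      by (simp add: sum_distrib_left[symmetric])
  qed
  finally show ?thesis by (simp add: sum_distrib_right)
qed

lemma conv_sum_right:
  "conv f (\<lambda>x. \<Sum>i\<in>I. a i * F i x) = (\<lambda>x. \<Sum>i\<in>I. a i * conv f (F i) x)"
proof
  fix x
  have "(\<Sum>y\<in>carrier G. f y * (\<Sum>i\<in>I. a i * F i (inv y \<otimes> x)))
      = (\<Sum>i\<in>I. \<Sum>y\<in>carrier G. f y * (a i * F i (inv y \<otimes> x)))"
    unfolding sum_distrib_left by (rule sum.swap)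
  then show "conv f (\<lambda>x. \<Sum>i\<in>I. a i * F i x) x = (\<Sum>i\<in>I. a i * conv f (F i) x)"
    by (simp add: conv_def sum_distrib_left mult.left_commute)
qed

definition odd_fun :: "('a \<Rightarrow> int) set" where
  "odd_fun = {f \<in> class_fun. parity (-1) f}"

text \<open>Sum zero removes the trivial character; odd functions satisfy it automatically. The
  price is that \<open>unit_fun\<close> is excluded, so zeroth powers need separate
  treatment.\<close>

definition even_fun :: "('a \<Rightarrow> int) set" where
  "even_fun = {f \<in> class_fun. parity 1 f \<and> (\<Sum>x\<in>carrier G. f x) = 0}"

lemma odd_fun_sum:
  assumes "f \<in> odd_fun"
  shows "(\<Sum>x\<in>carrier G. f x) = 0"
proof -
  have "(\<Sum>x\<in>carrier G. f x) = (\<Sum>x\<in>carrier G. f (inv x))" by (rule int_sum_inv[symmetric])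
  also have "\<dots> = (\<Sum>x\<in>carrier G. - f x)"
    using assms by (intro sum.cong refl) (simp add: odd_fun_def parity_def)
  finally show ?thesis by (simp add: sum_negf)
qed

lemma conv_odd_odd: "f \<in> odd_fun \<Longrightarrow> g \<in> odd_fun \<Longrightarrow> conv f g \<in> even_fun"
  using parity_conv[of f g "-1" "-1"] odd_fun_sum[of f]
  by (simp add: odd_fun_def even_fun_def conv_closed sum_conv)

lemma conv_odd_even: "f \<in> odd_fun \<Longrightarrow> g \<in> even_fun \<Longrightarrow> conv f g \<in> odd_fun"
  using parity_conv[of f g "-1" 1]
  by (simp add: odd_fun_def even_fun_def conv_closed)

lemma conv_even_even: "f \<in> even_fun \<Longrightarrow> g \<in> even_fun \<Longrightarrow> conv f g \<in> even_fun"
  using parity_conv[of f g 1 1]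
  by (simp add: even_fun_def conv_closed sum_conv)

lemma sum_cpow:
  assumes "f \<in> class_fun" "(\<Sum>x\<in>carrier G. f x) = 0" "n > 0"
  shows "(\<Sum>x\<in>carrier G. (f ^* n) x) = 0"
  using assms(3)
proof (cases n)
  case (Suc k)
  then show ?thesis using assms(1,2) by (simp add: sum_conv)
qed simp

lemma cpow_even: "f \<in> even_fun \<Longrightarrow> n > 0 \<Longrightarrow> f ^* n \<in> even_fun"
  using parity_cpow[of f 1 n] C.nat_pow_closed[of f n] sum_cpow[of f n]
  by (simp add: even_fun_def)

lemma cpow_odd: "f \<in> odd_fun \<Longrightarrow> odd n \<Longrightarrow> f ^* n \<in> odd_fun"
  using parity_cpow[of f "-1" n] C.nat_pow_closed[of f n]
  by (simp add: odd_fun_def)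

end

section \<open>Odd order: no non-trivial class is closed under inversion\<close>

locale odd_group = finite_group +
  assumes odd_order: "odd (order G)"
begin

lemma odd_pow_eq_one:
  assumes "x \<in> carrier G" "x [^] (2::nat) = \<one>"
  shows "x = \<one>"
proof (rule nat_pow_inj[of 2])
  show "coprime 2 (order G)" using odd_order by (simp add: coprime_left_2_iff_odd)
qed (use assms in auto)

text \<open>If \<open>h\<close> conjugates \<open>x\<close> to \<open>inv x\<close>, it interchanges
  the two, and so does every odd power of \<open>h\<close>. The power with exponent
  \<open>order G\<close> is the identity, so \<open>x = inv x\<close>.\<close>

lemma not_conj_to_inv:
  assumes "conj_to x (inv x)"
  shows "x = \<one>"
proof -
  obtain h where h: "x \<in> carrier G" "h \<in> carrier G" "inv x = h \<otimes> x \<otimes> inv h"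
    using assms by (auto simp: conj_to_def)
  have inv_h: "h \<otimes> inv x \<otimes> inv h = x"
  proof -
    have "inv (inv x) = inv (h \<otimes> x \<otimes> inv h)" by (rule arg_cong[OF h(3)])
    also have "\<dots> = h \<otimes> inv x \<otimes> inv h" using h(1,2) by (simp add: inv_mult_group m_assoc)
    finally show ?thesis using h(1) by simp
  qed
  have "h [^] n \<otimes> x \<otimes> inv (h [^] n) = (if even n then x else inv x)" for n :: nat
  proof (induction n)
    case (Suc n)
    have "h [^] Suc n \<otimes> x \<otimes> inv (h [^] Suc n) = h \<otimes> (h [^] n \<otimes> x \<otimes> inv (h [^] n)) \<otimes> inv h"
      using h(1,2) by (simp only: nat_pow_Suc2) (simp add: inv_mult_group m_assoc)
    also have "\<dots> = (if even (Suc n) then x else inv x)"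
      unfolding Suc using h(3) inv_h by auto
    finally show ?case .
  qed (use h in simp)
  from this[of "order G"] have "x = inv x" using odd_order h by (simp add: pow_order_eq_1)
  then have "x \<otimes> x = \<one>" using h(1) r_inv[of x] by simp
  then have "x [^] (2::nat) = \<one>" using h(1) by (simp add: numeral_2_eq_2)
  then show ?thesis using odd_pow_eq_one h(1) by blast
qed

text \<open>One representative per pair of inverse non-trivial classes. \<open>K x\<close> joins the
  classes of \<open>x\<close> and \<open>inv x\<close>, and the choice is made from this set, so
  elements with equal \<open>K\<close> receive the same representative.\<close>

lemma exists_class_representatives:
  obtains r :: nat and g :: "nat \<Rightarrow> 'a" where
    "\<And>i. i < r \<Longrightarrow> g i \<in> carrier G" "\<And>i. i < r \<Longrightarrow> g i \<noteq> \<one>"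
    "\<And>x. x \<in> carrier G \<Longrightarrow> x \<noteq> \<one> \<Longrightarrow> \<exists>i<r. conj_to (g i) x \<or> conj_to (g i) (inv x)"
    "\<And>i j. i < r \<Longrightarrow> j < r \<Longrightarrow> conj_to (g i) (g j) \<or> conj_to (g i) (inv (g j)) \<Longrightarrow> i = j"
proof -
  define K where "K x = {y. conj_to x y \<or> conj_to x (inv y) \<and> y \<in> carrier G}" for x
  have self: "x \<in> K x" if "x \<in> carrier G" for x using that by (simp add: K_def conj_to_refl)
  have K_eq: "K y = K x" if x: "x \<in> carrier G" and y: "y \<in> K x" for x y
  proof -
    have yG: "y \<in> carrier G" using y by (auto simp: K_def dest: conj_to_carrier)
    have "conj_to y z \<or> conj_to y (inv z) \<longleftrightarrow> conj_to x z \<or> conj_to x (inv z)" if z: "z \<in> carrier G" for z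
    proof (cases "conj_to x y")
      case True
      then show ?thesis using conj_to_trans[OF True] conj_to_trans[OF conj_to_sym[OF True]] by blast
    next
      case False
      then have xy: "conj_to x (inv y)" using y by (simp add: K_def)
      have e1: "conj_to (inv y) z \<longleftrightarrow> conj_to y (inv z)" using conj_to_inv_iff[of y "inv z"] yG z by simp
      have e2: "conj_to (inv y) (inv z) \<longleftrightarrow> conj_to y z" using conj_to_inv_iff[of y z] yG z by simp
      show ?thesis using e1 e2 conj_to_trans[OF xy] conj_to_trans[OF conj_to_sym[OF xy]] by blast
    qed
    then show ?thesis by (auto simp: K_def dest: conj_to_carrier)
  qed
  define rep where "rep x = (SOME y. y \<in> K x)" for x
  have rep: "rep x \<in> K x" if "x \<in> carrier G" for x
    unfolding rep_def using self[OF that] by (rule someI)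
  define S where "S = rep ` (carrier G - {\<one>})"
  have "finite S" by (simp add: S_def)
  then obtain g where g: "bij_betw g {0..<card S} S" using ex_bij_betw_nat_finite by blast
  have gS: "g i \<in> S" if "i < card S" for i using g that by (auto simp: bij_betw_def)
  have SG: "s \<in> carrier G \<and> s \<noteq> \<one>" if s: "s \<in> S" for s
  proof -
    obtain x where x: "x \<in> carrier G" "x \<noteq> \<one>" "s = rep x" using s by (auto simp: S_def)
    then have sK: "s \<in> K x" using rep by simp
    then have "s \<in> carrier G" by (auto simp: K_def dest: conj_to_carrier)
    moreover have "s \<noteq> \<one>"
    proof
      assume "s = \<one>"
      then have "conj_to x \<one>" using sK by (auto simp: K_def)
      then show False using conj_to_one[OF conj_to_sym] x(2) by blast
    qed
    ultimately show ?thesis by blast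
  qed
  show thesis
  proof (rule that[of "card S" g])
    show "g i \<in> carrier G" "g i \<noteq> \<one>" if "i < card S" for i using SG gS that by auto
    show "\<exists>i<card S. conj_to (g i) x \<or> conj_to (g i) (inv x)" if x: "x \<in> carrier G" "x \<noteq> \<one>" for x
    proof -
      have "rep x \<in> S" using x by (simp add: S_def)
      then have "rep x \<in> g ` {0..<card S}" using bij_betw_imp_surj_on[OF g] by simp
      then obtain i where i: "i < card S" "g i = rep x" by (metis atLeastLessThan_iff imageE)
      have "x \<in> K (g i)" unfolding i(2) using K_eq[OF x(1) rep[OF x(1)]] self[OF x(1)] by simp
      then show ?thesis using i by (auto simp: K_def)
    qed
    show "i = j" if ij: "i < card S" "j < card S" "conj_to (g i) (g j) \<or> conj_to (g i) (inv (g j))" for i j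
    proof -
      obtain x y where x: "x \<in> carrier G" "g i = rep x" and y: "y \<in> carrier G" "g j = rep y"
        using gS[OF ij(1)] gS[OF ij(2)] by (auto simp: S_def)
      have "g j \<in> K (g i)" using ij(3) SG[OF gS[OF ij(2)]] by (auto simp: K_def)
      with SG[OF gS[OF ij(1)]] have "K (g j) = K (g i)" by (intro K_eq) auto
      moreover have "K (g i) = K x" using K_eq[OF x(1) rep[OF x(1)]] x(2) by simp
      moreover have "K (g j) = K y" using K_eq[OF y(1) rep[OF y(1)]] y(2) by simp
      ultimately have "K x = K y" by (simp only:)
      then have "rep x = rep y" unfolding rep_def by (simp only:)
      then have "g i = g j" using x(2) y(2) by (simp only:)
      then show ?thesis using g ij(1,2) by (auto simp: bij_betw_def dest: inj_onD)
    qed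
  qed
qed

end

section \<open>Coordinates on odd and even class functions\<close>

locale class_representatives = odd_group +
  fixes r :: nat and g :: "nat \<Rightarrow> 'a"
  assumes g_closed: "i < r \<Longrightarrow> g i \<in> carrier G"
    and g_not_one: "i < r \<Longrightarrow> g i \<noteq> \<one>"
    and g_ex: "x \<in> carrier G \<Longrightarrow> x \<noteq> \<one> \<Longrightarrow> \<exists>i<r. conj_to (g i) x \<or> conj_to (g i) (inv x)"
    and g_unique: "i < r \<Longrightarrow> j < r \<Longrightarrow> conj_to (g i) (g j) \<or> conj_to (g i) (inv (g j)) \<Longrightarrow> i = j"
begin

definition class_index :: "'a \<Rightarrow> nat" where
  "class_index x = (THE i. i < r \<and> (conj_to (g i) x \<or> conj_to (g i) (inv x)))"

text \<open>An orientation: in each pair of inverse classes the one containing \<open>g i\<close> is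
  positive. The value 0 at the identity makes this an odd function on all of
  \<open>G\<close>.\<close>

definition class_sign :: "'a \<Rightarrow> int" where
  "class_sign x = (if x \<in> carrier G - {\<one>} then if conj_to (g (class_index x)) x then 1 else -1 else 0)"

lemma class_index_eqI:
  assumes "i < r" "x \<in> carrier G" "conj_to (g i) x \<or> conj_to (g i) (inv x)"
  shows "class_index x = i"
  unfolding class_index_def
proof (rule the_equality)
  fix j assume j: "j < r \<and> (conj_to (g j) x \<or> conj_to (g j) (inv x))"
  have gi: "g i \<in> carrier G" "g j \<in> carrier G" using g_closed assms(1) j by auto
  have flip: "conj_to (g k) (inv x) \<longleftrightarrow> conj_to (inv (g k)) x" if "g k \<in> carrier G" for k
    using conj_to_inv_iff[of "g k" "inv x"] assms(2) that by simp
  have gg: "conj_to (inv (g j)) (g i) \<longleftrightarrow> conj_to (g j) (inv (g i))"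
    using conj_to_inv_iff[of "g j" "inv (g i)"] gi by simp
  have gg2: "conj_to (inv (g j)) (inv (g i)) \<longleftrightarrow> conj_to (g j) (g i)"
    using conj_to_inv_iff[of "g j" "g i"] gi by simp
  have "conj_to (g j) (g i) \<or> conj_to (g j) (inv (g i))"
    using assms(3) j unfolding flip[OF gi(1)] flip[OF gi(2)] gg[symmetric]
    using conj_to_trans conj_to_sym gg gg2 by blast
  then show "j = i" using g_unique j assms(1) by blast
qed (use assms in blast)

lemma class_index:
  assumes "x \<in> carrier G" "x \<noteq> \<one>"
  shows "class_index x < r" "conj_to (g (class_index x)) x \<or> conj_to (g (class_index x)) (inv x)"
  using g_ex[OF assms] class_index_eqI assms(1) by blast+

lemma class_sign_values:
  assumes "x \<in> carrier G" "x \<noteq> \<one>"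
  shows "class_sign x = 1 \<or> class_sign x = -1"
  using assms by (simp add: class_sign_def)

lemma class_sign_square: "x \<in> carrier G \<Longrightarrow> x \<noteq> \<one> \<Longrightarrow> class_sign x * class_sign x = 1"
  using class_sign_values[of x] by auto

lemma class_sign_one [simp]: "class_sign \<one> = 0"
  by (simp add: class_sign_def)

lemma class_sign_pos_iff: "x \<in> carrier G \<Longrightarrow> x \<noteq> \<one> \<Longrightarrow> class_sign x = 1 \<longleftrightarrow> conj_to (g (class_index x)) x"
  by (simp add: class_sign_def)

lemma not_conj_to_both:
  assumes "i < r" "conj_to (g i) x"
  shows "\<not> conj_to (g i) (inv x)"
proof
  assume "conj_to (g i) (inv x)"
  then have "conj_to x (inv x)" using assms(2) conj_to_sym conj_to_trans by blast
  then have "x = \<one>" by (rule not_conj_to_inv)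
  then have "g i = \<one>" using assms(2) conj_to_sym conj_to_one by blast
  then show False using g_not_one assms(1) by blast
qed

lemma class_sign_neg_iff:
  assumes "x \<in> carrier G" "x \<noteq> \<one>"
  shows "class_sign x = -1 \<longleftrightarrow> conj_to (g (class_index x)) (inv x)"
  using class_index[OF assms] not_conj_to_both[of "class_index x" x] assms by (auto simp: class_sign_def)

lemma class_index_conj_to:
  assumes "conj_to x y" "x \<noteq> \<one>"
  shows "class_index y = class_index x"
proof (rule class_index_eqI)
  have x: "x \<in> carrier G" using assms(1) conj_to_carrier by blast
  show "class_index x < r" using class_index[OF x assms(2)] by blast
  show "y \<in> carrier G" using assms(1) conj_to_carrier by blast
  show "conj_to (g (class_index x)) y \<or> conj_to (g (class_index x)) (inv y)"
    using class_index(2)[OF x assms(2)] conj_to_trans conj_to_inv assms(1) by blast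
qed

lemma conj_to_not_one: "conj_to x y \<Longrightarrow> x \<noteq> \<one> \<Longrightarrow> y \<noteq> \<one>"
  using conj_to_one conj_to_sym by blast

lemma class_sign_conj_to:
  assumes "conj_to x y" "x \<noteq> \<one>"
  shows "class_sign y = class_sign x"
proof -
  have c: "x \<in> carrier G" "y \<in> carrier G" using assms(1) conj_to_carrier by blast+
  have "conj_to (g (class_index x)) y \<longleftrightarrow> conj_to (g (class_index x)) x" using conj_to_trans conj_to_sym assms(1) by blast
  then show ?thesis
    using c assms(2) conj_to_not_one[OF assms] class_index_conj_to[OF assms] by (simp add: class_sign_def)
qed

lemma class_index_inv:
  assumes "x \<in> carrier G" "x \<noteq> \<one>"
  shows "class_index (inv x) = class_index x"
  using class_index[OF assms] assms by (intro class_index_eqI) auto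

lemma class_sign_inv:
  assumes "x \<in> carrier G"
  shows "class_sign (inv x) = - class_sign x"
proof (cases "x = \<one>")
  case False
  then have ne: "inv x \<noteq> \<one>" using assms by (simp add: inv_eq_1_iff)
  have "class_sign (inv x) = 1 \<longleftrightarrow> class_sign x = -1"
    using class_sign_pos_iff[of "inv x"] class_sign_neg_iff[OF assms False] class_index_inv[OF assms False] ne assms by simp
  then show ?thesis using class_sign_values[OF assms False] class_sign_values[of "inv x"] ne assms by auto
qed simp

lemma class_index_g [simp]: "i < r \<Longrightarrow> class_index (g i) = i"
  by (rule class_index_eqI) (auto simp: g_closed conj_to_refl)

lemma class_sign_g [simp]: "i < r \<Longrightarrow> class_sign (g i) = 1"
  using class_sign_pos_iff[of "g i"] by (simp add: g_closed g_not_one conj_to_refl)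

definition half_class :: "nat \<Rightarrow> 'a set" where
  "half_class i = {x \<in> carrier G - {\<one>}. class_index x = i \<and> class_sign x = 1}"

definition c :: "nat \<Rightarrow> int" where
  "c i = int (card (half_class i))"

lemma half_class_eq:
  assumes i: "i < r"
  shows "half_class i = {x. conj_to (g i) x}"
proof (rule subset_antisym; rule subsetI)
  fix x assume "x \<in> half_class i"
  then show "x \<in> {x. conj_to (g i) x}" using class_sign_pos_iff[of x] by (simp add: half_class_def)
next
  fix x assume "x \<in> {x. conj_to (g i) x}"
  then have x: "conj_to (g i) x" by simp
  then show "x \<in> half_class i"
    using conj_to_carrier(2)[OF x] conj_to_not_one[OF x g_not_one[OF i]] class_index_conj_to[OF x g_not_one[OF i]]
      class_sign_conj_to[OF x g_not_one[OF i]] i by (simp add: half_class_def)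
qed

text \<open>A class size divides the odd group order. This parity later turns signs counted over
  elements into signs counted over classes, and it determines \<open>order G\<close> modulo
  4.\<close>

lemma odd_c: "i < r \<Longrightarrow> odd (card (half_class i))"
  using card_class_dvd[OF g_closed, of i] odd_order unfolding half_class_eq by (meson dvd_trans)

lemma c_pos: "i < r \<Longrightarrow> c i > 0"
  using odd_c[of i] odd_pos by (simp add: c_def)

lemma finite_half_class [simp]: "finite (half_class i)"
  by (simp add: half_class_def)

lemma card_class_index: "i < r \<Longrightarrow> int (card {x \<in> carrier G - {\<one>}. class_index x = i}) = 2 * c i"
proof -
  assume "i < r"
  have "{x \<in> carrier G - {\<one>}. class_index x = i} = half_class i \<union> m_inv G ` half_class i"
  proof (rule subset_antisym; rule subsetI)
    fix x assume x: "x \<in> {x \<in> carrier G - {\<one>}. class_index x = i}"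
    show "x \<in> half_class i \<union> m_inv G ` half_class i"
    proof (cases "class_sign x = 1")
      case False
      then have "inv x \<in> half_class i"
        using x class_sign_values[of x] by (auto simp: half_class_def class_sign_inv class_index_inv inv_eq_1_iff)
      then have "inv (inv x) \<in> m_inv G ` half_class i" by blast
      then show ?thesis using x by simp
    qed (use x in \<open>simp add: half_class_def\<close>)
  qed (auto simp: half_class_def class_index_inv inv_eq_1_iff)
  moreover have "half_class i \<inter> m_inv G ` half_class i = {}"
    by (auto simp: half_class_def class_sign_inv)
  moreover have "card (m_inv G ` half_class i) = card (half_class i)"
    by (rule card_image) (auto simp: half_class_def inj_on_def)
  ultimately show ?thesis by (simp add: card_Un_disjoint c_def)
qed

lemma sum_by_class_index:
  "(\<Sum>x\<in>carrier G - {\<one>}. (f::'a \<Rightarrow> int) x) = (\<Sum>i<r. \<Sum>x\<in>{x \<in> carrier G - {\<one>}. class_index x = i}. f x)"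
  by (rule sum.group[symmetric]) (use class_index(1) in auto)

lemma order_eq: "int (order G) = 1 + 2 * (\<Sum>i<r. c i)"
proof -
  have "int (card (carrier G - {\<one>})) = (\<Sum>i<r. 2 * c i)"
    using sum_by_class_index[of "\<lambda>_. 1"] card_class_index by simp
  moreover have "int (card (carrier G - {\<one>})) = int (order G) - 1"
    using card_Suc_Diff1[OF fin one_closed] by (simp add: Coset.order_def)
  ultimately show ?thesis by (simp add: sum_distrib_left)
qed

text \<open>
  The functions \<open>D i\<close> and \<open>E i\<close> are the bases dual to evaluation at the representatives \<open>g i\<close> of the
  odd class functions and of the even class functions of sum zero.
\<close>

definition D :: "nat \<Rightarrow> 'a \<Rightarrow> int" where
  "D i x = (if x \<in> carrier G - {\<one>} \<and> class_index x = i then class_sign x else 0)"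

definition E :: "nat \<Rightarrow> 'a \<Rightarrow> int" where
  "E i x = (if x = \<one> then - 2 * c i else if x \<in> carrier G \<and> class_index x = i then 1 else 0)"

lemma conj_class_index_class_sign:
  assumes "x \<in> carrier G" "h \<in> carrier G" "x \<noteq> \<one>"
  shows "class_index (h \<otimes> x \<otimes> inv h) = class_index x" "class_sign (h \<otimes> x \<otimes> inv h) = class_sign x" "h \<otimes> x \<otimes> inv h \<noteq> \<one>"
  using class_index_conj_to[OF conj_to_conj[OF assms(1,2)] assms(3)] class_sign_conj_to[OF conj_to_conj[OF assms(1,2)] assms(3)]
    conj_to_not_one[OF conj_to_conj[OF assms(1,2)] assms(3)] by simp_all

lemma D_odd: "D i \<in> odd_fun"
proof -
  have "D i (h \<otimes> x \<otimes> inv h) = D i x" if "x \<in> carrier G" "h \<in> carrier G" for x h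
    using that conj_class_index_class_sign[of x h] by (cases "x = \<one>") (auto simp: D_def)
  moreover have "D i (inv x) = - D i x" if "x \<in> carrier G" for x
    using that by (auto simp: D_def class_index_inv class_sign_inv inv_eq_1_iff)
  ultimately show ?thesis
    by (simp add: odd_fun_def class_fun_def parity_def) (simp add: D_def)
qed

lemma E_even: "i < r \<Longrightarrow> E i \<in> even_fun"
proof -
  assume i: "i < r"
  have "E i (h \<otimes> x \<otimes> inv h) = E i x" if "x \<in> carrier G" "h \<in> carrier G" for x h
    using that conj_class_index_class_sign[of x h] by (cases "x = \<one>") (auto simp: E_def)
  moreover have "E i (inv x) = E i x" if "x \<in> carrier G" for x
    using that by (auto simp: E_def class_index_inv inv_eq_1_iff)
  \<comment> \<open>The value \<open>- 2 * c i\<close> at the identity balances the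
    \<open>2 * c i\<close> elements of index \<open>i\<close>.\<close>
  moreover have "(\<Sum>x\<in>carrier G. E i x) = 0"
  proof -
    have "(\<Sum>x\<in>carrier G. E i x) = E i \<one> + (\<Sum>x\<in>carrier G - {\<one>}. E i x)"
      by (rule sum.remove) auto
    also have "(\<Sum>x\<in>carrier G - {\<one>}. E i x) = (\<Sum>x\<in>carrier G - {\<one>}. if class_index x = i then 1 else 0)"
      by (intro sum.cong) (auto simp: E_def)
    also have "\<dots> = int (card {x \<in> carrier G - {\<one>}. class_index x = i})"
      by (simp add: sum.If_cases Int_def)
    also have "\<dots> = 2 * c i" by (rule card_class_index[OF i])
    finally show ?thesis by (simp add: E_def)
  qed
  moreover have "E i x = 0" if "x \<notin> carrier G" for x using that by (auto simp: E_def)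
  ultimately show ?thesis by (simp add: even_fun_def class_fun_def parity_def)
qed

lemma class_fun_class_index:
  assumes "f \<in> class_fun" "parity a f" "x \<in> carrier G" "x \<noteq> \<one>"
  shows "f x = (if class_sign x = 1 then 1 else a) * f (g (class_index x))"
proof (cases "class_sign x = 1")
  case True
  then show ?thesis using class_fun_conj_to[OF assms(1)] class_sign_pos_iff assms(3,4) by auto
next
  case False
  then have "conj_to (g (class_index x)) (inv x)" using class_sign_values class_sign_neg_iff assms(3,4) by blast
  then have "f (inv x) = f (g (class_index x))" by (rule class_fun_conj_to[OF assms(1)])
  moreover have "f (inv (inv x)) = a * f (inv x)"
    using assms(2,3) inv_closed unfolding parity_def by blast
  ultimately show ?thesis using False assms(3) by simp
qed

lemma odd_decomp:
  assumes "f \<in> odd_fun"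
  shows "f = (\<lambda>x. \<Sum>i<r. f (g i) * D i x)"
proof
  fix x
  consider "x \<notin> carrier G" | "x = \<one>" | "x \<in> carrier G" "x \<noteq> \<one>" by blast
  then show "f x = (\<Sum>i<r. f (g i) * D i x)"
  proof cases
    case 1
    then show ?thesis using assms by (auto simp: odd_fun_def D_def class_funD)
  next
    case 2
    have "f (inv \<one>) = (-1) * f \<one>" using assms one_closed unfolding odd_fun_def parity_def by blast
    then have "f \<one> = 0" by simp
    then show ?thesis using 2 by (simp add: D_def)
  next
    case 3
    have "(\<Sum>i<r. f (g i) * D i x) = (\<Sum>i<r. if i = class_index x then f (g i) * class_sign x else 0)"
      using 3 by (intro sum.cong) (auto simp: D_def)
    also have "\<dots> = f (g (class_index x)) * class_sign x" using class_index(1)[OF 3] by simp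
    also have "\<dots> = f x"
      using class_fun_class_index[of f "-1", OF _ _ 3] assms class_sign_values[OF 3] by (auto simp: odd_fun_def)
    finally show ?thesis by simp
  qed
qed

lemma even_decomp:
  assumes "f \<in> even_fun"
  shows "f = (\<lambda>x. \<Sum>i<r. f (g i) * E i x)"
proof
  fix x
  have ne: "f x = f (g (class_index x))" if "x \<in> carrier G" "x \<noteq> \<one>" for x
    using class_fun_class_index[of f 1, OF _ _ that] assms by (auto simp: even_fun_def)
  consider "x \<notin> carrier G" | "x = \<one>" | "x \<in> carrier G" "x \<noteq> \<one>" by blast
  then show "f x = (\<Sum>i<r. f (g i) * E i x)"
  proof cases
    case 1
    then have "x \<noteq> \<one>" by auto
    then show ?thesis using assms 1 by (simp add: even_fun_def E_def class_funD)
  next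
    case 2
    \<comment> \<open>At the identity the expansion holds because the sum condition determines this
      value from the others.\<close>
    have "0 = f \<one> + (\<Sum>x\<in>carrier G - {\<one>}. f x)"
      using assms sum.remove[OF fin one_closed, of f] by (simp add: even_fun_def)
    also have "(\<Sum>x\<in>carrier G - {\<one>}. f x) = (\<Sum>i<r. \<Sum>x\<in>{x \<in> carrier G - {\<one>}. class_index x = i}. f (g i))"
      unfolding sum_by_class_index using ne by (intro sum.cong refl) auto
    also have "\<dots> = (\<Sum>i<r. 2 * c i * f (g i))"
      using card_class_index by (intro sum.cong refl) simp
    finally show ?thesis using 2 by (simp add: E_def sum_negf mult_ac)
  next
    case 3
    have "(\<Sum>i<r. f (g i) * E i x) = (\<Sum>i<r. if i = class_index x then f (g i) else 0)"
      using 3 by (intro sum.cong) (auto simp: E_def)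
    also have "\<dots> = f (g (class_index x))" using class_index(1)[OF 3] by simp
    finally show ?thesis using ne[OF 3] by simp
  qed
qed

lemma conv_one: "conv f h \<one> = (\<Sum>y\<in>carrier G. f y * h (inv y))"
  by (simp add: conv_def)

text \<open>The form \<open>conv f h \<one>\<close> sums \<open>f y * h (inv y)\<close>; on odd
  functions it is the negative of the scalar product, whence the sign.\<close>

lemma conv_D_D:
  assumes "i < r" "j < r"
  shows "conv (D i) (D j) \<one> = (if i = j then - 2 * c i else 0)"
proof -
  have "conv (D i) (D j) \<one> = (\<Sum>y\<in>carrier G. - (D i y * D j y))"
    unfolding conv_one using D_odd[of j] by (intro sum.cong refl) (simp add: odd_fun_def parity_def)
  also have "\<dots> = (\<Sum>y\<in>carrier G - {\<one>}. - (D i y * D j y))"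
    by (rule sum.mono_neutral_right) (auto simp: D_def)
  also have "\<dots> = (\<Sum>y\<in>carrier G - {\<one>}. if class_index y = i \<and> i = j then -1 else 0)"
    by (intro sum.cong refl) (auto simp: D_def class_sign_square)
  also have "\<dots> = (if i = j then - int (card {x \<in> carrier G - {\<one>}. class_index x = i}) else 0)"
    by (auto simp: sum.If_cases Int_def)
  finally show ?thesis using card_class_index assms by simp
qed

text \<open>On even functions the form is the scalar product itself. The identity, where no
  \<open>E i\<close> vanishes, adds the rank-one part \<open>4 * c i * c j\<close>.\<close>

lemma conv_E_E:
  assumes "i < r" "j < r"
  shows "conv (E i) (E j) \<one> = (if i = j then 2 * c i else 0) + 4 * c i * c j"
proof -
  have "conv (E i) (E j) \<one> = (\<Sum>y\<in>carrier G. E i y * E j y)"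
    unfolding conv_one using E_even[OF assms(2)]
    by (intro sum.cong refl) (simp add: even_fun_def parity_def)
  also have "\<dots> = E i \<one> * E j \<one> + (\<Sum>y\<in>carrier G - {\<one>}. E i y * E j y)"
    by (rule sum.remove) auto
  also have "(\<Sum>y\<in>carrier G - {\<one>}. E i y * E j y)
      = (\<Sum>y\<in>carrier G - {\<one>}. if class_index y = i \<and> i = j then 1 else 0)"
    by (intro sum.cong refl) (auto simp: E_def)
  also have "\<dots> = (if i = j then int (card {x \<in> carrier G - {\<one>}. class_index x = i}) else 0)"
    by (auto simp: sum.If_cases Int_def)
  also have "E i \<one> * E j \<one> = 4 * c i * c j" by (simp add: E_def)
  finally show ?thesis unfolding card_class_index[OF assms(1)] by simp
qed

section \<open>The power map as a signed permutation of the representatives\<close>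

lemma pow_not_one:
  assumes "coprime n (order G)" "x \<in> carrier G" "x \<noteq> \<one>"
  shows "x [^] (n::nat) \<noteq> \<one>"
  using nat_pow_inj[OF assms(1,2) one_closed] assms(3) by auto

text \<open>With \<open>power_sign\<close> this describes a monomial matrix:
  \<open>g i [^] n\<close> is conjugate to the representative of index
  \<open>power_index n i\<close> or to its inverse, as \<open>power_sign n i\<close> tells.\<close>

definition power_index :: "nat \<Rightarrow> nat \<Rightarrow> nat" where
  "power_index n i = class_index (g i [^] n)"

definition power_sign :: "nat \<Rightarrow> nat \<Rightarrow> int" where
  "power_sign n i = class_sign (g i [^] n)"

lemma power_sign_values:
  assumes "coprime n (order G)" "i < r"
  shows "power_sign n i = 1 \<or> power_sign n i = -1"
  unfolding power_sign_def using class_sign_values pow_not_one assms g_closed g_not_one by simp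

text \<open>If two indices agree, \<open>g i [^] n\<close> is conjugate to \<open>g j [^] n\<close>
  or to its inverse, and conjugacy can be pulled back along the injective power map.\<close>

lemma power_index_permutation:
  assumes "coprime n (order G)"
  shows "bij_betw (power_index n) {..<r} {..<r}"
proof -
  have g: "g i [^] n \<in> carrier G" "g i [^] n \<noteq> \<one>" if "i < r" for i
    using that g_closed g_not_one pow_not_one[OF assms] by auto
  have "inj_on (power_index n) {..<r}"
  proof (rule inj_onI)
    fix i j assume ij: "i \<in> {..<r}" "j \<in> {..<r}" "power_index n i = power_index n j"
    define k where "k = power_index n i"
    have kj: "k = power_index n j" unfolding k_def by (rule ij(3))
    have gi: "g i \<in> carrier G" "g j \<in> carrier G" using ij g_closed by auto
    have "conj_to (g k) (g i [^] n) \<or> conj_to (g k) (inv (g i [^] n))"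
      using class_index(2)[of "g i [^] n"] g ij unfolding k_def power_index_def by auto
    moreover have "conj_to (g k) (g j [^] n) \<or> conj_to (g k) (inv (g j [^] n))"
      using class_index(2)[of "g j [^] n"] g ij(2) unfolding kj power_index_def by auto
    moreover have "conj_to (inv (g i [^] n)) (inv (g j [^] n)) \<longleftrightarrow> conj_to (g i [^] n) (g j [^] n)"
      using conj_to_inv_iff gi by simp
    moreover have "conj_to (inv (g i [^] n)) (g j [^] n) \<longleftrightarrow> conj_to (g i [^] n) (inv (g j [^] n))"
      using conj_to_inv_iff[of "g i [^] n" "inv (g j [^] n)"] gi by simp
    ultimately have "conj_to (g i [^] n) (g j [^] n) \<or> conj_to (g i [^] n) (inv (g j [^] n))"
      using conj_to_sym conj_to_trans by blast
    moreover have "inv (g j [^] n) = inv (g j) [^] n" using inv_pow_nat[OF gi(2)] by simp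
    ultimately have "conj_to (g i) (g j) \<or> conj_to (g i) (inv (g j))"
      using conj_to_pow_iff[OF assms, of "g i" "g j"] conj_to_pow_iff[OF assms, of "g i" "inv (g j)"] gi by simp
    then show "i = j" using g_unique ij by simp
  qed
  moreover have "power_index n ` {..<r} \<subseteq> {..<r}" using class_index(1) g by (auto simp: power_index_def)
  ultimately show ?thesis by (simp add: bij_betw_def endo_inj_surj)
qed

text \<open>
  All classes have odd size, so the sign of the power map on elements is already determined on the
  class representatives.
\<close>

lemma sign_on_power:
  assumes "coprime n (order G)"
  shows "sign_on (carrier G) (\<lambda>x. x [^] n) = (\<Prod>i<r. power_sign n i)"
proof -
  define X where "X = carrier G - {\<one>}"
  define T where "T = {x \<in> X. class_sign x = 1}"
  have "inj_on (\<lambda>x. x [^] n) (carrier G)"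
    using nat_pow_inj[OF assms] by (auto intro: inj_onI)
  then have inj: "inj_on (\<lambda>x. x [^] n) X" by (rule inj_on_subset) (auto simp: X_def)
  have "(\<lambda>x. x [^] n) ` X \<subseteq> X" using pow_not_one[OF assms] by (auto simp: X_def)
  then have bX: "bij_betw (\<lambda>x. x [^] n) X X"
    using inj by (simp add: bij_betw_def endo_inj_surj X_def)
  have "sign_on X (\<lambda>x. x [^] n) = (-1) ^ card {x \<in> T. x [^] n \<notin> T}"
  proof (rule sign_on_gauss[where j = "\<lambda>x. inv x"])
    show "(inv x \<in> T) = (x \<notin> T)" if "x \<in> X" for x
      using that class_sign_values[of x] by (auto simp: T_def X_def class_sign_inv inv_eq_1_iff)
  qed (auto simp: X_def T_def bX[unfolded X_def] inv_eq_1_iff inv_pow_nat)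
  also have "{x \<in> T. x [^] n \<notin> T} = (\<Union>i\<in>{i. i < r \<and> power_sign n i = -1}. half_class i)"
  proof -
    have e: "class_sign (x [^] n) = power_sign n (class_index x)" "x [^] n \<in> X" if "x \<in> T" for x
    proof -
      have x: "x \<in> carrier G" "x \<noteq> \<one>" "class_sign x = 1" using that by (auto simp: T_def X_def)
      have i: "class_index x < r" using class_index(1) x by blast
      have "conj_to (g (class_index x) [^] n) (x [^] n)" using class_sign_pos_iff x conj_to_pow by blast
      then show "class_sign (x [^] n) = power_sign n (class_index x)"
        unfolding power_sign_def using class_sign_conj_to pow_not_one[OF assms] g_closed[OF i] g_not_one[OF i] by blast
      show "x [^] n \<in> X" using x pow_not_one[OF assms] by (simp add: X_def)
    qed
    have "x \<in> T \<longleftrightarrow> (\<exists>i<r. x \<in> half_class i)" for x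
      using class_index(1) by (auto simp: T_def X_def half_class_def)
    moreover have "x [^] n \<notin> T \<longleftrightarrow> power_sign n (class_index x) = -1" if "x \<in> T" for x
      using e[OF that] class_sign_values[of "x [^] n"] that by (auto simp: T_def X_def)
    moreover have "class_index x = i" if "x \<in> half_class i" for x i using that by (simp add: half_class_def)
    ultimately show ?thesis by blast
  qed
  also have "card \<dots> = (\<Sum>i\<in>{i. i < r \<and> power_sign n i = -1}. card (half_class i))"
    by (rule card_UN_disjoint) (auto simp: half_class_def)
  also have "(-1) ^ \<dots> = (\<Prod>i\<in>{i. i < r \<and> power_sign n i = -1}. (-1) ^ card (half_class i) :: int)"
    by (rule power_sum)
  \<comment> \<open>A class turned negative contributes all its elements to the exponent; their
    number is odd, so the class counts once.\<close>
  also have "\<dots> = (\<Prod>i\<in>{i. i < r \<and> power_sign n i = -1}. -1)"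
    using odd_c by (intro prod.cong refl) auto
  also have "\<dots> = (\<Prod>i\<in>{i. i < r \<and> power_sign n i = -1}. power_sign n i)"
    by (intro prod.cong refl) auto
  also have "\<dots> = (\<Prod>i<r. power_sign n i)"
    using power_sign_values[OF assms] by (intro prod.mono_neutral_left) auto
  finally have "sign_on X (\<lambda>x. x [^] n) = (\<Prod>i<r. power_sign n i)" .
  moreover have "sign_on ({\<one>} \<union> X) (\<lambda>x. x [^] n) = sign_on {\<one>} (\<lambda>x. x [^] n) * sign_on X (\<lambda>x. x [^] n)"
    using bX by (intro sign_on_Un) (auto simp: X_def bij_betw_def)
  moreover have "sign_on {\<one>} (\<lambda>x. x [^] n) = 1" by (rule sign_on_fixed) auto
  moreover have "{\<one>} \<union> X = carrier G" by (auto simp: X_def)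
  ultimately show ?thesis by simp
qed

end

section \<open>Determinants and an odd generator\<close>

lemma mat_times:
  "mat n n (\<lambda>(i, j). f i j) * mat n n (\<lambda>(i, j). h i j) =
   mat n n (\<lambda>(i, j). \<Sum>k<n. f i k * (h k j :: 'b :: comm_ring_1))"
  by (rule eq_matI) (auto simp: scalar_prod_def lessThan_atLeast0)

lemma det_mat_times:
  fixes f h :: "nat \<Rightarrow> nat \<Rightarrow> 'b :: comm_ring_1"
  shows "det (mat n n (\<lambda>(i, j). \<Sum>k<n. f i k * h k j)) =
    det (mat n n (\<lambda>(i, j). f i j)) * det (mat n n (\<lambda>(i, j). h i j))"
  unfolding mat_times[symmetric] by (rule det_mult[where n = n]) auto

lemma det_mat_transpose:
  fixes f :: "nat \<Rightarrow> nat \<Rightarrow> 'b :: comm_ring_1"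
  shows "det (mat n n (\<lambda>(i, j). f j i)) = det (mat n n (\<lambda>(i, j). f i j))"
proof -
  have "mat n n (\<lambda>(i, j). f j i) = transpose_mat (mat n n (\<lambda>(i, j). f i j))"
    by (rule eq_matI) auto
  then show ?thesis using det_transpose[of "mat n n (\<lambda>(i, j). f i j)" n] by simp
qed

lemma det_mat_diagonal:
  "det (mat n n (\<lambda>(i, j). if i = j then d i else 0)) = (\<Prod>i<n. d i :: 'b :: comm_ring_1)"
proof -
  have "det (mat n n (\<lambda>(i, j). if i = j then d i else 0))
      = prod_list (diag_mat (mat n n (\<lambda>(i, j). if i = j then d i else 0)))"
    by (rule det_upper_triangular[where n = n]) auto
  also have "diag_mat (mat n n (\<lambda>(i, j). if i = j then d i else 0)) = map d [0..<n]"
    by (auto simp: diag_mat_def)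
  also have "prod_list \<dots> = (\<Prod>i<n. d i)"
    by (simp add: prod.distinct_set_conv_list[symmetric] lessThan_atLeast0)
  finally show ?thesis .
qed

lemma det_mat_cong_mod:
  fixes f h :: "nat \<Rightarrow> nat \<Rightarrow> int"
  assumes "\<And>i j. i < n \<Longrightarrow> j < n \<Longrightarrow> [f i j = h i j] (mod m)"
  shows "[det (mat n n (\<lambda>(i, j). f i j)) = det (mat n n (\<lambda>(i, j). h i j))] (mod m)"
proof -
  have p: "p i < n" if "p permutes {0..<n}" "i < n" for p i
    using permutes_in_image[OF that(1), of i] that(2) by simp
  have d: "det (mat n n (\<lambda>(i, j). k i j)) =
      (\<Sum>p\<in>{p. p permutes {0..<n}}. signof p * (\<Prod>i = 0..<n. k i (p i)))" for k :: "nat \<Rightarrow> nat \<Rightarrow> int"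
    unfolding det_def'[OF mat_carrier] using p by (intro sum.cong arg_cong2[where f = times] prod.cong refl) auto
  show ?thesis
    unfolding d by (intro cong_sum cong_mult cong_refl cong_prod assms) (use p in auto)
qed

text \<open>The matrix determinant lemma for a column of ones times the row \<open>w\<close>. The
  identity \<open>B * R = R * U\<close>, with \<open>R\<close> unipotent with first column all ones
  and \<open>U\<close> upper triangular, needs no division and so works over every commutative
  ring.\<close>

lemma det_identity_plus_row:
  fixes w :: "nat \<Rightarrow> 'b :: comm_ring_1"
  shows "det (mat n n (\<lambda>(i, j). (if i = j then 1 else 0) + w j)) = 1 + (\<Sum>j<n. w j)"
proof (cases "n = 0")
  case False
  define R where "R i j = (if j = 0 \<or> i = j then 1 else 0 :: 'b)" for i j :: nat
  define U where "U i j = (if i = 0 then if j = 0 then 1 + (\<Sum>j<n. w j) else w j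
    else if i = j then 1 else 0)" for i j :: nat
  define B where "B i j = (if i = j then 1 else 0) + w j" for i j :: nat
  have tr: "det (mat n n (\<lambda>(i, j). k i j)) = (\<Prod>i<n. k i i)"
    if "\<And>i j. i < n \<Longrightarrow> j < i \<Longrightarrow> k i j = 0" for k :: "nat \<Rightarrow> nat \<Rightarrow> 'b"
  proof -
    have "det (mat n n (\<lambda>(i, j). k i j)) = prod_list (diag_mat (mat n n (\<lambda>(i, j). k i j)))"
      by (rule det_upper_triangular[where n = n]) (auto simp: that)
    also have "diag_mat (mat n n (\<lambda>(i, j). k i j)) = map (\<lambda>i. k i i) [0..<n]"
      by (auto simp: diag_mat_def)
    also have "prod_list \<dots> = (\<Prod>i<n. k i i)"
      by (simp add: prod.distinct_set_conv_list[symmetric] lessThan_atLeast0)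
    finally show ?thesis .
  qed
  have "det (mat n n (\<lambda>(i, j). R i j)) = det (mat n n (\<lambda>(i, j). R j i))"
    by (rule det_mat_transpose[symmetric])
  also have "\<dots> = (\<Prod>i<n. R i i)" by (rule tr) (auto simp: R_def)
  also have "\<dots> = 1" by (simp add: R_def)
  finally have detR: "det (mat n n (\<lambda>(i, j). R i j)) = 1" .
  have "det (mat n n (\<lambda>(i, j). U i j)) = (\<Prod>i<n. U i i)" by (rule tr) (auto simp: U_def)
  also have "\<dots> = U 0 0 * (\<Prod>i\<in>{..<n} - {0}. U i i)"
    by (rule prod.remove) (use False in auto)
  also have "(\<Prod>i\<in>{..<n} - {0}. U i i) = 1" by (intro prod.neutral) (auto simp: U_def)
  finally have detU: "det (mat n n (\<lambda>(i, j). U i j)) = 1 + (\<Sum>j<n. w j)" by (simp add: U_def)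
  have "(\<Sum>k<n. B i k * R k j) = (\<Sum>k<n. R i k * U k j)" if ij: "i < n" "j < n" for i j
  proof -
    have "(\<Sum>k<n. B i k * R k j) = (if j = 0 then 1 + (\<Sum>k<n. w k) else B i j)"
    proof (cases "j = 0")
      case True
      have "(\<Sum>k<n. B i k * R k j) = (\<Sum>k<n. (if i = k then 1 else 0) + w k)"
        using True by (intro sum.cong refl) (simp add: B_def R_def)
      also have "\<dots> = 1 + (\<Sum>k<n. w k)" using ij by (simp add: sum.distrib)
      finally show ?thesis using True by simp
    next
      case False
      have "(\<Sum>k<n. B i k * R k j) = (\<Sum>k<n. if k = j then B i k else 0)"
        using False by (intro sum.cong refl) (simp add: R_def)
      then show ?thesis using ij False by simp
    qed
    moreover have "(\<Sum>k<n. R i k * U k j) = U 0 j + (if i = 0 then 0 else U i j)"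
    proof -
      have "(\<Sum>k<n. R i k * U k j) = R i 0 * U 0 j + (\<Sum>k\<in>{..<n} - {0}. R i k * U k j)"
        by (rule sum.remove) (use False in auto)
      also have "(\<Sum>k\<in>{..<n} - {0}. R i k * U k j) = (\<Sum>k\<in>{..<n} - {0}. if k = i then U k j else 0)"
        by (intro sum.cong refl) (auto simp: R_def)
      also have "\<dots> = (if i = 0 then 0 else U i j)" using ij by (simp add: sum.delta)
      finally show ?thesis by (simp add: R_def)
    qed
    ultimately show ?thesis by (simp add: U_def B_def)
  qed
  then have "mat n n (\<lambda>(i, j). \<Sum>k<n. B i k * R k j) = mat n n (\<lambda>(i, j). \<Sum>k<n. R i k * U k j)"
    by (intro eq_matI) auto
  then have "det (mat n n (\<lambda>(i, j). B i j)) * det (mat n n (\<lambda>(i, j). R i j))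
      = det (mat n n (\<lambda>(i, j). R i j)) * det (mat n n (\<lambda>(i, j). U i j))"
    unfolding det_mat_times[symmetric] by simp
  then show ?thesis using detR detU by (simp add: B_def)
qed simp

lemma det_diagonal_plus_rank_one:
  fixes d w :: "nat \<Rightarrow> 'b :: comm_ring_1"
  shows "det (mat n n (\<lambda>(i, j). (if i = j then d i else 0) + d i * w j)) =
    (\<Prod>i<n. d i) * (1 + (\<Sum>j<n. w j))"
proof -
  have "(\<Sum>k<n. (if i = k then d i else 0) * ((if k = j then 1 else 0) + w j))
      = (if i = j then d i else 0) + d i * w j" if "i < n" for i j
  proof -
    have "(\<Sum>k<n. (if i = k then d i else 0) * ((if k = j then 1 else 0) + w j))
        = (\<Sum>k<n. if k = i then d i * ((if i = j then 1 else 0) + w j) else 0)"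
      by (intro sum.cong refl) auto
    then show ?thesis using that by (simp add: algebra_simps)
  qed
  then have "mat n n (\<lambda>(i, j). (if i = j then d i else 0) + d i * w j)
      = mat n n (\<lambda>(i, j). \<Sum>k<n. (if i = k then d i else 0) * ((if k = j then 1 else 0) + w j))"
    by (intro eq_matI) auto
  then show ?thesis
    by (simp only: det_mat_times det_mat_diagonal det_identity_plus_row)
qed

text \<open>Rows and columns are permuted alike, so the two permutation matrices \<open>P\<close>
  and its transpose cancel and the sign of \<open>\<pi>\<close> never has to be computed; only the
  row factors \<open>e i\<close> remain.\<close>

lemma det_permute_scale:
  fixes b :: "nat \<Rightarrow> nat \<Rightarrow> 'b :: comm_ring_1"
  assumes "bij_betw \<pi> {..<n} {..<n}"
  shows "det (mat n n (\<lambda>(i, j). e i * b (\<pi> i) (\<pi> j))) = (\<Prod>i<n. e i) * det (mat n n (\<lambda>(i, j). b i j))"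
proof -
  have \<pi>: "\<pi> i < n" if "i < n" for i using assms that by (auto simp: bij_betw_def)
  have inj: "\<pi> i = \<pi> j \<longleftrightarrow> i = j" if "i < n" "j < n" for i j
    using assms that by (auto simp: bij_betw_def inj_on_def)
  define Q where "Q i k = (if k = \<pi> i then e i else 0)" for i k
  define P where "P i k = (if k = \<pi> i then 1 else 0 :: 'b)" for i k
  have sQ: "(\<Sum>k<n. Q i k * x k) = e i * x (\<pi> i)" if "i < n" for i x
    using \<pi>[OF that] by (simp add: Q_def if_distrib[of "\<lambda>c. c * _"] cong: if_cong)
  have sP: "(\<Sum>k<n. x k * P i k) = x (\<pi> i)" if "i < n" for i x
    using \<pi>[OF that] by (simp add: P_def if_distrib[of "\<lambda>c. _ * c"] cong: if_cong)
  have "mat n n (\<lambda>(i, j). e i * b (\<pi> i) (\<pi> j))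
      = mat n n (\<lambda>(i, j). \<Sum>k<n. Q i k * (\<Sum>l<n. b k l * P j l))"
    by (rule eq_matI) (auto simp: sP sQ)
  then have "det (mat n n (\<lambda>(i, j). e i * b (\<pi> i) (\<pi> j))) =
      det (mat n n (\<lambda>(i, j). Q i j)) * (det (mat n n (\<lambda>(i, j). b i j)) * det (mat n n (\<lambda>(i, j). P j i)))"
    by (simp only: det_mat_times)
  also have "\<dots> = det (mat n n (\<lambda>(i, j). Q i j)) * det (mat n n (\<lambda>(i, j). P j i))
      * det (mat n n (\<lambda>(i, j). b i j))"
    by (simp add: mult_ac)
  also have "det (mat n n (\<lambda>(i, j). Q i j)) * det (mat n n (\<lambda>(i, j). P j i))
      = det (mat n n (\<lambda>(i, j). \<Sum>k<n. Q i k * P j k))"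
    by (simp only: det_mat_times)
  also have "mat n n (\<lambda>(i, j). \<Sum>k<n. Q i k * P j k) = mat n n (\<lambda>(i, j). if i = j then e i else 0)"
    by (rule eq_matI) (auto simp: sP, auto simp: Q_def inj)
  also have "det \<dots> = (\<Prod>i<n. e i)" by (rule det_mat_diagonal)
  finally show ?thesis .
qed

section \<open>Class functions modulo a prime\<close>

context finite_group
begin

definition cong_fun :: "nat \<Rightarrow> ('a \<Rightarrow> int) \<Rightarrow> ('a \<Rightarrow> int) \<Rightarrow> bool" where
  "cong_fun q f h \<longleftrightarrow> (\<forall>x\<in>carrier G. [f x = h x] (mod int q))"

lemma cong_fun_refl [simp]: "cong_fun q f f"
  by (simp add: cong_fun_def)

lemma cong_fun_sym: "cong_fun q f h \<Longrightarrow> cong_fun q h f"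
  by (auto simp: cong_fun_def intro: cong_sym)

lemma cong_fun_trans: "cong_fun q f h \<Longrightarrow> cong_fun q h k \<Longrightarrow> cong_fun q f k"
  by (auto simp: cong_fun_def intro: cong_trans)

lemma cong_fun_conv: "cong_fun q f f' \<Longrightarrow> cong_fun q h h' \<Longrightarrow> cong_fun q (conv f h) (conv f' h')"
  by (auto simp: cong_fun_def conv_def intro!: cong_sum cong_mult)

lemma cong_fun_add: "cong_fun q f f' \<Longrightarrow> cong_fun q h h' \<Longrightarrow> cong_fun q (\<lambda>x. f x + h x) (\<lambda>x. f' x + h' x)"
  by (auto simp: cong_fun_def intro: cong_add)

lemma cong_fun_diff: "cong_fun q f f' \<Longrightarrow> cong_fun q h h' \<Longrightarrow> cong_fun q (\<lambda>x. f x - h x) (\<lambda>x. f' x - h' x)"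
  by (auto simp: cong_fun_def intro: cong_diff)

lemma conv_zero [simp]: "conv (\<lambda>_. 0) f = (\<lambda>_. 0)" "conv f (\<lambda>_. 0) = (\<lambda>_. 0)"
  by (auto simp: conv_def)

lemma conv_add_right: "conv f (\<lambda>x. h x + k x) = (\<lambda>x. conv f h x + conv f k x)"
  by (auto simp: conv_def algebra_simps sum.distrib)

lemma conv_add_left: "conv (\<lambda>x. h x + k x) f = (\<lambda>x. conv h f x + conv k f x)"
  by (auto simp: conv_def algebra_simps sum.distrib)

lemma conv_diff_right: "conv f (\<lambda>x. h x - k x) = (\<lambda>x. conv f h x - conv f k x)"
  by (auto simp: conv_def algebra_simps sum_subtractf)

lemma cpow_closed: "f \<in> class_fun \<Longrightarrow> f ^* n \<in> class_fun"
  using C.nat_pow_closed by simp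

lemma cpow_add: "f \<in> class_fun \<Longrightarrow> f ^* (m + n) = conv (f ^* m) (f ^* n)"
  using C.nat_pow_mult[of f m n] by simp

lemma cpow_prime_power_cong:
  assumes "prime q" "coprime q (order G)" "f \<in> class_fun" "x \<in> carrier G"
  shows "[(f ^* (q ^ n)) (x [^] (q ^ n)) = f x] (mod int q)"
proof (induction n)
  case 0
  then show ?case using assms by (simp add: conv_unit)
next
  case (Suc n)
  have "f ^* (q ^ Suc n) = (f ^* (q ^ n)) ^* q" "x [^] (q ^ Suc n) = (x [^] (q ^ n)) [^] q"
    using assms C.nat_pow_pow[of f "q ^ n" q] by (simp_all add: nat_pow_pow mult.commute)
  then show ?case
    using cpow_prime_cong[OF assms(1,2) cpow_closed[OF assms(3)], of "x [^] (q ^ n)" "q ^ n"] assms(4) Suc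
    by (auto intro: cong_trans)
qed

text \<open>For \<open>n = totient (order G)\<close> Euler's theorem makes
  \<open>x \<mapsto> x [^] (q ^ n)\<close> the identity on the group, so the \<open>n\<close>-fold
  Frobenius is the identity modulo \<open>q\<close>. In particular there are no nilpotents.\<close>

lemma cpow_period:
  assumes "prime q" "coprime q (order G)"
  obtains n where "n > 0" "\<And>f. f \<in> class_fun \<Longrightarrow> cong_fun q (f ^* (q ^ n)) f"
proof -
  have o: "order G > 0" by (simp add: order_gt_0_iff_finite)
  define n where "n = totient (order G)"
  have "[q ^ n = 1] (mod order G)" unfolding n_def by (rule euler_theorem) (rule assms)
  moreover have "q ^ n \<ge> 1" using assms(1) by (simp add: Suc_le_eq prime_gt_0_nat)
  ultimately obtain v where v: "q ^ n = 1 + order G * v"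
    by (metis cong_to_1_nat dvd_def le_add_diff_inverse)
  have "x [^] (q ^ n) = x" if "x \<in> carrier G" for x
    unfolding v using that by (simp add: nat_pow_mult[symmetric] nat_pow_pow[symmetric] pow_order_eq_1)
  then have "cong_fun q (f ^* (q ^ n)) f" if "f \<in> class_fun" for f
    using cpow_prime_power_cong[OF assms that, of _ n] by (simp add: cong_fun_def)
  moreover have "n > 0" using o by (simp add: n_def)
  ultimately show thesis using that by blast
qed

text \<open>Values are restricted to least residues, one function for each residue class, so that
  the set is finite and its cardinality can be minimised.\<close>

definition annihilator :: "nat \<Rightarrow> ('a \<Rightarrow> int) \<Rightarrow> ('a \<Rightarrow> int) set" where
  "annihilator q d = {z \<in> class_fun. (\<forall>x\<in>carrier G. z x \<in> {0..<int q}) \<and> cong_fun q (conv z d) (\<lambda>_. 0)}"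

lemma finite_annihilator: "finite (annihilator q d)"
proof -
  have "finite {f. \<forall>x. (x \<in> carrier G \<longrightarrow> f x \<in> {0..<int q}) \<and> (x \<notin> carrier G \<longrightarrow> f x = 0)}"
    by (rule finite_set_of_finite_funs) auto
  then show ?thesis
    by (rule finite_subset[rotated]) (auto simp: annihilator_def class_fun_def)
qed

text \<open>
  Modulo \<open>q\<close> the class functions form a reduced ring in which \<open>f ^* N\<close> is idempotent for
  \<open>N = q ^ n - 1\<close>; an odd function with minimal annihilator generates all odd functions.
\<close>

lemma exists_odd_generator:
  assumes "prime q" "odd q" "coprime q (order G)"
  obtains d where "d \<in> odd_fun" "\<And>v. v \<in> odd_fun \<Longrightarrow> \<exists>w\<in>even_fun. cong_fun q v (conv d w)"
proof -
  obtain n where n: "n > 0" "\<And>f. f \<in> class_fun \<Longrightarrow> cong_fun q (f ^* (q ^ n)) f"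
    using cpow_period[OF assms(1,3)] by blast
  \<comment> \<open>\<open>N\<close> is even and \<open>k = N - 1\<close> is odd, so
    \<open>d ^* N\<close> is an even function and \<open>d ^* k\<close> an odd one; modulo
    \<open>q\<close>, \<open>d ^* N\<close> acts as the identity on multiples of
    \<open>d\<close>.\<close>
  define N where "N = q ^ n - 1"
  have q2: "q > 2" using assms(1,2) prime_ge_2_nat[of q] by (cases "q = 2") auto
  have qn: "q ^ n = Suc N" using q2 by (simp add: N_def)
  have "q ^ 1 \<le> q ^ n" using n(1) q2 by (intro power_increasing) auto
  then have "N \<ge> 2" using qn q2 by simp
  then obtain k where k: "N = Suc k" by (cases N) auto
  have "odd (q ^ n)" using assms(2) by simp
  then have "even N" unfolding qn by simp
  have "odd k" using \<open>even N\<close> k by simp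
  have per: "cong_fun q (f ^* Suc N) f" if "f \<in> class_fun" for f using n(2)[OF that] qn by simp
  have sq: "f ^* Suc N = conv (conv f f) (f ^* k)" if "f \<in> class_fun" for f
  proof -
    have "f ^* Suc N = f ^* (2 + k)" using k by simp
    also have "\<dots> = conv (f ^* 2) (f ^* k)" by (rule cpow_add[OF that])
    also have "f ^* 2 = conv f f" using that by (simp add: numeral_2_eq_2 conv_unit)
    finally show ?thesis .
  qed
  have "(\<lambda>_. 0) \<in> odd_fun" by (simp add: odd_fun_def class_fun_def parity_def)
  then obtain d where d: "d \<in> odd_fun" "\<And>y. y \<in> odd_fun \<Longrightarrow> card (annihilator q d) \<le> card (annihilator q y)"
    using ex_has_least_nat[of "\<lambda>y. y \<in> odd_fun" _ "\<lambda>y. card (annihilator q y)"] by blast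
  have dc: "d \<in> class_fun" using d(1) by (simp add: odd_fun_def)
  have "\<exists>w\<in>even_fun. cong_fun q v (conv d w)" if v: "v \<in> odd_fun" for v
  proof -
    have vc: "v \<in> class_fun" using v by (simp add: odd_fun_def)
    define e where "e = d ^* N"
    have ec: "e \<in> class_fun" unfolding e_def by (rule cpow_closed[OF dc])
    have "parity ((-1) ^ N) e" unfolding e_def using d(1) by (intro parity_cpow) (auto simp: odd_fun_def)
    then have ep: "parity 1 e" using \<open>even N\<close> by simp
    have ev: "conv e v \<in> odd_fun"
      using parity_conv[OF ec vc ep, of "-1"] v conv_closed[OF ec vc] by (simp add: odd_fun_def)
    define u where "u x = v x - conv e v x" for x
    have u: "u \<in> odd_fun"
      using v ev by (simp add: odd_fun_def class_fun_def parity_def u_def)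
    then have uc: "u \<in> class_fun" by (simp add: odd_fun_def)
    have ed: "cong_fun q (conv e d) d" using per[OF dc] by (simp add: e_def)
    have "conv d u = (\<lambda>x. conv d v x - conv d (conv e v) x)"
      unfolding u_def by (rule conv_diff_right)
    moreover have "conv d (conv e v) = conv (conv e d) v"
      using conv_commute[OF dc, of e] by (simp add: conv_assoc[symmetric])
    moreover have "cong_fun q (\<lambda>x. conv d v x - conv (conv e d) v x) (\<lambda>x. conv d v x - conv d v x)"
      by (intro cong_fun_diff cong_fun_conv ed cong_fun_refl)
    ultimately have du: "cong_fun q (conv d u) (\<lambda>_. 0)" by simp
    then have ud: "cong_fun q (conv u d) (\<lambda>_. 0)" using conv_commute[OF dc, of u] by simp
    define d' where "d' x = d x + u x" for x
    have d': "d' \<in> odd_fun"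
      using d(1) u by (simp add: odd_fun_def class_fun_def parity_def d'_def)
    have sub: "annihilator q d' \<subseteq> annihilator q d"
    proof
      fix z assume z: "z \<in> annihilator q d'"
      then have zd: "cong_fun q (conv z d') (\<lambda>_. 0)" by (auto simp: annihilator_def)
      have "cong_fun q (conv z (conv d d)) (conv z (conv d' d))"
      proof -
        have "conv d' d = (\<lambda>x. conv d d x + conv u d x)" unfolding d'_def by (rule conv_add_left)
        moreover have "cong_fun q (\<lambda>x. conv d d x + conv u d x) (\<lambda>x. conv d d x + 0)"
          by (intro cong_fun_add cong_fun_refl ud)
        ultimately have "cong_fun q (conv d' d) (conv d d)" by simp
        then show ?thesis by (rule cong_fun_conv[OF cong_fun_refl cong_fun_sym])
      qed
      also have "conv z (conv d' d) = conv (conv z d') d" by (simp add: conv_assoc)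
      finally have "cong_fun q (conv z (conv d d)) (conv (\<lambda>_. 0) d)"
        using cong_fun_conv[OF zd cong_fun_refl, of d] by (rule cong_fun_trans)
      then have zdd: "cong_fun q (conv z (conv d d)) (\<lambda>_. 0)" by simp
      have "cong_fun q (conv z d) (conv z (d ^* Suc N))"
        using per[OF dc] by (intro cong_fun_conv cong_fun_refl) (rule cong_fun_sym)
      also have "conv z (d ^* Suc N) = conv (conv z (conv d d)) (d ^* k)"
        unfolding sq[OF dc] by (simp add: conv_assoc)
      finally have "cong_fun q (conv z d) (conv (\<lambda>_. 0) (d ^* k))"
        using cong_fun_conv[OF zdd cong_fun_refl, of "d ^* k"] by (rule cong_fun_trans)
      then show "z \<in> annihilator q d" using z by (simp add: annihilator_def)
    qed
    have u0: "cong_fun q u (\<lambda>_. 0)"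
    proof (rule ccontr)
      assume nu: "\<not> cong_fun q u (\<lambda>_. 0)"
      define u' where "u' x = u x mod int q" for x
      have u'u: "cong_fun q u' u" by (simp add: cong_fun_def u'_def cong_def)
      have "u' \<in> class_fun" using uc by (simp add: class_fun_def u'_def)
      moreover have "cong_fun q (conv u' d) (\<lambda>_. 0)"
        using cong_fun_conv[OF u'u cong_fun_refl] ud by (rule cong_fun_trans)
      ultimately have in_d: "u' \<in> annihilator q d" using q2 by (simp add: annihilator_def u'_def)
      have "u' \<notin> annihilator q d'"
      proof
        assume "u' \<in> annihilator q d'"
        then have "cong_fun q (conv u' d') (\<lambda>_. 0)" by (simp add: annihilator_def)
        then have "cong_fun q (conv u d') (\<lambda>_. 0)"
          by (rule cong_fun_trans[OF cong_fun_conv[OF cong_fun_sym[OF u'u] cong_fun_refl]])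
        moreover have "conv u d' = (\<lambda>x. conv u d x + conv u u x)"
          unfolding d'_def by (rule conv_add_right)
        ultimately have "cong_fun q (\<lambda>x. conv u d x + conv u u x - conv u d x) (\<lambda>x. 0 - 0)"
          using ud by (intro cong_fun_diff) auto
        \<comment> \<open>Modulo \<open>q\<close> the function \<open>u\<close> is a multiple of its
          own square, so a vanishing square forces \<open>u\<close> to vanish.\<close>
        then have uu: "cong_fun q (conv u u) (\<lambda>_. 0)" by simp
        have "cong_fun q u (conv (conv u u) (u ^* k))"
          using cong_fun_sym[OF per[OF uc]] unfolding sq[OF uc] .
        then have "cong_fun q u (conv (\<lambda>_. 0) (u ^* k))" by (rule cong_fun_trans) (rule cong_fun_conv[OF uu cong_fun_refl])
        then show False using nu by simp
      qed
      then have "annihilator q d' \<subset> annihilator q d" using sub in_d by blast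
      then have "card (annihilator q d') < card (annihilator q d)" by (rule psubset_card_mono[OF finite_annihilator])
      then show False using d(2)[OF d'] by simp
    qed
    define w where "w = conv (d ^* k) v"
    have "d ^* k \<in> odd_fun" by (rule cpow_odd[OF d(1) \<open>odd k\<close>])
    then have w: "w \<in> even_fun" unfolding w_def using v by (rule conv_odd_odd)
    have "conv e v = conv d w"
    proof -
      have "e = conv (d ^* k) d" by (simp add: e_def k)
      also have "\<dots> = conv d (d ^* k)" by (rule conv_commute[OF cpow_closed[OF dc]])
      finally show ?thesis by (simp add: w_def conv_assoc)
    qed
    moreover have "cong_fun q v (conv e v)"
      using u0 by (simp add: cong_fun_def u_def cong_iff_dvd_diff)
    ultimately show ?thesis using w by auto
  qed
  then show thesis using that d(1) by blast
qed

end

section \<open>Groups of odd order\<close>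

context class_representatives
begin

text \<open>Multiplication by \<open>f\<close> on the even functions of sum zero. The coordinates of
  the image are its values at the \<open>g j\<close>, for \<open>E\<close> and \<open>D\<close>
  alike: an even \<open>f\<close> gives an endomorphism, an odd \<open>f\<close> a map into the odd
  functions.\<close>

definition mult_det :: "('a \<Rightarrow> int) \<Rightarrow> int" where
  "mult_det f = det (mat r r (\<lambda>(j, i). conv f (E i) (g j)))"

lemma E_class: "i < r \<Longrightarrow> E i \<in> class_fun"
  using E_even by (simp add: even_fun_def)

lemma conv_even_apply:
  assumes "w \<in> even_fun"
  shows "conv f w x = (\<Sum>i<r. conv f (E i) x * w (g i))"
proof -
  have "conv f w = conv f (\<lambda>x. \<Sum>i<r. w (g i) * E i x)"
    by (rule arg_cong[OF even_decomp[OF assms]])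
  then show ?thesis unfolding conv_sum_right by (simp add: mult.commute)
qed

lemma conv_odd_apply:
  assumes "w \<in> odd_fun"
  shows "conv f w x = (\<Sum>i<r. conv f (D i) x * w (g i))"
proof -
  have "conv f w = conv f (\<lambda>x. \<Sum>i<r. w (g i) * D i x)"
    by (rule arg_cong[OF odd_decomp[OF assms]])
  then show ?thesis unfolding conv_sum_right by (simp add: mult.commute)
qed

text \<open>The inner factor \<open>h\<close> maps the even functions of sum zero to themselves, so
  the matrices compose; the outer factor \<open>f\<close> may be odd.\<close>

lemma mult_det_conv:
  assumes "h \<in> even_fun"
  shows "mult_det (conv f h) = mult_det f * mult_det h"
proof -
  have "conv (conv f h) (E i) (g j) = (\<Sum>k<r. conv f (E k) (g j) * conv h (E i) (g k))"
    if "i < r" for i j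
    unfolding conv_assoc by (rule conv_even_apply[OF conv_even_even[OF assms E_even[OF that]]])
  then have "mat r r (\<lambda>(j, i). conv (conv f h) (E i) (g j))
      = mat r r (\<lambda>(j, i). \<Sum>k<r. conv f (E k) (g j) * conv h (E i) (g k))"
    by (intro eq_matI) auto
  then show ?thesis unfolding mult_det_def by (simp only: det_mat_times)
qed

lemma E_g: "i < r \<Longrightarrow> j < r \<Longrightarrow> E i (g j) = (if j = i then 1 else 0)"
  using g_not_one[of j] g_closed[of j] by (auto simp: E_def)

lemma D_g: "i < r \<Longrightarrow> j < r \<Longrightarrow> D i (g j) = (if j = i then 1 else 0)"
  using g_not_one[of j] g_closed[of j] by (auto simp: D_def)

lemma mult_det_unit: "mult_det unit_fun = 1"
proof -
  have "mat r r (\<lambda>(j, i). conv unit_fun (E i) (g j)) = mat r r (\<lambda>(j, i). if j = i then 1 else 0)"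
    by (rule eq_matI) (auto simp: conv_unit E_class E_g)
  then show ?thesis unfolding mult_det_def by (simp only: det_mat_diagonal) simp
qed

lemma mult_det_cpow: "h \<in> even_fun \<Longrightarrow> mult_det (h ^* n) = mult_det h ^ n"
  by (induction n) (simp_all add: mult_det_unit mult_det_conv)

lemma g_pow:
  assumes "coprime n (order G)" "i < r"
  shows "g i [^] n \<in> carrier G" "g i [^] n \<noteq> \<one>"
  using g_closed[OF assms(2)] g_not_one[OF assms(2)] pow_not_one[OF assms(1)] by auto

text \<open>Frobenius is applied to the product \<open>F = conv d (E i)\<close>. Modulo
  \<open>q\<close>, \<open>E i ^* q\<close> agrees at the representatives with
  \<open>E (power_index q i)\<close>, and \<open>F ^* q\<close> at \<open>g j [^] q\<close>
  reproduces \<open>F (g j)\<close>. Moving from \<open>g j [^] q\<close> to its representative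
  costs \<open>power_sign q j\<close>.\<close>

lemma mult_det_frobenius:
  assumes q: "prime q" "odd q" "coprime q (order G)" and d: "d \<in> odd_fun"
  shows "[(\<Prod>i<r. power_sign q i) * mult_det (d ^* q) = mult_det d] (mod int q)"
proof -
  have bij: "bij_betw (power_index q) {..<r} {..<r}" by (rule power_index_permutation[OF q(3)])
  have power_index: "power_index q i < r" if "i < r" for i using bij that by (auto simp: bij_betw_def)
  have inj: "power_index q i = power_index q j \<longleftrightarrow> i = j" if "i < r" "j < r" for i j
    using bij that by (auto simp: bij_betw_def inj_on_def)
  have q0: "q > 0" using q(1) by (simp add: prime_gt_0_nat)
  have dc: "d \<in> class_fun" using d by (simp add: odd_fun_def)
  have "[power_sign q j * conv (d ^* q) (E (power_index q i)) (g (power_index q j)) = conv d (E i) (g j)] (mod int q)"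
    if ij: "j < r" "i < r" for i j
  proof -
    define F where "F = conv d (E i)"
    have F: "F \<in> odd_fun" unfolding F_def by (rule conv_odd_even[OF d E_even[OF ij(2)]])
    then have Fc: "F \<in> class_fun" by (simp add: odd_fun_def)
    have Fq: "F ^* q \<in> odd_fun" by (rule cpow_odd[OF F q(2)])
    have Eq: "E i ^* q \<in> even_fun" by (rule cpow_even[OF E_even[OF ij(2)] q0])
    have E_val: "[(E i ^* q) (g (power_index q l)) = (if l = i then 1 else 0)] (mod int q)" if l: "l < r" for l
    proof -
      have "(E i ^* q) (g l [^] q) = (E i ^* q) (g (power_index q l))"
        using class_fun_class_index[of "E i ^* q" 1, OF _ _ g_pow[OF q(3) l]] Eq
        by (simp add: even_fun_def power_index_def)
      then show ?thesis
        using cpow_prime_cong[OF q(1,3) E_class[OF ij(2)] g_closed[OF l]] E_g[OF ij(2) l] by simp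
    qed
    have "(F ^* q) (g j [^] q) = power_sign q j * (F ^* q) (g (power_index q j))"
      using class_fun_class_index[of "F ^* q" "-1", OF _ _ g_pow[OF q(3) ij(1)]] Fq
        power_sign_values[OF q(3) ij(1)]
      by (auto simp: odd_fun_def power_index_def power_sign_def)
    moreover have "F ^* q = conv (d ^* q) (E i ^* q)"
      using C.nat_pow_distrib[of d "E i" q] dc E_class[OF ij(2)] by (simp add: F_def)
    moreover have "conv (d ^* q) (E i ^* q) (g (power_index q j))
        = (\<Sum>l<r. conv (d ^* q) (E (power_index q l)) (g (power_index q j)) * (E i ^* q) (g (power_index q l)))"
      unfolding conv_even_apply[OF Eq]
      by (rule sum.reindex_bij_betw[OF bij, symmetric])
    moreover have "[(\<Sum>l<r. conv (d ^* q) (E (power_index q l)) (g (power_index q j)) * (E i ^* q) (g (power_index q l)))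
        = (\<Sum>l<r. conv (d ^* q) (E (power_index q l)) (g (power_index q j)) * (if l = i then 1 else 0))] (mod int q)"
      by (intro cong_sum cong_mult cong_refl E_val) simp
    moreover have "(\<Sum>l<r. conv (d ^* q) (E (power_index q l)) (g (power_index q j)) * (if l = i then 1 else 0))
        = conv (d ^* q) (E (power_index q i)) (g (power_index q j))"
      using ij(2) by (simp add: if_distrib[of "\<lambda>c. _ * c"] cong: if_cong)
    ultimately have "[(F ^* q) (g j [^] q) = power_sign q j * conv (d ^* q) (E (power_index q i)) (g (power_index q j))] (mod int q)"
      by (simp only:) (intro cong_mult cong_refl)
    moreover have "[(F ^* q) (g j [^] q) = F (g j)] (mod int q)"
      by (rule cpow_prime_cong[OF q(1,3) Fc g_closed[OF ij(1)]])
    ultimately show ?thesis unfolding F_def by (meson cong_sym cong_trans)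
  qed
  then have "[det (mat r r (\<lambda>(j, i). power_sign q j * conv (d ^* q) (E (power_index q i)) (g (power_index q j)))) = mult_det d] (mod int q)"
    unfolding mult_det_def by (rule det_mat_cong_mod)
  moreover have "det (mat r r (\<lambda>(j, i). power_sign q j * conv (d ^* q) (E (power_index q i)) (g (power_index q j))))
      = (\<Prod>i<r. power_sign q i) * mult_det (d ^* q)"
    unfolding mult_det_def by (rule det_permute_scale[OF bij])
  ultimately show ?thesis by simp
qed

text \<open>
  Both sides are, up to a common factor, the Gram determinant of the functions \<open>conv d (E i)\<close> for
  the form \<open>conv f h \<one>\<close>.
\<close>

lemma mult_det_gram:
  assumes d: "d \<in> odd_fun"
  shows "(mult_det d)\<^sup>2 * (-1) ^ r = mult_det (conv d d) * int (order G)"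
proof -
  have dc: "d \<in> class_fun" using d by (simp add: odd_fun_def)
  have dd: "conv d d \<in> even_fun" using d d by (rule conv_odd_odd)
  \<comment> \<open>Both sides are \<open>conv f h \<one>\<close> for
    \<open>f = conv d (E i)\<close> and \<open>h = conv d (E k)\<close>: once the product of two odd
    functions, expanded in the \<open>D\<close>, once the product of the even functions
    \<open>conv (conv d d) (E i)\<close> and \<open>E k\<close>.\<close>
  have ent: "(\<Sum>b<r. conv d (E i) (g b) * (\<Sum>l<r. (if b = l then - 2 * c b else 0) * conv d (E k) (g l)))
      = (\<Sum>l<r. conv (conv d d) (E i) (g l) * ((if l = k then 2 * c l else 0) + 2 * c l * (2 * c k)))"
    if ik: "i < r" "k < r" for i k
  proof -
    define f where "f = conv d (E i)"
    define h where "h = conv d (E k)"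
    define F where "F = conv (conv d d) (E i)"
    have f: "f \<in> odd_fun" and h: "h \<in> odd_fun"
      unfolding f_def h_def using conv_odd_even[OF d E_even] ik by auto
    have F: "F \<in> even_fun" unfolding F_def by (rule conv_even_even[OF dd E_even[OF ik(1)]])
    have fc: "f \<in> class_fun" and Fc: "F \<in> class_fun" using f F by (auto simp: odd_fun_def even_fun_def)
    have "conv f h \<one> = (\<Sum>b<r. conv f (D b) \<one> * h (g b))" by (rule conv_odd_apply[OF h])
    also have "\<dots> = (\<Sum>b<r. f (g b) * (- 2 * c b) * h (g b))"
    proof (intro sum.cong refl arg_cong2[where f = times])
      fix b assume b: "b \<in> {..<r}"
      have "conv f (D b) \<one> = conv (D b) f \<one>" using conv_commute[OF fc, of "D b"] by simp
      also have "\<dots> = (\<Sum>a<r. conv (D b) (D a) \<one> * f (g a))" by (rule conv_odd_apply[OF f])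
      also have "\<dots> = (\<Sum>a<r. if a = b then - 2 * c b * f (g b) else 0)"
        using b by (intro sum.cong refl) (auto simp: conv_D_D)
      also have "\<dots> = f (g b) * (- 2 * c b)" using b by simp
      finally show "conv f (D b) \<one> = f (g b) * (- 2 * c b)" .
    qed
    also have "\<dots> = (\<Sum>b<r. f (g b) * (\<Sum>l<r. (if b = l then - 2 * c b else 0) * h (g l)))"
      by (intro sum.cong refl) (simp add: if_distrib[of "\<lambda>c. c * _"] cong: if_cong)
    finally have 1: "conv f h \<one> = \<dots>" .
    have "conv f h = conv F (E k)"
    proof -
      have "conv f h = conv (conv f d) (E k)" by (simp add: h_def conv_assoc)
      also have "conv f d = conv d f" by (rule conv_commute[OF fc])
      also have "\<dots> = F" by (simp add: f_def F_def conv_assoc)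
      finally show ?thesis .
    qed
    then have "conv f h \<one> = conv (E k) F \<one>" using conv_commute[OF Fc, of "E k"] by simp
    also have "\<dots> = (\<Sum>l<r. conv (E k) (E l) \<one> * F (g l))" by (rule conv_even_apply[OF F])
    also have "\<dots> = (\<Sum>l<r. F (g l) * ((if l = k then 2 * c l else 0) + 2 * c l * (2 * c k)))"
      using ik(2) by (intro sum.cong refl) (auto simp: conv_E_E)
    finally show ?thesis using 1 unfolding f_def h_def F_def by simp
  qed
  have "det (mat r r (\<lambda>(i, k). \<Sum>b<r. conv d (E i) (g b) *
        (\<Sum>l<r. (if b = l then - 2 * c b else 0) * conv d (E k) (g l))))
      = mult_det d * ((\<Prod>i<r. - 2 * c i) * mult_det d)"
    unfolding mult_det_def det_mat_times det_mat_diagonal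
    by (simp only: det_mat_transpose[where f = "\<lambda>j i. conv d (E i) (g j)"])
  moreover have "det (mat r r (\<lambda>(i, k). \<Sum>l<r. conv (conv d d) (E i) (g l) *
        ((if l = k then 2 * c l else 0) + 2 * c l * (2 * c k))))
      = mult_det (conv d d) * ((\<Prod>i<r. 2 * c i) * (1 + (\<Sum>i<r. 2 * c i)))"
    unfolding mult_det_def det_mat_times det_diagonal_plus_rank_one
    by (simp only: det_mat_transpose[where f = "\<lambda>j i. conv (conv d d) (E i) (g j)"])
  moreover have "mat r r (\<lambda>(i, k). \<Sum>b<r. conv d (E i) (g b) *
        (\<Sum>l<r. (if b = l then - 2 * c b else 0) * conv d (E k) (g l)))
      = mat r r (\<lambda>(i, k). \<Sum>l<r. conv (conv d d) (E i) (g l) *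
        ((if l = k then 2 * c l else 0) + 2 * c l * (2 * c k)))"
    using ent by (intro eq_matI) auto
  ultimately have eq: "mult_det d * ((\<Prod>i<r. - 2 * c i) * mult_det d)
      = mult_det (conv d d) * ((\<Prod>i<r. 2 * c i) * (1 + (\<Sum>i<r. 2 * c i)))"
    by simp
  \<comment> \<open>The sign \<open>(-1) ^ r\<close> stems from the negative form on odd functions,
    \<open>order G\<close> from the rank-one part of the even one; the common factor is cancelled in
    the integers.\<close>
  have "(\<Prod>i<r. - 2 * c i) = (\<Prod>i<r. (-1) * (2 * c i))" by simp
  also have "\<dots> = (-1) ^ r * (\<Prod>i<r. 2 * c i)" by (simp only: prod.distrib prod_constant card_lessThan)
  finally have neg: "(\<Prod>i<r. - 2 * c i) = (-1) ^ r * (\<Prod>i<r. 2 * c i)" .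
  have o: "1 + (\<Sum>i<r. 2 * c i) = int (order G)" using order_eq by (simp add: sum_distrib_left)
  have "(\<Prod>i<r. 2 * c i) * ((mult_det d)\<^sup>2 * (-1) ^ r) = (\<Prod>i<r. 2 * c i) * (mult_det (conv d d) * int (order G))"
    using eq unfolding neg o by (simp only: power2_eq_square mult_ac)
  moreover have "c i \<noteq> 0" if "i < r" for i using c_pos[OF that] by simp
  then have "(\<Prod>i<r. 2 * c i) \<noteq> 0" by simp
  ultimately show ?thesis by (simp only: mult_cancel_left) simp
qed

text \<open>All \<open>c i\<close> are odd, so the class equation gives \<open>order G\<close>
  congruent to \<open>1 + 2 * r\<close> modulo 4.\<close>

lemma star_order: "(-1) ^ r * int (order G) = star (int (order G))"
proof -
  have "even (\<Sum>i<n. c i) \<longleftrightarrow> even n" if "n \<le> r" for n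
    using that odd_c by (induction n) (auto simp: c_def)
  then have "even (\<Sum>i<r. c i) \<longleftrightarrow> even r" by simp
  moreover have "int (order G) mod 4 = 1 \<longleftrightarrow> even (\<Sum>i<r. c i)" unfolding order_eq by presburger
  ultimately show ?thesis by (auto simp: star_def)
qed

lemma prod_power_sign_eq_Legendre:
  assumes q: "prime q" "odd q" "coprime q (order G)"
  shows "(\<Prod>i<r. power_sign q i) = Legendre (star (int (order G))) (int q)"
proof -
  have q2: "int q > 2" using q(1,2) prime_ge_2_nat[of q] by (cases "q = 2") auto
  have pq: "prime (int q)" using q(1) by simp
  obtain d where d: "d \<in> odd_fun" "\<And>v. v \<in> odd_fun \<Longrightarrow> \<exists>w\<in>even_fun. cong_fun q v (conv d w)"
    using exists_odd_generator[OF q] by blast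
  have "\<forall>k. \<exists>w\<in>even_fun. cong_fun q (D k) (conv d w)" using d(2) D_odd by blast
  then obtain W where W: "\<And>k. W k \<in> even_fun" "\<And>k. cong_fun q (D k) (conv d (W k))" by metis
  \<comment> \<open>The values of the quotients \<open>W k\<close> of \<open>D k\<close> by
    \<open>d\<close> form an inverse of the matrix of \<open>d\<close>, so \<open>mult_det d\<close>
    is a unit modulo \<open>q\<close>.\<close>
  have "[(\<Sum>i<r. conv d (E i) (g j) * W k (g i)) = (if j = k then 1 else 0)] (mod int q)"
    if "j < r" "k < r" for j k
  proof -
    have "[D k (g j) = conv d (W k) (g j)] (mod int q)"
      using W(2)[of k] g_closed[OF that(1)] by (auto simp: cong_fun_def)
    then show ?thesis unfolding conv_even_apply[OF W(1)] D_g[OF that(2,1)] by (rule cong_sym)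
  qed
  then have "[det (mat r r (\<lambda>(j, k). \<Sum>i<r. conv d (E i) (g j) * W k (g i)))
      = det (mat r r (\<lambda>(j, k). if j = k then 1 else 0))] (mod int q)"
    by (rule det_mat_cong_mod)
  then have "[mult_det d * det (mat r r (\<lambda>(i, k). W k (g i))) = 1] (mod int q)"
    unfolding det_mat_times det_mat_diagonal mult_det_def by simp
  then have cop: "coprime (mult_det d) (int q)"
    by (meson coprime_iff_invertible_int)
  define s where "s = (q - 1) div 2"
  have qs: "q = 1 + 2 * s" using q(2) q2 by (simp add: s_def)
  have dc: "d \<in> class_fun" using d(1) by (simp add: odd_fun_def)
  have dd: "conv d d \<in> even_fun" using d(1) d(1) by (rule conv_odd_odd)
  \<comment> \<open>Splitting off one \<open>d\<close> leaves the power
    \<open>s = (q - 1) div 2\<close> of the even function \<open>conv d d\<close>, the exponent of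
    Euler's criterion.\<close>
  have "d ^* q = conv (d ^* 1) ((d ^* 2) ^* s)"
    using C.nat_pow_pow[of d 2 s] dc unfolding qs by (simp only: cpow_add) simp
  also have "\<dots> = conv d (conv d d ^* s)" using dc by (simp add: numeral_2_eq_2 conv_unit)
  finally have "mult_det (d ^* q) = mult_det d * mult_det (conv d d) ^ s"
    using conv_even_even
    by (cases "s = 0") (simp_all add: mult_det_conv cpow_even[OF dd] mult_det_cpow[OF dd] conv_unit dc conv_commute[OF dc, of unit_fun])
  then have "[mult_det d * ((\<Prod>i<r. power_sign q i) * mult_det (conv d d) ^ s) = mult_det d * 1] (mod int q)"
    using mult_det_frobenius[OF q d(1)] by (simp add: mult_ac)
  then have e: "[(\<Prod>i<r. power_sign q i) * mult_det (conv d d) ^ s = 1] (mod int q)"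
    using cop by (simp only: cong_mult_lcancel)
  have pe: "(\<Prod>i<n. power_sign q i) \<in> {1, -1}" if "n \<le> r" for n
    using that
  proof (induction n)
    case (Suc n)
    then show ?case using power_sign_values[OF q(3), of n] by auto
  qed simp
  have "(\<Prod>i<r. power_sign q i) \<in> {1, -1}" by (rule pe) simp
  then have pe2: "(\<Prod>i<r. power_sign q i) * (\<Prod>i<r. power_sign q i) = 1" and pe3: "(\<Prod>i<r. power_sign q i) \<in> {-1, 0, 1}"
    by auto
  have "[(\<Prod>i<r. power_sign q i) * ((\<Prod>i<r. power_sign q i) * mult_det (conv d d) ^ s) = (\<Prod>i<r. power_sign q i) * 1] (mod int q)"
    using e by (intro cong_mult cong_refl)
  then have "[mult_det (conv d d) ^ s = (\<Prod>i<r. power_sign q i)] (mod int q)"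
    unfolding mult.assoc[symmetric] pe2 by simp
  moreover have "nat ((int q - 1) div 2) = s" using qs by simp
  ultimately have "[Legendre (mult_det (conv d d)) (int q) = (\<Prod>i<r. power_sign q i)] (mod int q)"
    using Legendre_euler[OF pq q2, of "mult_det (conv d d)"] by (auto intro: cong_trans)
  then have L: "Legendre (mult_det (conv d d)) (int q) = (\<Prod>i<r. power_sign q i)"
    by (rule Legendre_eqI[OF q2 pe3])
  have unit: "Legendre x (int q) * Legendre x (int q) = 1" if "coprime x (int q)" for x
    using that q2 by (auto simp: Legendre_def cong_0_iff dest: coprime_common_divisor)
  have co: "coprime (int (order G)) (int q)" using q(3) by (simp add: coprime_commute)
  \<comment> \<open>In the Gram identity the square of the unit \<open>mult_det d\<close> has symbol
    1, so the choice of \<open>d\<close> drops out.\<close>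
  have "Legendre (mult_det (conv d d)) (int q) * Legendre (int (order G)) (int q) = Legendre ((-1) ^ r) (int q)"
    using arg_cong[OF mult_det_gram[OF d(1)], of "\<lambda>x. Legendre x (int q)"] unit[OF cop]
    by (simp add: Legendre_mult[OF pq q2] power2_eq_square)
  then have "Legendre (mult_det (conv d d)) (int q) * (Legendre (int (order G)) (int q) * Legendre (int (order G)) (int q))
      = Legendre ((-1) ^ r) (int q) * Legendre (int (order G)) (int q)"
    by (simp only: mult.assoc[symmetric])
  then have "Legendre (mult_det (conv d d)) (int q) = Legendre ((-1) ^ r * int (order G)) (int q)"
    unfolding unit[OF co] by (simp add: Legendre_mult[OF pq q2])
  then show ?thesis using L star_order by simp
qed

end

section \<open>From odd primes to all exponents\<close>

context finite_group
begin

lemma int_pow_cong: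
  assumes "x \<in> carrier G" "[a = b] (mod int (order G))"
  shows "x [^] (a::int) = x [^] b"
proof -
  obtain k where "a = b + int (order G) * k" using assms(2) by (metis cong_iff_lin cong_sym)
  then show ?thesis
    using assms(1) by (simp add: int_pow_mult int_pow_pow[symmetric] int_pow_int pow_order_eq_1)
qed

end

context odd_group
begin

lemma sign_on_power_prime:
  assumes "prime q" "odd q" "coprime q (order G)"
  shows "sign_on (carrier G) (\<lambda>x. x [^] q) = kronecker (int q) (int (order G))"
proof -
  obtain r g where "class_representatives G r g"
  proof (rule exists_class_representatives)
    fix r :: nat and g :: "nat \<Rightarrow> 'a"
    assume "\<And>i. i < r \<Longrightarrow> g i \<in> carrier G" "\<And>i. i < r \<Longrightarrow> g i \<noteq> \<one>"
      "\<And>x. x \<in> carrier G \<Longrightarrow> x \<noteq> \<one> \<Longrightarrow> \<exists>i<r. conj_to (g i) x \<or> conj_to (g i) (inv x)"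
      "\<And>i j. i < r \<Longrightarrow> j < r \<Longrightarrow> conj_to (g i) (g j) \<or> conj_to (g i) (inv (g j)) \<Longrightarrow> i = j"
    then have "class_representatives G r g" by unfold_locales
    then show thesis by (rule that)
  qed
  then interpret class_representatives G r g .
  have p: "prime (int q)" "odd (int q)" using assms by simp_all
  have o: "odd (int (order G))" "int (order G) > 0" using odd_order by (simp_all add: order_gt_0_iff_finite)
  have "sign_on (carrier G) (\<lambda>x. x [^] q) = kronecker (star (int (order G))) (int q)"
    using sign_on_power[OF assms(3)] prod_power_sign_eq_Legendre[OF assms] p
    by (simp add: kronecker_odd_prime)
  also have "\<dots> = kronecker (int q) (int (order G))"
    using o assms(3) by (intro kronecker_star) auto
  finally show ?thesis .
qed

lemma sign_on_power_nat:
  assumes "odd n" "coprime n (order G)"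
  shows "sign_on (carrier G) (\<lambda>x. x [^] n) = kronecker (int n) (int (order G))"
  using assms
proof (induction n rule: prime_divisors_induct)
  case (unit x)
  then show ?case by (simp add: kronecker_1_left cong: sign_on_cong)
next
  case (factor p x)
  have px: "odd p" "odd x" "coprime p (order G)" "coprime x (order G)" using factor.prems by auto
  have bij: "bij_betw (\<lambda>y. y [^] k) (carrier G) (carrier G)" if "coprime k (order G)" for k :: nat
  proof -
    have "inj_on (\<lambda>y. y [^] k) (carrier G)" using nat_pow_inj[OF that] by (auto intro: inj_onI)
    moreover have "(\<lambda>y. y [^] k) ` carrier G \<subseteq> carrier G" by auto
    ultimately show ?thesis unfolding bij_betw_def using endo_inj_surj[OF fin] by blast
  qed
  have "sign_on (carrier G) (\<lambda>y. y [^] (p * x)) = sign_on (carrier G) ((\<lambda>y. y [^] x) \<circ> (\<lambda>y. y [^] p))"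
    by (intro sign_on_cong) (auto simp: nat_pow_pow)
  also have "\<dots> = kronecker (int x) (int (order G)) * kronecker (int p) (int (order G))"
    using sign_on_compose[OF bij[OF px(4)] bij[OF px(3)] fin] factor.IH[OF px(2,4)]
      sign_on_power_prime[OF factor(1) px(1,3)] by simp
  also have "\<dots> = kronecker (int (p * x)) (int (order G))"
    using px odd_order by (simp add: kronecker_mult_left mult.commute odd_pos)
  finally show ?case .
qed simp

theorem elementary_symbol_eq_kronecker:
  assumes "coprime m (int (order G))"
  shows "elementary_symbol m G = kronecker m (int (order G))"
proof -
  define h where "h = int (order G)"
  have h: "odd h" "h > 0" using odd_order by (simp_all add: h_def order_gt_0_iff_finite)
  \<comment> \<open>Both sides depend only on \<open>m\<close> modulo \<open>h\<close>, and adding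
    the odd \<open>h\<close> changes parity, so an odd positive representative exists. This covers
    even and negative \<open>m\<close>.\<close>
  define a where "a = (if odd (m mod h) then m mod h else m mod h + h)"
  have am: "[a = m] (mod h)" by (simp add: a_def cong_def)
  have nonneg: "m mod h \<ge> 0" using h by simp
  have "a > 0"
  proof (cases "odd (m mod h)")
    case True
    then have "m mod h \<noteq> 0" "a = m mod h" by (auto simp: a_def)
    then show ?thesis using nonneg by linarith
  next
    case False
    then have "a = m mod h + h" by (simp add: a_def)
    then show ?thesis using nonneg h by linarith
  qed
  have "odd a" using h by (simp add: a_def)
  define n where "n = nat a"
  have n: "a = int n" "odd n" using \<open>a > 0\<close> \<open>odd a\<close> by (auto simp: n_def even_nat_iff)
  have "coprime a h" using assms am unfolding h_def by (metis cong_imp_coprime cong_sym)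
  then have "coprime n (order G)" unfolding n h_def by simp
  then have "sign_on (carrier G) (\<lambda>x. x [^] n) = kronecker a h"
    using sign_on_power_nat[OF n(2)] by (simp add: n h_def)
  moreover have "elementary_symbol m G = sign_on (carrier G) (\<lambda>x. x [^] m)"
    by (simp add: elementary_symbol_def power_perm_def sign_on_def)
  moreover have "sign_on (carrier G) (\<lambda>x. x [^] m) = sign_on (carrier G) (\<lambda>x. x [^] n)"
    using am int_pow_cong[of _ a m] unfolding h_def n by (intro sign_on_cong refl) (auto simp: int_pow_int)
  ultimately show ?thesis using kronecker_cong_left[OF h am] by (simp add: h_def)
qed

end

section \<open>Products and 2-groups\<close>

text \<open>The choice is made from the unordered pair \<open>{x, j x}\<close>, which is the same
  set for both members, so exactly one of them is selected.\<close>

lemma exists_half_system: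
  assumes "finite X" "\<And>x. x \<in> X \<Longrightarrow> j x \<in> X" "\<And>x. x \<in> X \<Longrightarrow> j (j x) = x" "\<And>x. x \<in> X \<Longrightarrow> j x \<noteq> x"
  obtains T where "T \<subseteq> X" "\<And>x. x \<in> X \<Longrightarrow> j x \<in> T \<longleftrightarrow> x \<notin> T" "card X = 2 * card T"
proof -
  define T where "T = {x \<in> X. (SOME y. y \<in> {x, j x}) = x}"
  have T: "j x \<in> T \<longleftrightarrow> x \<notin> T" if x: "x \<in> X" for x
  proof -
    have "(SOME y. y \<in> {x, j x}) \<in> {x, j x}" by (rule someI[of _ x]) simp
    moreover have "{j x, j (j x)} = {x, j x}" using assms(3)[OF x] by auto
    ultimately show ?thesis
      using x assms(2)[OF x] assms(4)[OF x] unfolding T_def mem_Collect_eq by auto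
  qed
  have TX: "T \<subseteq> X" by (auto simp: T_def)
  have "X = T \<union> j ` T"
  proof
    show "X \<subseteq> T \<union> j ` T"
    proof
      fix x assume x: "x \<in> X"
      show "x \<in> T \<union> j ` T"
      proof (cases "x \<in> T")
        case False
        then have "j x \<in> T" using T x by simp
        then have "j (j x) \<in> j ` T" by (rule imageI)
        then show ?thesis using assms(3)[OF x] by simp
      qed simp
    qed
    show "T \<union> j ` T \<subseteq> X" using TX assms(2) by auto
  qed
  moreover have "T \<inter> j ` T = {}" using T TX by auto
  moreover have "card (j ` T) = card T"
    using TX assms(3) by (intro card_image) (metis inj_onI subsetD)
  moreover have "finite T" using TX assms(1) by (rule finite_subset)
  ultimately have "card X = 2 * card T" by (metis card_Un_disjoint finite_imageI mult_2)
  then show thesis using that TX T by blast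
qed

lemma sign_on_fixed_point_free_involution:
  assumes "finite X" "\<And>x. x \<in> X \<Longrightarrow> j x \<in> X" "\<And>x. x \<in> X \<Longrightarrow> j (j x) = x" "\<And>x. x \<in> X \<Longrightarrow> j x \<noteq> x"
  shows "even (card X)" "sign_on X j = (-1) ^ (card X div 2)"
proof -
  obtain T where T: "T \<subseteq> X" "\<And>x. x \<in> X \<Longrightarrow> j x \<in> T \<longleftrightarrow> x \<notin> T" "card X = 2 * card T"
    using exists_half_system[OF assms] by blast
  show "even (card X)" using T(3) by simp
  have "sign_on X j = (-1) ^ card {x \<in> T. j x \<notin> T}"
    by (rule sign_on_gauss[where j = j])
      (use assms T in \<open>auto intro!: bij_betw_byWitness[where f' = j]\<close>)
  also have "{x \<in> T. j x \<notin> T} = T" using T by auto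
  finally show "sign_on X j = (-1) ^ (card X div 2)" using T(3) by simp
qed

lemma bij_betw_Times:
  assumes "bij_betw f A A" "bij_betw h B B"
  shows "bij_betw (\<lambda>(a, b). (f a, h b)) (A \<times> B) (A \<times> B)"
  using assms by (auto simp: bij_betw_def inj_on_def image_paired_Times)

lemma sign_on_Times_left:
  assumes "finite A" "finite B" "bij_betw f A A"
  shows "sign_on (A \<times> B) (\<lambda>(a, b). (f a, b)) = sign_on A f ^ card B"
  using assms(2)
proof (induction B rule: finite_induct)
  case empty
  have "sign_on ({} :: ('a \<times> 'b) set) (\<lambda>(a, b). (f a, b)) = 1" by (rule sign_on_fixed) auto
  then show ?case by simp
next
  case (insert b B)
  have bij: "bij_betw (\<lambda>(a, b). (f a, b)) (A \<times> C) (A \<times> C)" for C :: "'b set"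
    by (rule bij_betw_Times[OF assms(3)]) (simp add: bij_betw_def)
  have "sign_on (A \<times> {b} \<union> A \<times> B) (\<lambda>(a, b). (f a, b))
      = sign_on (A \<times> {b}) (\<lambda>(a, b). (f a, b)) * sign_on (A \<times> B) (\<lambda>(a, b). (f a, b))"
    using assms(1) insert.hyps by (intro sign_on_Un bij) auto
  moreover have "sign_on (A \<times> {b}) (\<lambda>(a, b). (f a, b)) = sign_on A f"
    by (rule sign_on_conj[where k = "\<lambda>a. (a, b)"])
      (use assms in \<open>auto simp: bij_betw_def inj_on_def\<close>)
  moreover have "A \<times> insert b B = A \<times> {b} \<union> A \<times> B" by auto
  ultimately show ?case using insert by simp
qed

text \<open>The product map is a composition of two maps, each moving one coordinate; moving the
  first alone amounts to \<open>card B\<close> disjoint copies of \<open>f\<close>.\<close>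

lemma sign_on_Times:
  assumes "finite A" "finite B" "bij_betw f A A" "bij_betw h B B"
  shows "sign_on (A \<times> B) (\<lambda>(a, b). (f a, h b)) = sign_on A f ^ card B * sign_on B h ^ card A"
proof -
  have bf: "bij_betw (\<lambda>(a, b). (f a, b)) (A \<times> B) (A \<times> B)"
    by (rule bij_betw_Times[OF assms(3)]) (simp add: bij_betw_def)
  have bh: "bij_betw (\<lambda>(a, b). (a, h b)) (A \<times> B) (A \<times> B)"
    by (rule bij_betw_Times[OF _ assms(4)]) (simp add: bij_betw_def)
  have bh': "bij_betw (\<lambda>(b, a). (h b, a)) (B \<times> A) (B \<times> A)"
    by (rule bij_betw_Times[OF assms(4)]) (simp add: bij_betw_def)
  have swap: "bij_betw (\<lambda>(b, a). (a, b)) (B \<times> A) (A \<times> B)"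
    by (rule bij_betw_byWitness[where f' = "\<lambda>(a, b). (b, a)"]) auto
  have "sign_on (A \<times> B) (\<lambda>(a, b). (f a, h b))
      = sign_on (A \<times> B) ((\<lambda>(a, b). (f a, b)) \<circ> (\<lambda>(a, b). (a, h b)))"
    by (intro sign_on_cong) auto
  also have "\<dots> = sign_on (A \<times> B) (\<lambda>(a, b). (f a, b)) * sign_on (A \<times> B) (\<lambda>(a, b). (a, h b))"
    using assms by (intro sign_on_compose bf bh) auto
  also have "sign_on (A \<times> B) (\<lambda>(a, b). (a, h b)) = sign_on (B \<times> A) (\<lambda>(b, a). (h b, a))"
    by (rule sign_on_conj[OF _ swap bh']) (use assms in auto)
  finally show ?thesis using assms by (simp add: sign_on_Times_left)
qed

section \<open>Inversion, involutions and 2-groups\<close>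

context finite_group
begin

lemma elementary_symbol_sign_on: "elementary_symbol m G = sign_on (carrier G) (\<lambda>x. x [^] m)"
  by (simp add: elementary_symbol_def power_perm_def sign_on_def)

lemma bij_int_pow:
  assumes "coprime m (int (order G))"
  shows "bij_betw (\<lambda>x. x [^] m) (carrier G) (carrier G)"
proof -
  have "bij_betw (power_perm m G) (carrier G) (carrier G)"
    by (rule permutes_imp_bij[OF power_perm_permutes[OF is_group fin assms]])
  then show ?thesis by (simp add: power_perm_def cong: bij_betw_cong)
qed

lemma torsion_set_2: "torsion_set 2 G = {x \<in> carrier G. x \<otimes> x = \<one>}"
  by (auto simp: torsion_set_def numeral_2_eq_2)

lemma inv_eq_self_iff:
  assumes x: "x \<in> carrier G"
  shows "inv x = x \<longleftrightarrow> x \<otimes> x = \<one>"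
proof
  show "x \<otimes> x = \<one>" if "inv x = x" using r_inv[OF x] unfolding that .
  show "inv x = x" if "x \<otimes> x = \<one>" by (rule inv_equality[OF that x x])
qed

text \<open>Inversion fixes the elements with square 1 and pairs off the others. Its signature is
  the symbol at \<open>m = -1\<close>, which explains the sign in \<open>group_disc\<close>, whose
  other factor is positive.\<close>

lemma
  shows even_card_not_torsion: "even (order G - card (torsion_set 2 G))"
    and sign_on_inv: "sign_on (carrier G) (\<lambda>x. inv x) = (-1) ^ ((order G - card (torsion_set 2 G)) div 2)"
proof -
  define X where "X = carrier G - torsion_set 2 G"
  have sub: "torsion_set 2 G \<subseteq> carrier G" by (auto simp: torsion_set_def)
  then have card_X: "card X = order G - card (torsion_set 2 G)"
    unfolding X_def Coset.order_def by (rule card_Diff_subset[OF finite_subset[OF _ fin]]) (rule sub)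
  have inv: "inv x \<in> X" "inv (inv x) = x" "inv x \<noteq> x" if "x \<in> X" for x
  proof -
    have x: "x \<in> carrier G" "x \<otimes> x \<noteq> \<one>" using that by (auto simp: X_def torsion_set_2)
    have "inv x \<otimes> inv x = inv (x \<otimes> x)" using x by (simp add: inv_mult_group)
    then have "inv x \<otimes> inv x \<noteq> \<one>" using x by (simp add: inv_eq_1_iff)
    then show "inv x \<in> X" using x by (simp add: X_def torsion_set_2)
    show "inv (inv x) = x" "inv x \<noteq> x" using x inv_eq_self_iff by auto
  qed
  have finX: "finite X" by (simp add: X_def)
  from sign_on_fixed_point_free_involution[OF finX inv]
  have ev: "even (card X)" "sign_on X (\<lambda>x. inv x) = (-1) ^ (card X div 2)" by auto
  show "even (order G - card (torsion_set 2 G))" using ev(1) card_X by simp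
  have fixed: "inv x = x" if "x \<in> torsion_set 2 G" for x
    using that inv_eq_self_iff by (auto simp: torsion_set_2)
  have "sign_on (torsion_set 2 G \<union> X) (\<lambda>x. inv x)
      = sign_on (torsion_set 2 G) (\<lambda>x. inv x) * sign_on X (\<lambda>x. inv x)"
  proof (rule sign_on_Un)
    show "finite (torsion_set 2 G)" using sub by (rule finite_subset) simp
    show "bij_betw (\<lambda>x. inv x) (torsion_set 2 G) (torsion_set 2 G)"
      by (rule bij_betw_byWitness[where f' = "\<lambda>x. inv x"]) (auto simp: fixed)
    show "bij_betw (\<lambda>x. inv x) X X"
      by (rule bij_betw_byWitness[where f' = "\<lambda>x. inv x"]) (auto simp: inv)
  qed (auto simp: finX X_def)
  moreover have "torsion_set 2 G \<union> X = carrier G" using sub by (auto simp: X_def)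
  ultimately show "sign_on (carrier G) (\<lambda>x. inv x) = (-1) ^ ((order G - card (torsion_set 2 G)) div 2)"
    using ev(2) card_X fixed by (simp add: sign_on_fixed)
qed

lemma card_torsion_even:
  assumes "even (order G)"
  shows "even (card (torsion_set 2 G))"
proof -
  have "card (torsion_set 2 G) \<le> order G"
    unfolding Coset.order_def by (rule card_mono) (auto simp: torsion_set_def)
  then show ?thesis using even_card_not_torsion assms by (simp add: even_diff_nat)
qed

lemma odd_pow_torsion:
  assumes "x \<in> torsion_set 2 G" "odd (m::int)"
  shows "x [^] m = x"
proof -
  from assms(2) obtain k where k: "m = 2 * k + 1" by (rule oddE)
  have x: "x \<in> carrier G" "x [^] (2::nat) = \<one>" using assms(1) by (simp_all add: torsion_set_def)
  have "x [^] (int 2) = \<one>" unfolding int_pow_int by (rule x(2))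
  then have "(x [^] (2::int)) [^] k = \<one>" by simp
  then have "x [^] (2 * k) = \<one>" unfolding int_pow_pow[OF x(1)] .
  then have "x [^] (2 * k) \<otimes> x [^] (1::int) = x" using x(1) by simp
  then show ?thesis unfolding int_pow_mult[OF x(1), symmetric] k .
qed

text \<open>Each cyclic subgroup receives a chosen generator \<open>\<rho>\<close>, and the half
  system \<open>T\<close> consists of the \<open>\<rho> [^] i\<close> with
  \<open>i mod 4 = 1\<close>. The \<open>m\<close>-th power preserves this residue, so Gauss's lemma
  counts nothing.\<close>

lemma power_sign_2_group:
  assumes order: "order G = 2 ^ k" "k \<ge> 1" and m: "m mod 4 = 1"
  shows "sign_on (carrier G) (\<lambda>x. x [^] (m::int)) = 1"
proof -
  \<comment> \<open>The generators of the cyclic group of \<open>x\<close>: the odd exponents are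
    those invertible modulo its order.\<close>
  define R where "R x = {y. \<exists>i::int. odd i \<and> y = x [^] i}" for x
  have root: "\<exists>j::int. odd j \<and> (x [^] i) [^] j = x" if x: "x \<in> carrier G" and i: "odd i" for x and i :: int
  proof -
    have "coprime i (2 ^ k)" using i by (simp add: coprime_right_2_iff_odd)
    then obtain j where j: "[i * j = 1] (mod 2 ^ k)" using cong_solve_coprime_int by blast
    then have "[i * j = 1] (mod 2)" by (rule cong_dvd_modulus) (use order(2) in simp)
    then have "odd (i * j)" by (simp add: cong_def even_iff_mod_2_eq_zero)
    then have "odd j" by simp
    moreover have "x [^] (i * j) = x [^] (1::int)" using j order(1) by (intro int_pow_cong x) simp
    ultimately show ?thesis using x by (intro exI[of _ j]) (simp add: int_pow_pow)
  qed
  have R_sub: "R (x [^] i) \<subseteq> R x" if x: "x \<in> carrier G" and i: "odd i" for x and i :: int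
  proof
    fix y assume "y \<in> R (x [^] i)"
    then obtain j :: int where "odd j" "y = (x [^] i) [^] j" by (auto simp: R_def)
    then show "y \<in> R x" using x i unfolding R_def
      by (intro CollectI exI[of _ "i * j"]) (simp add: int_pow_pow)
  qed
  have R_eq: "R (x [^] i) = R x" if x: "x \<in> carrier G" and i: "odd i" for x and i :: int
  proof (rule subset_antisym[OF R_sub[OF x i]])
    from root[OF x i] obtain j :: int where j: "odd j" "(x [^] i) [^] j = x" by (elim exE conjE)
    have "R ((x [^] i) [^] j) \<subseteq> R (x [^] i)" by (rule R_sub[OF int_pow_closed[OF x] j(1)])
    then show "R x \<subseteq> R (x [^] i)" unfolding j(2) .
  qed
  define \<rho> where "\<rho> x = (SOME y. y \<in> R x)" for x
  have \<rho>: "\<exists>i::int. odd i \<and> x = \<rho> x [^] i" "\<rho> x \<in> carrier G" if x: "x \<in> carrier G" for x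
  proof -
    have "odd (1::int) \<and> x = x [^] (1::int)" using x by simp
    then have "x \<in> R x" unfolding R_def by blast
    then have "\<rho> x \<in> R x" unfolding \<rho>_def by (rule someI)
    then obtain i :: int where i: "odd i" "\<rho> x = x [^] i" unfolding R_def by blast
    show "\<exists>i::int. odd i \<and> x = \<rho> x [^] i" using root[OF x i(1)] unfolding i(2)[symmetric] by (auto intro: sym)
    show "\<rho> x \<in> carrier G" using i(2) x by simp
  qed
  have \<rho>_pow: "\<rho> (x [^] i) = \<rho> x" if "x \<in> carrier G" "odd i" for x and i :: int
    unfolding \<rho>_def R_eq[OF that] ..
  have \<rho>_inv: "\<rho> (inv x) = \<rho> x" if "x \<in> carrier G" for x
    using \<rho>_pow[OF that, of "-1"] that by (simp add: int_pow_neg)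
  define X where "X = carrier G - torsion_set 2 G"
  define T where "T = {x \<in> X. \<exists>i. i mod 4 = (1::int) \<and> x = \<rho> x [^] i}"
  have inv_X: "inv x \<in> X" if "x \<in> X" for x
  proof -
    have x: "x \<in> carrier G" "x \<otimes> x \<noteq> \<one>" using that by (auto simp: X_def torsion_set_2)
    have "inv x \<otimes> inv x = inv (x \<otimes> x)" using x by (simp add: inv_mult_group)
    then show ?thesis using x by (simp add: X_def torsion_set_2 inv_eq_1_iff)
  qed
  have odd_m: "odd m" using m by presburger
  then have cop: "coprime m (int (order G))" using order by (simp add: coprime_right_2_iff_odd)
  have pow_X: "x [^] m \<in> X" if x: "x \<in> X" for x
  proof -
    have xG: "x \<in> carrier G" using x by (simp add: X_def)
    from root[OF xG odd_m] obtain j :: int where j: "odd j" "(x [^] m) [^] j = x" by (elim exE conjE)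
    have "x [^] m \<notin> torsion_set 2 G"
    proof
      assume t: "x [^] m \<in> torsion_set 2 G"
      then have "(x [^] m) [^] j = x [^] m" using j(1) by (rule odd_pow_torsion)
      then show False using j(2) t x by (simp add: X_def)
    qed
    then show ?thesis using xG by (simp add: X_def)
  qed
  have T_iff: "inv x \<in> T \<longleftrightarrow> x \<notin> T" if x: "x \<in> X" for x
  proof -
    have xG: "x \<in> carrier G" using x by (auto simp: X_def torsion_set_2)
    have rG: "\<rho> x \<in> carrier G" using \<rho>(2)[OF xG] .
    \<comment> \<open>Otherwise \<open>\<rho> x\<close> is killed by some \<open>i + j\<close>
      congruent to 2 modulo 4; being a power of 2, its order is at most 2, although its power
      \<open>x\<close> does not have square 1.\<close>
    have "\<not> (x \<in> T \<and> inv x \<in> T)"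
    proof
      assume "x \<in> T \<and> inv x \<in> T"
      then obtain i j :: int where ij: "i mod 4 = 1" "x = \<rho> x [^] i" "j mod 4 = 1" "inv x = \<rho> x [^] j"
        unfolding T_def using \<rho>_inv[OF xG] by auto
      have "\<rho> x [^] (i + j) = x \<otimes> inv x" using ij rG by (simp add: int_pow_mult)
      then have "\<rho> x [^] (i + j) = \<one>" using xG by simp
      then have d: "int (ord (\<rho> x)) dvd i + j" using int_pow_eq_id[OF rG] by simp
      have "ord (\<rho> x) dvd 2 ^ k" using ord_dvd_group_order[OF rG] order(1) by simp
      then obtain s where s: "ord (\<rho> x) = 2 ^ s" using divides_primepow_nat[OF two_is_prime_nat] by blast
      have "\<not> 4 dvd i + j" using ij(1,3) by presburger
      have "s \<le> 1"
      proof (rule ccontr)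
        assume "\<not> s \<le> 1"
        then have "(2::nat) ^ 2 dvd 2 ^ s" by (intro le_imp_power_dvd) simp
        then have "int 4 dvd int (ord (\<rho> x))" unfolding s by (simp only: int_dvd_int_iff) simp
        then show False using d \<open>\<not> 4 dvd i + j\<close> by (metis dvd_trans of_nat_numeral)
      qed
      then have "ord (\<rho> x) dvd 2" unfolding s using le_imp_power_dvd[of s 1 "2::nat"] by simp
      then have "\<rho> x [^] (2::nat) = \<one>" using pow_eq_id[OF rG] by simp
      then have "\<rho> x \<in> torsion_set 2 G" using rG by (simp add: torsion_set_def)
      moreover have "odd i" using ij(1) by presburger
      ultimately have "x = \<rho> x" using odd_pow_torsion ij(2) by metis
      then show False using \<open>\<rho> x \<in> torsion_set 2 G\<close> x by (simp add: X_def)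
    qed
    moreover have "x \<in> T \<or> inv x \<in> T"
    proof -
      from \<rho>(1)[OF xG] obtain i :: int where i: "odd i" "x = \<rho> x [^] i" by (elim exE conjE)
      have "i mod 4 = 1 \<or> (- i) mod 4 = 1" using i(1) by presburger
      then show ?thesis
      proof
        assume "i mod 4 = 1"
        then show ?thesis using i x by (auto simp: T_def)
      next
        assume a: "(- i) mod 4 = 1"
        have "\<rho> x [^] (- i) = inv (\<rho> x [^] i)" using rG by (simp add: int_pow_neg)
        also have "\<dots> = inv x" using i(2) by simp
        finally have "inv x = \<rho> (inv x) [^] (- i)" using \<rho>_inv[OF xG] by simp
        then show ?thesis using a inv_X[OF x] by (auto simp: T_def)
      qed
    qed
    ultimately show ?thesis by blast
  qed
  have pow_T: "x [^] m \<in> T" if x: "x \<in> T" for x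
  proof -
    have xX: "x \<in> X" and xG: "x \<in> carrier G" using x by (auto simp: T_def X_def)
    obtain i :: int where i: "i mod 4 = 1" "x = \<rho> x [^] i" using x by (auto simp: T_def)
    have "\<rho> x [^] (i * m) = (\<rho> x [^] i) [^] m" using \<rho>(2)[OF xG] by (simp add: int_pow_pow)
    also have "\<dots> = x [^] m" using i(2) by simp
    finally have "x [^] m = \<rho> (x [^] m) [^] (i * m)" using \<rho>_pow[OF xG odd_m] by simp
    moreover have "(i * m) mod 4 = 1"
      using mod_mult_eq[of i 4 m] i(1) m by simp
    ultimately show ?thesis unfolding T_def using pow_X[OF xX] by blast
  qed
  have finX: "finite X" by (simp add: X_def)
  have "inj_on (\<lambda>x. x [^] m) X"
    using bij_int_pow[OF cop] by (auto simp: bij_betw_def X_def intro: inj_on_subset)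
  moreover have "(\<lambda>x. x [^] m) ` X \<subseteq> X" using pow_X by auto
  ultimately have bX: "bij_betw (\<lambda>x. x [^] m) X X"
    unfolding bij_betw_def using endo_inj_surj[OF finX] by blast
  have "sign_on X (\<lambda>x. x [^] m) = (-1) ^ card {x \<in> T. x [^] m \<notin> T}"
  proof (rule sign_on_gauss[where j = "\<lambda>x. inv x"])
    show "(inv x) [^] m = inv (x [^] m)" if "x \<in> X" for x
      using that by (simp add: X_def int_pow_inv)
    show "T \<subseteq> X" by (auto simp: T_def)
    show "inv (inv x) = x" if "x \<in> X" for x using that by (simp add: X_def)
  qed (use finX bX inv_X T_iff in auto)
  also have "{x \<in> T. x [^] m \<notin> T} = {}" using pow_T by auto
  finally have sX: "sign_on X (\<lambda>x. x [^] m) = 1" by simp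
  have fixed: "x [^] m = x" if "x \<in> torsion_set 2 G" for x
    using that odd_m by (rule odd_pow_torsion)
  have sub: "torsion_set 2 G \<subseteq> carrier G" by (auto simp: torsion_set_def)
  have "sign_on (torsion_set 2 G \<union> X) (\<lambda>x. x [^] m)
      = sign_on (torsion_set 2 G) (\<lambda>x. x [^] m) * sign_on X (\<lambda>x. x [^] m)"
  proof (rule sign_on_Un)
    show "finite (torsion_set 2 G)" using sub by (rule finite_subset) simp
    show "bij_betw (\<lambda>x. x [^] m) (torsion_set 2 G) (torsion_set 2 G)"
      by (rule bij_betw_byWitness[where f' = "\<lambda>x. x"]) (auto simp: fixed)
  qed (use finX bX in \<open>auto simp: X_def\<close>)
  moreover have "torsion_set 2 G \<union> X = carrier G" using sub by (auto simp: X_def)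
  ultimately show ?thesis using sX by (simp add: sign_on_fixed fixed)
qed

text \<open>For \<open>m\<close> congruent to 3 modulo 4 the map is inversion after a power map with
  exponent congruent to 1, so the signature of inversion is all that remains.\<close>

lemma power_sign_2_group_odd:
  assumes order: "order G = 2 ^ k" "k \<ge> 1" and m: "odd m"
  shows "sign_on (carrier G) (\<lambda>x. x [^] (m::int)) =
    (if m mod 4 = 1 then 1 else (-1) ^ ((order G - card (torsion_set 2 G)) div 2))"
proof (cases "m mod 4 = 1")
  case True
  then show ?thesis using power_sign_2_group[OF order] by simp
next
  case False
  then have m': "(- m) mod 4 = 1" using m by presburger
  have cop: "coprime (- m) (int (order G))" using m order by (simp add: coprime_right_2_iff_odd)
  have "sign_on (carrier G) (\<lambda>x. x [^] m) = sign_on (carrier G) ((\<lambda>x. inv x) \<circ> (\<lambda>x. x [^] (- m)))"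
    by (intro sign_on_cong) (auto simp: int_pow_neg)
  also have "\<dots> = sign_on (carrier G) (\<lambda>x. inv x) * sign_on (carrier G) (\<lambda>x. x [^] (- m))"
    by (intro sign_on_compose bij_inv bij_int_pow[OF cop] fin)
  finally show ?thesis using False sign_on_inv power_sign_2_group[OF order m'] by simp
qed

end

section \<open>The two classes of groups\<close>

lemma star_eq_power: "odd h \<Longrightarrow> star (int h) = (-1) ^ ((h - 1) div 2) * int h"
proof -
  assume h: "odd h"
  have "int h mod 4 = 1 \<longleftrightarrow> h mod 4 = 1" by presburger
  moreover have "h mod 4 = 1 \<longleftrightarrow> even ((h - 1) div 2)" using h by presburger
  ultimately show ?thesis by (simp add: star_def)
qed

lemma (in odd_group) elementary_symbol_eq_kronecker_disc:
  assumes "coprime m (int (order G))"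
  shows "elementary_symbol m G = kronecker (group_disc G) m"
proof -
  have "torsion_set 2 G = {\<one>}"
    using odd_pow_eq_one by (auto simp: torsion_set_def)
  moreover have "sylow2_eps G = 0" using odd_order by (auto simp: sylow2_eps_def)
  ultimately have "group_disc G = star (int (order G))"
    using star_eq_power[OF odd_order] by (simp add: group_disc_def)
  moreover have "odd (int (order G))" "int (order G) > 0"
    using odd_order by (simp_all add: order_gt_0_iff_finite)
  ultimately show ?thesis
    using elementary_symbol_eq_kronecker[OF assms] kronecker_star assms by simp
qed

text \<open>For a non-trivial 2-part \<open>K\<close> the odd factor \<open>H\<close> disappears on
  both sides: its signature is raised to the even power \<open>order K\<close>, and the power of the
  order in the discriminant is a square. A trivial 2-part is the odd case.\<close>

lemma elementary_symbol_odd_times_2group: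
  fixes G :: "('a, 'b) monoid_scheme" and m :: int
  assumes "group G" "finite (carrier G)" "odd_times_2group G" "coprime m (int (order G))"
  shows "elementary_symbol m G = kronecker (group_disc G) m"
proof -
  interpret G: finite_group G using assms(1,2) by (simp add: finite_group_def finite_group_axioms_def)
  obtain H K :: "'a monoid" and k \<phi> where HK: "group H" "group K" "odd (order H)" "order K = 2 ^ k"
    and \<phi>: "\<phi> \<in> iso G (H \<times>\<times> K)"
    using assms(3) by (auto simp: odd_times_2group_def is_iso_def)
  have "finite (carrier H)" using HK(3) by (metis card.infinite even_zero Coset.order_def)
  then interpret H: odd_group H using HK
    by (simp add: odd_group_def finite_group_def finite_group_axioms_def odd_group_axioms_def)
  have "finite (carrier K)" using HK(4) by (metis card.infinite power_not_zero zero_neq_numeral Coset.order_def)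
  then interpret K: finite_group K using HK by (simp add: finite_group_def finite_group_axioms_def)
  have bij: "bij_betw \<phi> (carrier G) (carrier H \<times> carrier K)" using \<phi> by (simp add: iso_def)
  have "\<phi> \<in> hom G (H \<times>\<times> K)" using \<phi> by (simp add: iso_def)
  then have homs: "fst \<circ> \<phi> \<in> hom G H" "snd \<circ> \<phi> \<in> hom G K" by (simp_all add: hom_pairwise)
  interpret p: group_hom G H "fst \<circ> \<phi>"
    by (intro group_hom.intro group_hom_axioms.intro homs(1)) (rule assms(1) HK(1))+
  interpret s: group_hom G K "snd \<circ> \<phi>"
    by (intro group_hom.intro group_hom_axioms.intro homs(2)) (rule assms(1) HK(2))+
  have ord: "order G = order H * 2 ^ k"
    using bij_betw_same_card[OF bij] HK(4) by (simp add: Coset.order_def card_cartesian_product)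
  show ?thesis
  proof (cases "k = 0")
    case True
    then have "odd (order G)" using ord HK(3) by simp
    then interpret odd_group G by unfold_locales
    show ?thesis by (rule elementary_symbol_eq_kronecker_disc[OF assms(4)])
  next
    case False
    then have k: "k \<ge> 1" by simp
    then have evenG: "even (order G)" using ord by simp
    have odd_m: "odd m"
    proof
      assume "even m"
      then have "is_unit (2::int)" by (rule coprime_common_divisor[OF assms(4)]) (use evenG in simp)
      then show False by simp
    qed
    have copH: "coprime m (int (order H))" using assms(4) unfolding ord by simp
    have copK: "coprime m (int (order K))" using odd_m HK(4) by (simp add: coprime_right_2_iff_odd)
    have orderK: "even (order K)" using HK(4) k by simp
    have tors_eq: "torsion_set 2 G = {x \<in> carrier G. (fst \<circ> \<phi>) x = \<one>\<^bsub>H\<^esub> \<and> (snd \<circ> \<phi>) x \<in> torsion_set 2 K}"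
    proof -
      have inj: "x = \<one>\<^bsub>G\<^esub>" if "x \<in> carrier G" "(fst \<circ> \<phi>) x = \<one>\<^bsub>H\<^esub>" "(snd \<circ> \<phi>) x = \<one>\<^bsub>K\<^esub>" for x
      proof -
        have "\<phi> x = \<phi> \<one>\<^bsub>G\<^esub>" using that p.hom_one s.hom_one by (simp add: prod_eq_iff)
        then show ?thesis using bij that(1) by (auto simp: bij_betw_def dest: inj_onD)
      qed
      have "x [^]\<^bsub>G\<^esub> (2::nat) = \<one>\<^bsub>G\<^esub> \<longleftrightarrow>
          (fst \<circ> \<phi>) x = \<one>\<^bsub>H\<^esub> \<and> (snd \<circ> \<phi>) x [^]\<^bsub>K\<^esub> (2::nat) = \<one>\<^bsub>K\<^esub>" if x: "x \<in> carrier G" for x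
      proof
        assume "x [^]\<^bsub>G\<^esub> (2::nat) = \<one>\<^bsub>G\<^esub>"
        then have "(fst \<circ> \<phi>) x [^]\<^bsub>H\<^esub> (2::nat) = \<one>\<^bsub>H\<^esub>" "(snd \<circ> \<phi>) x [^]\<^bsub>K\<^esub> (2::nat) = \<one>\<^bsub>K\<^esub>"
          using p.hom_nat_pow[OF x, of 2] s.hom_nat_pow[OF x, of 2] p.hom_one s.hom_one by simp_all
        then show "(fst \<circ> \<phi>) x = \<one>\<^bsub>H\<^esub> \<and> (snd \<circ> \<phi>) x [^]\<^bsub>K\<^esub> (2::nat) = \<one>\<^bsub>K\<^esub>"
          using H.odd_pow_eq_one p.hom_closed[OF x] by blast
      next
        assume "(fst \<circ> \<phi>) x = \<one>\<^bsub>H\<^esub> \<and> (snd \<circ> \<phi>) x [^]\<^bsub>K\<^esub> (2::nat) = \<one>\<^bsub>K\<^esub>"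
        then show "x [^]\<^bsub>G\<^esub> (2::nat) = \<one>\<^bsub>G\<^esub>"
          using p.hom_nat_pow[OF x, of 2] s.hom_nat_pow[OF x, of 2] x by (intro inj) simp_all
      qed
      then show ?thesis using s.hom_closed by (auto simp: torsion_set_def)
    qed
    have card_t: "card (torsion_set 2 G) = card (torsion_set 2 K)"
    proof (rule bij_betw_same_card[of "snd \<circ> \<phi>"])
      have "inj_on (snd \<circ> \<phi>) (torsion_set 2 G)"
      proof (rule inj_onI)
        fix x y assume "x \<in> torsion_set 2 G" "y \<in> torsion_set 2 G" "(snd \<circ> \<phi>) x = (snd \<circ> \<phi>) y"
        then have "\<phi> x = \<phi> y" "x \<in> carrier G" "y \<in> carrier G" by (auto simp: tors_eq prod_eq_iff)
        then show "x = y" using bij by (auto simp: bij_betw_def dest: inj_onD)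
      qed
      moreover have "(snd \<circ> \<phi>) ` torsion_set 2 G = torsion_set 2 K"
      proof (rule subset_antisym; rule subsetI)
        fix y assume y: "y \<in> torsion_set 2 K"
        then have "(\<one>\<^bsub>H\<^esub>, y) \<in> \<phi> ` carrier G" using bij by (auto simp: bij_betw_def torsion_set_def)
        then obtain x where x: "x \<in> carrier G" "\<phi> x = (\<one>\<^bsub>H\<^esub>, y)" by (metis imageE)
        then have "x \<in> torsion_set 2 G" using y by (simp add: tors_eq)
        then show "y \<in> (snd \<circ> \<phi>) ` torsion_set 2 G" using x(2) by (intro image_eqI[of _ _ x]) simp_all
      qed (auto simp: tors_eq)
      ultimately show "bij_betw (snd \<circ> \<phi>) (torsion_set 2 G) (torsion_set 2 K)" by (simp add: bij_betw_def)
    qed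
    define t where "t = card (torsion_set 2 G)"
    have t_even: "even t" unfolding t_def by (rule G.card_torsion_even[OF evenG])
    have t_le: "t \<le> order K" unfolding t_def card_t Coset.order_def
      by (rule card_mono) (auto simp: torsion_set_def)
    have "elementary_symbol m G = sign_on (carrier H \<times> carrier K) (\<lambda>(a, b). (a [^]\<^bsub>H\<^esub> m, b [^]\<^bsub>K\<^esub> m))"
      unfolding G.elementary_symbol_sign_on
    proof (rule sign_on_conj[OF G.fin bij G.bij_int_pow[OF assms(4)], symmetric])
      fix x assume x: "x \<in> carrier G"
      show "\<phi> (x [^]\<^bsub>G\<^esub> m) = (case \<phi> x of (a, b) \<Rightarrow> (a [^]\<^bsub>H\<^esub> m, b [^]\<^bsub>K\<^esub> m))"
        using p.hom_int_pow[OF x, of m] s.hom_int_pow[OF x, of m]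
        by (simp add: prod_eq_iff case_prod_unfold)
    qed
    also have "\<dots> = sign_on (carrier H) (\<lambda>a. a [^]\<^bsub>H\<^esub> m) ^ order K
        * sign_on (carrier K) (\<lambda>b. b [^]\<^bsub>K\<^esub> m) ^ order H"
      unfolding Coset.order_def
      by (rule sign_on_Times[OF H.fin K.fin H.bij_int_pow[OF copH] K.bij_int_pow[OF copK]])
    also have "\<dots> = sign_on (carrier K) (\<lambda>b. b [^]\<^bsub>K\<^esub> m)"
    proof -
      have s: "sign_on A f = 1 \<or> sign_on A f = -1" for A :: "'a set" and f
        by (auto simp: sign_on_def sign_def)
      have "sign_on (carrier H) (\<lambda>a. a [^]\<^bsub>H\<^esub> m) ^ order K = 1"
        using s[of "carrier H" "\<lambda>a. a [^]\<^bsub>H\<^esub> m"] orderK by auto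
      moreover have "sign_on (carrier K) (\<lambda>b. b [^]\<^bsub>K\<^esub> m) ^ order H = sign_on (carrier K) (\<lambda>b. b [^]\<^bsub>K\<^esub> m)"
        using s[of "carrier K" "\<lambda>b. b [^]\<^bsub>K\<^esub> m"] HK(3) by auto
      ultimately show ?thesis by simp
    qed
    also have "\<dots> = (if m mod 4 = 1 then 1 else (-1) ^ ((order K - t) div 2))"
      unfolding t_def card_t by (rule K.power_sign_2_group_odd[OF HK(4) k odd_m])
    \<comment> \<open>Passing from \<open>order K\<close> to \<open>order G\<close> adds
      \<open>2 * u * order K\<close>, half of which is still even.\<close>
    also have "(-1) ^ ((order K - t) div 2) = (-1 :: int) ^ ((order G - t) div 2)"
    proof -
      from HK(3) obtain u where u: "order H = 2 * u + 1" by (rule oddE)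
      have "order G - t = 2 * (u * order K) + (order K - t)"
        using t_le unfolding ord HK(4)[symmetric] u by (simp add: algebra_simps)
      then have "(order G - t) div 2 = u * order K + (order K - t) div 2" by simp
      then show ?thesis using orderK by (simp add: power_add)
    qed
    finally have sym: "elementary_symbol m G = (if m mod 4 = 1 then 1 else (-1) ^ ((order G - t) div 2))" .
    \<comment> \<open>The kernel of the projection to \<open>H\<close> is the only Sylow 2-subgroup,
      so the denominator of the discriminant is 1 even when \<open>sylow2_eps\<close> is 1, as for
      order 2.\<close>
    have num1: "num_sylow2 G = 1"
    proof -
      define P where "P = {x \<in> carrier G. (fst \<circ> \<phi>) x = \<one>\<^bsub>H\<^esub>}"
      have mult: "multiplicity 2 (order G) = k"
      proof -
        have "\<not> 2 dvd order H" using HK(3) by simp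
        then have "multiplicity 2 (order H) = 0" by (rule not_dvd_imp_multiplicity_0)
        moreover have "order H \<noteq> 0" using HK(3) by (metis even_zero)
        ultimately show ?thesis unfolding ord
          by (simp add: prime_elem_multiplicity_mult_distrib)
      qed
      moreover have "subgroup P G"
        using p.subgroup_kernel by (simp add: P_def kernel_def)
      moreover have cardP: "card P = 2 ^ k"
      proof -
        have "bij_betw (snd \<circ> \<phi>) P (carrier K)"
        proof -
          have "inj_on (snd \<circ> \<phi>) P"
          proof (rule inj_onI)
            fix x y assume "x \<in> P" "y \<in> P" "(snd \<circ> \<phi>) x = (snd \<circ> \<phi>) y"
            then have "\<phi> x = \<phi> y" "x \<in> carrier G" "y \<in> carrier G" by (auto simp: P_def prod_eq_iff)
            then show "x = y" using bij by (auto simp: bij_betw_def dest: inj_onD)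
          qed
          moreover have "(snd \<circ> \<phi>) ` P = carrier K"
          proof (rule subset_antisym; rule subsetI)
            fix y assume y: "y \<in> carrier K"
            then have "(\<one>\<^bsub>H\<^esub>, y) \<in> \<phi> ` carrier G" using bij by (auto simp: bij_betw_def)
            then obtain x where x: "x \<in> carrier G" "\<phi> x = (\<one>\<^bsub>H\<^esub>, y)" by (metis imageE)
            then show "y \<in> (snd \<circ> \<phi>) ` P" by (intro image_eqI[of _ _ x]) (simp_all add: P_def)
          next
            fix y assume "y \<in> (snd \<circ> \<phi>) ` P"
            then show "y \<in> carrier K" using s.hom_closed by (auto simp: P_def)
          qed
          ultimately show ?thesis by (simp add: bij_betw_def)
        qed
        then show ?thesis using HK(4) by (simp add: bij_betw_same_card Coset.order_def)
      qed
      moreover have "S = P" if S: "subgroup S G" "card S = 2 ^ k" for S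
      proof (rule card_subset_eq)
        show "finite P" by (simp add: P_def)
        show "S \<subseteq> P"
        proof
          fix x assume x: "x \<in> S"
          have xG: "x \<in> carrier G" using subgroup.subset[OF S(1)] x by blast
          interpret S: group "G\<lparr>carrier := S\<rparr>" by (rule subgroup.subgroup_is_group[OF S(1) assms(1)])
          have "x [^]\<^bsub>G\<lparr>carrier := S\<rparr>\<^esub> order (G\<lparr>carrier := S\<rparr>) = \<one>\<^bsub>G\<lparr>carrier := S\<rparr>\<^esub>"
            by (rule S.pow_order_eq_1) (simp add: x)
          then have "x [^]\<^bsub>G\<^esub> ((2::nat) ^ k) = \<one>\<^bsub>G\<^esub>"
            using S(2) G.nat_pow_consistent[of x "2 ^ k" S] by (simp add: Coset.order_def)
          then have e: "(fst \<circ> \<phi>) x [^]\<^bsub>H\<^esub> ((2::nat) ^ k) = \<one>\<^bsub>H\<^esub> [^]\<^bsub>H\<^esub> ((2::nat) ^ k)"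
            using p.hom_nat_pow[OF xG, of "2 ^ k"] p.hom_one by simp
          have "coprime (2 ^ k) (order H)" using HK(3) by (simp add: coprime_left_2_iff_odd)
          then have "(fst \<circ> \<phi>) x = \<one>\<^bsub>H\<^esub>"
            by (rule H.nat_pow_inj[OF _ p.hom_closed[OF xG] H.one_closed e])
          then show "x \<in> P" using xG by (simp add: P_def)
        qed
        show "card S = card P" using S(2) cardP by simp
      qed
      ultimately have "sylow_subgroups 2 G = {P}" unfolding sylow_subgroups_def mult by blast
      then show ?thesis by (simp add: num_sylow2_def)
    qed
    from t_even obtain t' where t': "t = 2 * t'" by (rule evenE)
    have "group_disc G = (int (order G) ^ t')\<^sup>2 * (-1) ^ ((order G - t) div 2)"
      unfolding group_disc_def num1 t_def[symmetric] by (simp add: t' power_mult mult.commute)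
    then have "kronecker (group_disc G) m = kronecker ((-1) ^ ((order G - t) div 2)) m"
    proof -
      have "coprime (int (order G) ^ t') m" using assms(4) by (simp add: coprime_commute)
      moreover have "int (order G) ^ t' \<noteq> 0" using G.fin by (simp add: G.order_gt_0_iff_finite)
      moreover have "m \<noteq> 0" using odd_m by auto
      ultimately show ?thesis
        using \<open>group_disc G = _\<close> by (simp only:) (rule kronecker_square_mult, auto)
    qed
    also have "\<dots> = (if m mod 4 = 1 then 1 else (-1) ^ ((order G - t) div 2))"
      using kronecker_minus_one_left[OF odd_m] kronecker_1_left[of m]
      by (cases "even ((order G - t) div 2)") auto
    finally show ?thesis using sym by simp
  qed
qed

text \<open>Odd powers fix the involutions, so the symbol is that of the index-2 subgroup
  \<open>N\<close> of order \<open>n\<close>. On the other side the exponent \<open>n + 1\<close> is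
  even, and the division by the number \<open>n\<close> of Sylow 2-subgroups is what keeps
  \<open>n\<close> in the discriminant up to squares.\<close>

lemma elementary_symbol_twice_odd:
  fixes G :: "('a, 'b) monoid_scheme" and m :: int
  assumes "group G" "finite (carrier G)" "odd n" "order G = 2 * n"
    and invol: "even_order_elements_are_involutions G" and "coprime m (int (order G))"
  shows "elementary_symbol m G = kronecker (group_disc G) m"
proof -
  interpret finite_group G using assms(1,2) by (simp add: finite_group_def finite_group_axioms_def)
  define \<sigma> where "\<sigma> x = sign_on (carrier G) (\<lambda>y. x \<otimes>\<^bsub>G\<^esub> y)" for x
  have \<sigma>_mult: "\<sigma> (x \<otimes>\<^bsub>G\<^esub> y) = \<sigma> x * \<sigma> y" if "x \<in> carrier G" "y \<in> carrier G" for x y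
  proof -
    have "\<sigma> (x \<otimes>\<^bsub>G\<^esub> y) = sign_on (carrier G) ((\<lambda>z. x \<otimes>\<^bsub>G\<^esub> z) \<circ> (\<lambda>z. y \<otimes>\<^bsub>G\<^esub> z))"
      unfolding \<sigma>_def using that by (intro sign_on_cong) (auto simp: m_assoc)
    then show ?thesis
      unfolding \<sigma>_def using sign_on_compose[OF bij_mult_left[OF that(1)] bij_mult_left[OF that(2)] fin] by simp
  qed
  have \<sigma>_one: "\<sigma> \<one>\<^bsub>G\<^esub> = 1" unfolding \<sigma>_def by (rule sign_on_fixed) auto
  have \<sigma>_values: "\<sigma> x = 1 \<or> \<sigma> x = -1" for x by (auto simp: \<sigma>_def sign_on_def sign_def)
  have \<sigma>_pow: "\<sigma> (x [^]\<^bsub>G\<^esub> (k::nat)) = \<sigma> x ^ k" if "x \<in> carrier G" for x k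
    by (induction k) (use that in \<open>simp_all add: \<sigma>_one \<sigma>_mult\<close>)
  \<comment> \<open>Left translation by an involution is a product of \<open>n\<close> disjoint
    transpositions, and \<open>n\<close> is odd.\<close>
  have \<sigma>_invol: "\<sigma> z = -1" if z: "z \<in> carrier G" "z \<noteq> \<one>\<^bsub>G\<^esub>" "z \<otimes>\<^bsub>G\<^esub> z = \<one>\<^bsub>G\<^esub>" for z
  proof -
    have "sign_on (carrier G) (\<lambda>y. z \<otimes>\<^bsub>G\<^esub> y) = (-1) ^ (card (carrier G) div 2)"
    proof (rule sign_on_fixed_point_free_involution(2)[OF fin])
      fix y assume y: "y \<in> carrier G"
      show "z \<otimes>\<^bsub>G\<^esub> y \<in> carrier G" using y z by simp
      show "z \<otimes>\<^bsub>G\<^esub> (z \<otimes>\<^bsub>G\<^esub> y) = y" using y z by (simp add: m_assoc[symmetric])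
      show "z \<otimes>\<^bsub>G\<^esub> y \<noteq> y" using y z by simp
    qed
    then show ?thesis using assms(3,4) by (simp add: \<sigma>_def Coset.order_def)
  qed
  define N where "N = {x \<in> carrier G. \<sigma> x = 1}"
  have not_N: "x \<otimes>\<^bsub>G\<^esub> x = \<one>\<^bsub>G\<^esub> \<and> x \<noteq> \<one>\<^bsub>G\<^esub>" if x: "x \<in> carrier G" "x \<notin> N" for x
  proof -
    have sx: "\<sigma> x = -1" using x \<sigma>_values by (auto simp: N_def)
    have "\<sigma> x ^ group.ord G x = 1" using \<sigma>_pow[OF x(1), of "group.ord G x"] x(1) \<sigma>_one by simp
    then have "even (ord x)" unfolding sx by (cases "even (ord x)") auto
    then have "ord x = 2" using invol x(1) by (simp add: even_order_elements_are_involutions_def)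
    then have "x [^]\<^bsub>G\<^esub> (2::nat) = \<one>\<^bsub>G\<^esub>" using pow_ord_eq_1[OF x(1)] by simp
    moreover have "x \<noteq> \<one>\<^bsub>G\<^esub>" using sx \<sigma>_one by auto
    ultimately show ?thesis using x(1) by (simp add: numeral_2_eq_2)
  qed
  have tors: "torsion_set 2 G = insert \<one>\<^bsub>G\<^esub> (carrier G - N)"
    proof (rule subset_antisym; rule subsetI)
    fix x assume "x \<in> torsion_set 2 G"
    then have x: "x \<in> carrier G" "x \<otimes>\<^bsub>G\<^esub> x = \<one>\<^bsub>G\<^esub>" by (simp_all add: torsion_set_2)
    then show "x \<in> insert \<one>\<^bsub>G\<^esub> (carrier G - N)"
      using \<sigma>_invol[OF x(1) _ x(2)] by (cases "x = \<one>\<^bsub>G\<^esub>") (simp_all add: N_def)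
  next
    fix x assume "x \<in> insert \<one>\<^bsub>G\<^esub> (carrier G - N)"
    then show "x \<in> torsion_set 2 G" unfolding torsion_set_2 using not_N[of x] by (elim insertE) simp_all
  qed
  \<comment> \<open>Even size and the presence of the identity yield a second element, which lies
    outside \<open>N\<close>.\<close>
  have "even (card (torsion_set 2 G))" by (rule card_torsion_even) (simp add: assms(4))
  moreover have "torsion_set 2 G \<noteq> {}" using tors by blast
  ultimately have "torsion_set 2 G \<noteq> {\<one>\<^bsub>G\<^esub>}" by auto
  then obtain z where z: "z \<in> carrier G" "z \<notin> N" using tors by blast
  have sz: "\<sigma> z = -1" using z \<sigma>_values by (auto simp: N_def)
  have zz: "z \<otimes>\<^bsub>G\<^esub> z = \<one>\<^bsub>G\<^esub>" using not_N[OF z] by blast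
  have subN: "subgroup N G"
  proof (rule subgroupI)
    show "N \<subseteq> carrier G" by (auto simp: N_def)
    show "N \<noteq> {}" using \<sigma>_one by (auto simp: N_def)
    show "inv\<^bsub>G\<^esub> a \<in> N" if "a \<in> N" for a
      using that \<sigma>_mult[of a "inv\<^bsub>G\<^esub> a"] \<sigma>_one by (simp add: N_def)
    show "a \<otimes>\<^bsub>G\<^esub> b \<in> N" if "a \<in> N" "b \<in> N" for a b
      using that \<sigma>_mult by (simp add: N_def)
  qed
  have finN: "finite N" by (simp add: N_def)
  have NG: "N \<subseteq> carrier G" by (auto simp: N_def)
  have zmul: "z \<otimes>\<^bsub>G\<^esub> (z \<otimes>\<^bsub>G\<^esub> x) = x" if "x \<in> carrier G" for x
    using that z(1) zz by (simp add: m_assoc[symmetric])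
  have "bij_betw (\<lambda>x. z \<otimes>\<^bsub>G\<^esub> x) N (carrier G - N)"
  proof (rule bij_betw_byWitness[where f' = "\<lambda>x. z \<otimes>\<^bsub>G\<^esub> x"])
    show "(\<lambda>x. z \<otimes>\<^bsub>G\<^esub> x) ` N \<subseteq> carrier G - N" using z(1) sz \<sigma>_mult by (auto simp: N_def)
    show "(\<lambda>x. z \<otimes>\<^bsub>G\<^esub> x) ` (carrier G - N) \<subseteq> N"
    proof
      fix y assume "y \<in> (\<lambda>x. z \<otimes>\<^bsub>G\<^esub> x) ` (carrier G - N)"
      then obtain x where x: "x \<in> carrier G" "x \<notin> N" "y = z \<otimes>\<^bsub>G\<^esub> x" by blast
      then have "\<sigma> x = -1" using \<sigma>_values by (auto simp: N_def)
      then show "y \<in> N" using x sz z(1) \<sigma>_mult by (simp add: N_def)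
    qed
  qed (use zmul NG in auto)
  then have "card N = card (carrier G - N)" by (rule bij_betw_same_card)
  moreover have "card (carrier G - N) = 2 * n - card N"
    using card_Diff_subset[OF finN NG] assms(4) by (simp add: Coset.order_def)
  moreover have "card N \<le> 2 * n"
    using card_mono[OF fin NG] assms(4) by (simp add: Coset.order_def)
  ultimately have cardN: "card N = n" "card (carrier G - N) = n" by linarith+
  have card_t: "card (torsion_set 2 G) = n + 1"
    unfolding tors using cardN(2) \<sigma>_one by (simp add: N_def)
  have odd_m: "odd m"
  proof
    assume "even m"
    then have "is_unit (2::int)" by (rule coprime_common_divisor[OF assms(6)]) (simp add: assms(4))
    then show False by simp
  qed
  define N' where "N' = G\<lparr>carrier := N\<rparr>"
  have "group N'" unfolding N'_def by (rule subgroup.subgroup_is_group[OF subN assms(1)])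
  moreover have orderN: "order N' = n" unfolding N'_def using cardN(1) by (simp add: Coset.order_def)
  ultimately interpret N: odd_group N'
    using finN assms(3)
    by (simp add: odd_group_def finite_group_def finite_group_axioms_def odd_group_axioms_def N'_def)
  have cop_n: "coprime m (int n)" using assms(4,6) by simp
  have fixed: "x [^]\<^bsub>G\<^esub> m = x" if "x \<in> carrier G - N" for x
    using that tors odd_m by (intro odd_pow_torsion) auto
  have powN: "x [^]\<^bsub>N'\<^esub> m = x [^]\<^bsub>G\<^esub> m" if "x \<in> N" for x
    unfolding N'_def using int_pow_consistent[OF subN that, of m] by simp
  have bijN: "bij_betw (\<lambda>x. x [^]\<^bsub>G\<^esub> m) N N"
  proof -
    have "bij_betw (\<lambda>x. x [^]\<^bsub>N'\<^esub> m) N N"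
      using N.bij_int_pow[of m] cop_n orderN by (simp add: N'_def)
    then show ?thesis using powN by (simp cong: bij_betw_cong)
  qed
  have "sign_on (N \<union> (carrier G - N)) (\<lambda>x. x [^]\<^bsub>G\<^esub> m)
      = sign_on N (\<lambda>x. x [^]\<^bsub>G\<^esub> m) * sign_on (carrier G - N) (\<lambda>x. x [^]\<^bsub>G\<^esub> m)"
  proof (rule sign_on_Un[OF finN _ _ bijN])
    show "bij_betw (\<lambda>x. x [^]\<^bsub>G\<^esub> m) (carrier G - N) (carrier G - N)"
      by (rule bij_betw_byWitness[where f' = "\<lambda>x. x"]) (auto simp: fixed)
  qed auto
  moreover have "N \<union> (carrier G - N) = carrier G" using NG by blast
  moreover have "sign_on (carrier G - N) (\<lambda>x. x [^]\<^bsub>G\<^esub> m) = 1" by (rule sign_on_fixed) (rule fixed)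
  moreover have "sign_on N (\<lambda>x. x [^]\<^bsub>G\<^esub> m) = elementary_symbol m N'"
    unfolding N.elementary_symbol_sign_on using powN by (intro sign_on_cong) (simp_all add: N'_def)
  ultimately have "elementary_symbol m G = elementary_symbol m N'"
    by (simp add: elementary_symbol_sign_on)
  also have "\<dots> = kronecker m (int n)"
    using N.elementary_symbol_eq_kronecker[of m] cop_n orderN by simp
  also have "\<dots> = kronecker (star (int n)) m"
    using assms(3) cop_n by (intro kronecker_star[symmetric]) (auto simp: odd_pos)
  finally have sym: "elementary_symbol m G = kronecker (star (int n)) m" .
  have num: "num_sylow2 G = n"
  proof -
    have "n \<noteq> 0" using assms(3) by (metis even_zero)
    have "multiplicity 2 (order G) = 1"
    proof -
      have "\<not> 2 dvd n" using assms(3) by simp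
      then have "multiplicity 2 n = 0" by (rule not_dvd_imp_multiplicity_0)
      then show ?thesis unfolding assms(4) using \<open>n \<noteq> 0\<close>
        by (simp add: prime_elem_multiplicity_mult_distrib)
    qed
    then have syl: "sylow_subgroups 2 G = {S. subgroup S G \<and> card S = 2}" by (simp add: sylow_subgroups_def)
    \<comment> \<open>A subgroup of order 2 is determined by its involution, and the involutions are
      the \<open>n\<close> elements outside \<open>N\<close>.\<close>
    have "bij_betw (\<lambda>x. {\<one>\<^bsub>G\<^esub>, x}) (carrier G - N) (sylow_subgroups 2 G)"
    proof (rule bij_betw_imageI)
      show "inj_on (\<lambda>x. {\<one>\<^bsub>G\<^esub>, x}) (carrier G - N)"
        using not_N by (auto simp: inj_on_def doubleton_eq_iff)
      show "(\<lambda>x. {\<one>\<^bsub>G\<^esub>, x}) ` (carrier G - N) = sylow_subgroups 2 G"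
      proof (rule subset_antisym; rule subsetI)
        fix S assume "S \<in> (\<lambda>x. {\<one>\<^bsub>G\<^esub>, x}) ` (carrier G - N)"
        then obtain x where x: "x \<in> carrier G" "x \<notin> N" "S = {\<one>\<^bsub>G\<^esub>, x}" by blast
        have xx: "x \<otimes>\<^bsub>G\<^esub> x = \<one>\<^bsub>G\<^esub>" "x \<noteq> \<one>\<^bsub>G\<^esub>" using not_N[OF x(1,2)] by auto
        then have "inv\<^bsub>G\<^esub> x = x" using inv_eq_self_iff[OF x(1)] by simp
        then have "subgroup S G" using x(1) xx by (intro subgroupI) (auto simp: x(3))
        then show "S \<in> sylow_subgroups 2 G" using xx(2) by (simp add: syl x(3))
      next
        fix S assume "S \<in> sylow_subgroups 2 G"
        then have S: "subgroup S G" "card S = 2" by (auto simp: syl)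
        have one: "\<one>\<^bsub>G\<^esub> \<in> S" by (rule subgroup.one_closed[OF S(1)])
        obtain a b where "S = {a, b}" "a \<noteq> b" using S(2) by (auto simp: card_2_iff)
        then obtain x where x: "S = {\<one>\<^bsub>G\<^esub>, x}" "x \<noteq> \<one>\<^bsub>G\<^esub>" using one by auto
        have xG: "x \<in> carrier G" using subgroup.subset[OF S(1)] x by auto
        have "x \<otimes>\<^bsub>G\<^esub> x \<in> S" using subgroup.m_closed[OF S(1)] x by auto
        then have "x \<otimes>\<^bsub>G\<^esub> x = \<one>\<^bsub>G\<^esub>" using x xG by auto
        then have "\<sigma> x = -1" using \<sigma>_invol xG x(2) by blast
        then have "x \<in> carrier G - N" using xG by (simp add: N_def)
        then show "S \<in> (\<lambda>x. {\<one>\<^bsub>G\<^esub>, x}) ` (carrier G - N)" using x(1) by blast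
      qed
    qed
    then show ?thesis using cardN(2) by (simp add: num_sylow2_def bij_betw_same_card)
  qed
  from assms(3) obtain u where u: "n = 2 * u + 1" by (rule oddE)
  \<comment> \<open>Since \<open>n + 1 = 2 * (u + 1)\<close> and
    \<open>(2 * n) ^ (u + 1) = s * n\<close>, the power in the discriminant is
    \<open>s\<^sup>2 * n * n\<close>, and the division by \<open>n\<close> leaves
    \<open>s\<^sup>2 * n\<close>.\<close>
  define s where "s = 2 ^ (u + 1) * int n ^ u"
  have "sylow2_eps G = 1" using num assms(4) by (simp add: sylow2_eps_def)
  moreover have "int (order G) ^ (n + 1) = int n * (s\<^sup>2 * int n)"
  proof -
    have e: "n + 1 = (u + 1) + (u + 1)" using u by simp
    have p: "(2 * int n) ^ (u + 1) = s * int n" by (simp add: s_def power_mult_distrib)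
    have "int (order G) = 2 * int n" using assms(4) by simp
    then show ?thesis unfolding e power_add[of _ "u + 1" "u + 1"] by (simp only: p) (simp add: power2_eq_square)
  qed
  moreover have "int n \<noteq> 0" using u by simp
  moreover have "(order G - (n + 1)) div 2 = (n - 1) div 2" using assms(4) u by simp
  ultimately have "group_disc G = (-1) ^ ((n - 1) div 2) * (s\<^sup>2 * int n)"
    unfolding group_disc_def card_t num by simp
  also have "\<dots> = s\<^sup>2 * star (int n)" using star_eq_power[OF assms(3)] by simp
  finally have disc: "group_disc G = s\<^sup>2 * star (int n)" .
  have "coprime s m"
    unfolding s_def using cop_n odd_m by (simp add: coprime_commute coprime_left_2_iff_odd coprime_right_2_iff_odd)
  moreover have "s \<noteq> 0" "star (int n) \<noteq> 0" "m \<noteq> 0" using u odd_m by (auto simp: s_def star_def)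
  ultimately show ?thesis unfolding sym disc by (simp add: kronecker_square_mult)
qed

theorem theorem1p5:
  fixes G :: "('a, 'b) monoid_scheme" and m :: int
  assumes "group G" and "finite (carrier G)"
    and "odd_times_2group G \<or>
         (\<exists>n. odd n \<and> order G = 2 * n \<and> even_order_elements_are_involutions G)"
    and "coprime m (int (order G))"
  shows "elementary_symbol m G = kronecker (group_disc G) m"
  using assms elementary_symbol_odd_times_2group elementary_symbol_twice_odd by blast

end
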